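(* Let $n=1$. For $d\ge 4$, as a module for the joint action of $\mathfrak{spo}(2|1)$ and $\mathfrak{gl}(1|1)$, $$\mathrm{S}^{d}(E)^{\mathfrak{n}'^{+}}=\mathrm{V}^{2|1}_{(d)}\otimes \mathrm{V}^{1|1}_{(d+\frac12,-\frac12)}\ \oplus\ \mathrm{V}^{2|1}_{(d-1)}\otimes \mathrm{V}^{1|1}_{(d-\frac12,\frac12)},$$ where $\mathrm{V}^{2|1}_{(a)}$ (resp. $\mathrm{V}^{1|1}_{(b,c)}$) is the irreducible $\mathfrak{spo}(2|1)$-module of highest weight $(a)$ (resp. the irreducible $\mathfrak{gl}(1|1)$-module of highest weight $(b,c)$). Moreover, \begin{itemize} \item $\mathrm{S}^{0}(E)^{\mathfrak{n}'^{+}}=\mathrm{V}^{2|1}_{(0)}\otimes \mathrm{V}^{1|1}_{(\frac12,-\frac12)}$; \item $\mathrm{S}^{1}(E)^{\mathfrak{n}'^{+}}=\mathrm{V}^{2|1}_{(1)}\otimes \mathrm{V}^{1|1}_{(\frac32,-\frac12)}$; \item $\mathrm{S}^{2}(E)^{\mathfrak{n}'^{+}}=\mathrm{V}^{2|1}_{(2)}\otimes \mathrm{V}^{1|1}_{(\frac52,-\frac12)}\oplus \mathrm{V}^{2|1}_{(1)}\otimes \mathrm{V}^{1|1}_{(\frac32,\frac12)}$; \item $\mathrm{S}^{3}(E)^{\mathfrak{n}'^{+}}=\mathrm{V}^{2|1}_{(3)}\otimes \mathrm{V}^{1|1}_{(\frac72,-\frac12)}\oplus \mathrm{V}^{2|1}_{(2)}\otimes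 \mathrm{V}^{1|1}_{(\frac52,\frac12)}\oplus \mathrm{V}^{2|1}_{(0)}\otimes \mathrm{V}^{1|1}_{(\frac32,\frac32)}$. \end{itemize}
   Context: Everything is over $\mathbb{C}$. $V=\mathbb{C}^{2|1}$ has even basis vectors $u_1,u_2$ and odd basis vector $u_3$, and $$\mathfrak{spo}(2|1)=\left\{\begin{pmatrix} a&b&x\\ c&-a&y\\ -y&x&0\end{pmatrix}: a,b,c,x,y\in\mathbb{C}\right\}\subset\mathfrak{gl}(2|1).$$ With $\mathrm{E}_{i,j}$ the matrix units, the Cartan subalgebra is $\mathbb{C}(\mathrm{E}_{1,1}-\mathrm{E}_{2,2})$, the Borel subalgebra is $\mathfrak{b}^{\mathrm{spo}}=\mathbb{C}(\mathrm{E}_{1,1}-\mathrm{E}_{2,2})\oplus\mathbb{C}\mathrm{E}_{1,2}\oplus\mathbb{C}(\mathrm{E}_{1,3}+\mathrm{E}_{3,2})$, and a weight $(a)$ is the eigenvalue of $\mathrm{E}_{1,1}-\mathrm{E}_{2,2}$. $X'=\mathbb{C}^{1|1}$ has even basis vector $e$ and odd basis vector $f$; $E=V\otimes X'$ has even basis $x_1=u_1\otimes e$, $x_2=u_2\otimes e$, $x_3=u_3\otimes f$ and odd basis $\eta_1=u_1\otimes f$, $\eta_2=u_2\otimes f$, $\eta_3=u_3\otimes e$. $\mathrm{S}(E)=\mathbb{C}[x_1,x_2,x_3]\otimes\Lambda(\eta_1,\eta_2,\eta_3)$ with degree $d$ part $\mathrm{S}^d(E)$; $\mathfrak{spo}(2|1)$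 acts on $E$ by $X(v\otimes v')=Xv\otimes v'$ and on $\mathrm{S}(E)$ by superderivations. $\mathfrak{gl}(1|1)$ acts as the span of $F_{1,1}=x_1\partial_{x_1}+x_2\partial_{x_2}+\eta_3\partial_{\eta_3}+\frac12$, $F_{2,2}=\eta_1\partial_{\eta_1}+\eta_2\partial_{\eta_2}+x_3\partial_{x_3}-\frac12$, $F_{2,1}=x_3\partial_{\eta_3}-\eta_1\partial_{x_1}-\eta_2\partial_{x_2}$, $F_{1,2}=\eta_3\partial_{x_3}-x_1\partial_{\eta_1}-x_2\partial_{\eta_2}$; a highest weight vector of weight $(b,c)$ is killed by $F_{1,2}$ and has $F_{1,1}$- and $F_{2,2}$-eigenvalues $b$ and $c$. $\mathrm{S}^d(E)^{\mathfrak{n}'^{+}}=\{p\in\mathrm{S}^d(E): D_{12}p=D_{22}p=0\}$, where $D_{12}=\partial_{x_3}\partial_{\eta_3}+\partial_{x_1}\partial_{\eta_2}-\partial_{x_2}\partial_{\eta_1}$ and $D_{22}=\partial_{x_3}^2+2\partial_{\eta_1}\partial_{\eta_2}$. Irreducible highest weight modules are considered up to parity shift, and $\otimes$ is the outer tensor product. *)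

theory Defs
  imports "HOL-Analysis.Cartesian_Space" "HOL-Library.Function_Algebras"
begin

section \<open>Super vector spaces\<close>

text \<open>
  A complex vector space is a subspace of a function space \<open>'i \<Rightarrow> complex\<close> with pointwise operations
  (every complex vector space embeds into one).  A \<open>\<int>/2\<close>-grading on the index type \<open>'i\<close>
  (\<open>True\<close> means odd) induces one on \<open>'i \<Rightarrow> complex\<close>, and a super vector space is a graded subspace.
  This makes tensor products and direct sums concrete: they live in the function spaces over
  \<open>'i \<times> 'j\<close> and \<open>'i + 'j\<close>.
\<close>

definition cscale :: "complex \<Rightarrow> ('i \<Rightarrow> complex) \<Rightarrow> ('i \<Rightarrow> complex)" where
  "cscale c v = (\<lambda>i. c * v i)"

global_interpretation cfun: vector_space cscale
  by unfold_locales (auto simp: cscale_def fun_eq_iff algebra_simps)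

definition linear_on :: "('i \<Rightarrow> complex) set \<Rightarrow> (('i \<Rightarrow> complex) \<Rightarrow> ('j \<Rightarrow> complex)) \<Rightarrow> bool" where
  "linear_on U f \<longleftrightarrow>
     (\<forall>u\<in>U. \<forall>v\<in>U. f (u + v) = f u + f v) \<and> (\<forall>c. \<forall>u\<in>U. f (cscale c u) = cscale c (f u))"

definition hom_part :: "('i \<Rightarrow> bool) \<Rightarrow> bool \<Rightarrow> ('i \<Rightarrow> complex) \<Rightarrow> ('i \<Rightarrow> complex)" where
  "hom_part p s v = (\<lambda>i. if p i = s then v i else 0)"

definition graded_subspace :: "('i \<Rightarrow> bool) \<Rightarrow> ('i \<Rightarrow> complex) set \<Rightarrow> bool" where
  "graded_subspace p U \<longleftrightarrow> cfun.subspace U \<and> (\<forall>u\<in>U. \<forall>s. hom_part p s u \<in> U)"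

text \<open>\<open>v\<close> is homogeneous of parity \<open>s\<close> iff \<open>hom_part p s v = v\<close>.\<close>


section \<open>Matrix Lie superalgebras and their modules\<close>

definition mscale :: "complex \<Rightarrow> complex^'n^'n \<Rightarrow> complex^'n^'n" where
  "mscale c X = (\<chi> i j. c * X $ i $ j)"

definition mat_part :: "('n \<Rightarrow> bool) \<Rightarrow> bool \<Rightarrow> complex^'n^'n \<Rightarrow> complex^'n^'n" where
  "mat_part \<pi> s X = (\<chi> i j. if (\<pi> i \<noteq> \<pi> j) = s then X $ i $ j else 0)"

text \<open>The superbracket of matrices that are homogeneous of parities \<open>s\<close> and \<open>t\<close>.\<close>

definition super_bracket ::
    "bool \<Rightarrow> bool \<Rightarrow> complex^'n^'n \<Rightarrow> complex^'n^'n \<Rightarrow> complex^'n^'n" where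
  "super_bracket s t X Y = (if s \<and> t then X ** Y + Y ** X else X ** Y - Y ** X)"

record ('g, 'i) super_module =
  space :: "('i \<Rightarrow> complex) set"
  odd_idx :: "'i \<Rightarrow> bool"
  act :: "'g \<Rightarrow> ('i \<Rightarrow> complex) \<Rightarrow> ('i \<Rightarrow> complex)"

definition is_module ::
    "('n::finite \<Rightarrow> bool) \<Rightarrow> (complex^'n^'n) set \<Rightarrow> (complex^'n^'n, 'i) super_module \<Rightarrow> bool" where
  "is_module \<pi> \<gg> M \<longleftrightarrow>
     graded_subspace (odd_idx M) (space M) \<and>
     (\<forall>X\<in>\<gg>. \<forall>v\<in>space M. act M X v \<in> space M) \<and>
     (\<forall>X\<in>\<gg>. linear_on (space M) (act M X)) \<and>
     (\<forall>X\<in>\<gg>. \<forall>Y\<in>\<gg>. \<forall>v\<in>space M. act M (X + Y) v = act M X v + act M Y v) \<and>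
     (\<forall>c. \<forall>X\<in>\<gg>. \<forall>v\<in>space M. act M (mscale c X) v = cscale c (act M X v)) \<and>
     (\<forall>X\<in>\<gg>. \<forall>v\<in>space M. \<forall>s t. mat_part \<pi> s X = X \<and> hom_part (odd_idx M) t v = v \<longrightarrow>
        hom_part (odd_idx M) (s \<noteq> t) (act M X v) = act M X v) \<and>
     (\<forall>X\<in>\<gg>. \<forall>Y\<in>\<gg>. \<forall>v\<in>space M. \<forall>s t. mat_part \<pi> s X = X \<and> mat_part \<pi> t Y = Y \<longrightarrow>
        act M (super_bracket s t X Y) v =
          (if s \<and> t then act M X (act M Y v) + act M Y (act M X v)
           else act M X (act M Y v) - act M Y (act M X v)))"

definition irreducible_module ::
    "('n::finite \<Rightarrow> bool) \<Rightarrow> (complex^'n^'n) set \<Rightarrow> (complex^'n^'n, 'i) super_module \<Rightarrow> bool" where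
  "irreducible_module \<pi> \<gg> M \<longleftrightarrow>
     is_module \<pi> \<gg> M \<and> space M \<noteq> {0} \<and>
     (\<forall>U \<subseteq> space M. graded_subspace (odd_idx M) U \<and> (\<forall>X\<in>\<gg>. \<forall>u\<in>U. act M X u \<in> U) \<longrightarrow>
        U = {0} \<or> U = space M)"

definition mat_unit :: "'n \<Rightarrow> 'n \<Rightarrow> complex^'n^'n" where
  "mat_unit i j = (\<chi> k l. if k = i \<and> l = j then 1 else 0)"

definition odd3 :: "3 \<Rightarrow> bool" where "odd3 i \<longleftrightarrow> i = 3"

definition odd2 :: "2 \<Rightarrow> bool" where "odd2 j \<longleftrightarrow> j = 2"

definition spo21 :: "(complex^3^3) set" where
  "spo21 = {vector [vector [a, b, x], vector [c, -a, y], vector [-y, x, 0]] | a b c x y. True}"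

definition gl11 :: "(complex^2^2) set" where
  "gl11 = UNIV"

text \<open>
  The irreducible modules of highest weight \<open>(a)\<close>, resp. \<open>(b, c)\<close>; no condition is imposed on the
  parity of the highest weight vector, so these are determined up to isomorphism and parity shift.
\<close>

definition irr_spo21 :: "(complex^3^3, 'i) super_module \<Rightarrow> complex \<Rightarrow> bool" where
  "irr_spo21 M a \<longleftrightarrow>
     irreducible_module odd3 spo21 M \<and>
     (\<exists>v\<in>space M. v \<noteq> 0 \<and>
        act M (mat_unit 1 1 - mat_unit 2 2) v = cscale a v \<and>
        act M (mat_unit 1 2) v = 0 \<and>
        act M (mat_unit 1 3 + mat_unit 3 2) v = 0)"

definition irr_gl11 :: "(complex^2^2, 'i) super_module \<Rightarrow> complex \<Rightarrow> complex \<Rightarrow> bool" where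
  "irr_gl11 M b c \<longleftrightarrow>
     irreducible_module odd2 gl11 M \<and>
     (\<exists>v\<in>space M. v \<noteq> 0 \<and>
        act M (mat_unit 1 1) v = cscale b v \<and>
        act M (mat_unit 2 2) v = cscale c v \<and>
        act M (mat_unit 1 2) v = 0)"


section \<open>Joint modules\<close>

text \<open>
  A joint action of \<open>spo(2|1)\<close> and \<open>gl(1|1)\<close> is an action of pairs \<open>(X, Y)\<close>, the pair acting as the
  operator of \<open>X\<close> plus the operator of \<open>Y\<close>.
\<close>

type_synonym 'i joint_module = "((complex^3^3) \<times> (complex^2^2), 'i) super_module"

text \<open>
  In the outer tensor product, \<open>v \<otimes> w\<close> is the function \<open>(i, j) \<mapsto> v i * w j\<close>, and
  \<open>X (v \<otimes> w) = X v \<otimes> w\<close>, \<open>Y (v \<otimes> w) = (-1)^(|Y||v|) v \<otimes> Y w\<close>.  An element \<open>t\<close> of the tensor product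
  has columns \<open>\<lambda>i. t (i, j)\<close> in \<open>space M\<close> and rows \<open>\<lambda>j. t (i, j)\<close> in \<open>space N\<close>, so the linear
  extensions of these formulas are obtained by letting \<open>X\<close> act on columns and \<open>Y\<close> on rows.
\<close>

definition outer_tensor ::
    "(complex^3^3, 'i) super_module \<Rightarrow> (complex^2^2, 'j) super_module \<Rightarrow> ('i \<times> 'j) joint_module"
    (infixr "\<otimes>" 70) where
  "M \<otimes> N =
     \<lparr>space = cfun.span {\<lambda>(i, j). v i * w j | v w. v \<in> space M \<and> w \<in> space N},
      odd_idx = (\<lambda>(i, j). odd_idx M i \<noteq> odd_idx N j),
      act = (\<lambda>(X, Y) t (i, j).
        act M X (\<lambda>i'. t (i', j)) i
        + act N (mat_part odd2 False Y) (\<lambda>j'. t (i, j')) j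
        + (if odd_idx M i then -1 else 1) * act N (mat_part odd2 True Y) (\<lambda>j'. t (i, j')) j)\<rparr>"

definition direct_sum :: "('g, 'i) super_module \<Rightarrow> ('g, 'j) super_module \<Rightarrow> ('g, 'i + 'j) super_module"
    (infixr "\<oplus>" 65) where
  "M \<oplus> N =
     \<lparr>space = {case_sum v w | v w. v \<in> space M \<and> w \<in> space N},
      odd_idx = case_sum (odd_idx M) (odd_idx N),
      act = (\<lambda>X u. case_sum (act M X (u \<circ> Inl)) (act N X (u \<circ> Inr)))\<rparr>"

definition parity_shift :: "bool \<Rightarrow> ('g, 'i) super_module \<Rightarrow> ('g, 'i) super_module" where
  "parity_shift s M = M\<lparr>odd_idx := (\<lambda>i. odd_idx M i \<noteq> s)\<rparr>"

text \<open>Isomorphism by an even linear bijection commuting with both actions.\<close>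

definition joint_iso :: "'i joint_module \<Rightarrow> 'j joint_module \<Rightarrow> bool" (infix "\<cong>" 50) where
  "M \<cong> N \<longleftrightarrow>
     (\<exists>\<Phi>. linear_on (space M) \<Phi> \<and> bij_betw \<Phi> (space M) (space N) \<and>
        (\<forall>v\<in>space M. \<forall>s. \<Phi> (hom_part (odd_idx M) s v) = hom_part (odd_idx N) s (\<Phi> v)) \<and>
        (\<forall>X\<in>spo21. \<forall>Y\<in>gl11. \<forall>v\<in>space M.
           act M (X, Y) v \<in> space M \<and> \<Phi> (act M (X, Y) v) = act N (X, Y) (\<Phi> v)))"


section \<open>The supersymmetric algebra \<open>S(E)\<close>\<close>

datatype gen = X1 | X2 | X3 | Eta1 | Eta2 | Eta3

fun odd_gen :: "gen \<Rightarrow> bool" where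
  "odd_gen X1 = False" | "odd_gen X2 = False" | "odd_gen X3 = False"
| "odd_gen Eta1 = True" | "odd_gen Eta2 = True" | "odd_gen Eta3 = True"

text \<open>
  \<open>m :: gen \<Rightarrow> nat\<close> stands for the monomial
  \<open>x1^(m X1) x2^(m X2) x3^(m X3) \<eta>1^(m Eta1) \<eta>2^(m Eta2) \<eta>3^(m Eta3)\<close> (factors in this order); it is
  nonzero iff \<open>is_monomial m\<close>.  An element of \<open>S(E)\<close> is given by its coefficients
  \<open>p :: (gen \<Rightarrow> nat) \<Rightarrow> complex\<close>, which vanish outside \<open>is_monomial\<close>.
\<close>

definition is_monomial :: "(gen \<Rightarrow> nat) \<Rightarrow> bool" where
  "is_monomial m \<longleftrightarrow> m Eta1 \<le> 1 \<and> m Eta2 \<le> 1 \<and> m Eta3 \<le> 1"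

definition total_degree :: "(gen \<Rightarrow> nat) \<Rightarrow> nat" where
  "total_degree m = m X1 + m X2 + m X3 + m Eta1 + m Eta2 + m Eta3"

definition odd_monomial :: "(gen \<Rightarrow> nat) \<Rightarrow> bool" where
  "odd_monomial m \<longleftrightarrow> odd (m Eta1 + m Eta2 + m Eta3)"

text \<open>There are finitely many monomials of degree \<open>d\<close>, so finite support is automatic here.\<close>

definition S_deg :: "nat \<Rightarrow> ((gen \<Rightarrow> nat) \<Rightarrow> complex) set" where
  "S_deg d = {p. \<forall>m. p m \<noteq> 0 \<longrightarrow> is_monomial m \<and> total_degree m = d}"

text \<open>The sign from moving \<open>g\<close> past the odd variables to its left in the monomial \<open>m\<close>.\<close>

fun koszul_sign :: "gen \<Rightarrow> (gen \<Rightarrow> nat) \<Rightarrow> complex" where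
  "koszul_sign Eta2 m = (-1) ^ m Eta1"
| "koszul_sign Eta3 m = (-1) ^ (m Eta1 + m Eta2)"
| "koszul_sign _ m = 1"

text \<open>
  Left multiplication by a generator and the left partial derivative, by their coefficient at the
  monomial \<open>m\<close>.
\<close>

definition gmult :: "gen \<Rightarrow> ((gen \<Rightarrow> nat) \<Rightarrow> complex) \<Rightarrow> ((gen \<Rightarrow> nat) \<Rightarrow> complex)" where
  "gmult g p = (\<lambda>m. if is_monomial m \<and> m g > 0
                    then koszul_sign g m * p (m(g := m g - 1)) else 0)"

definition pd :: "gen \<Rightarrow> ((gen \<Rightarrow> nat) \<Rightarrow> complex) \<Rightarrow> ((gen \<Rightarrow> nat) \<Rightarrow> complex)" where
  "pd g p = (\<lambda>m. of_nat (m g + 1) * koszul_sign g m * p (m(g := m g + 1)))"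

text \<open>\<open>E_basis i j\<close> is \<open>u_i \<otimes> e\<close> for \<open>j = 1\<close> and \<open>u_i \<otimes> f\<close> for \<open>j = 2\<close>.\<close>

definition E_basis :: "3 \<Rightarrow> 2 \<Rightarrow> gen" where
  "E_basis i j =
     (if j = 1 then (if i = 1 then X1 else if i = 2 then X2 else Eta3)
      else (if i = 1 then Eta1 else if i = 2 then Eta2 else X3))"

text \<open>
  The superderivation of \<open>S(E)\<close> extending a linear map \<open>A\<close> of \<open>E\<close> is the sum of \<open>A(g) \<partial>\<^sub>g\<close> over the
  basis elements \<open>g\<close> of \<open>E\<close>; here \<open>A = X \<otimes> 1\<close>, so \<open>A (u_k \<otimes> v')\<close> is the sum over \<open>i\<close> of
  \<open>X\<^sub>i\<^sub>k (u_i \<otimes> v')\<close>.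
\<close>

definition spo_op :: "complex^3^3 \<Rightarrow> ((gen \<Rightarrow> nat) \<Rightarrow> complex) \<Rightarrow> ((gen \<Rightarrow> nat) \<Rightarrow> complex)" where
  "spo_op X p = (\<Sum>k\<in>UNIV. \<Sum>j\<in>UNIV. \<Sum>i\<in>UNIV.
     cscale (X $ i $ k) (gmult (E_basis i j) (pd (E_basis k j) p)))"

definition F11 :: "((gen \<Rightarrow> nat) \<Rightarrow> complex) \<Rightarrow> ((gen \<Rightarrow> nat) \<Rightarrow> complex)" where
  "F11 p = gmult X1 (pd X1 p) + gmult X2 (pd X2 p) + gmult Eta3 (pd Eta3 p) + cscale (1/2) p"

definition F22 :: "((gen \<Rightarrow> nat) \<Rightarrow> complex) \<Rightarrow> ((gen \<Rightarrow> nat) \<Rightarrow> complex)" where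
  "F22 p = gmult Eta1 (pd Eta1 p) + gmult Eta2 (pd Eta2 p) + gmult X3 (pd X3 p) - cscale (1/2) p"

definition F21 :: "((gen \<Rightarrow> nat) \<Rightarrow> complex) \<Rightarrow> ((gen \<Rightarrow> nat) \<Rightarrow> complex)" where
  "F21 p = gmult X3 (pd Eta3 p) - gmult Eta1 (pd X1 p) - gmult Eta2 (pd X2 p)"

definition F12 :: "((gen \<Rightarrow> nat) \<Rightarrow> complex) \<Rightarrow> ((gen \<Rightarrow> nat) \<Rightarrow> complex)" where
  "F12 p = gmult Eta3 (pd X3 p) - gmult X1 (pd Eta1 p) - gmult X2 (pd Eta2 p)"

text \<open>The matrix unit \<open>E\<^sub>i\<^sub>j\<close> of \<open>gl(1|1)\<close> acts as \<open>F\<^sub>i\<^sub>j\<close>.\<close>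

definition gl_op :: "complex^2^2 \<Rightarrow> ((gen \<Rightarrow> nat) \<Rightarrow> complex) \<Rightarrow> ((gen \<Rightarrow> nat) \<Rightarrow> complex)" where
  "gl_op Y p = cscale (Y $ 1 $ 1) (F11 p) + cscale (Y $ 1 $ 2) (F12 p)
             + cscale (Y $ 2 $ 1) (F21 p) + cscale (Y $ 2 $ 2) (F22 p)"

definition D12 :: "((gen \<Rightarrow> nat) \<Rightarrow> complex) \<Rightarrow> ((gen \<Rightarrow> nat) \<Rightarrow> complex)" where
  "D12 p = pd X3 (pd Eta3 p) + pd X1 (pd Eta2 p) - pd X2 (pd Eta1 p)"

definition D22 :: "((gen \<Rightarrow> nat) \<Rightarrow> complex) \<Rightarrow> ((gen \<Rightarrow> nat) \<Rightarrow> complex)" where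
  "D22 p = pd X3 (pd X3 p) + cscale 2 (pd Eta1 (pd Eta2 p))"

definition S_inv :: "nat \<Rightarrow> (gen \<Rightarrow> nat) joint_module" where
  "S_inv d =
     \<lparr>space = {p \<in> S_deg d. D12 p = 0 \<and> D22 p = 0},
      odd_idx = odd_monomial,
      act = (\<lambda>(X, Y) p. spo_op X p + gl_op Y p)\<rparr>"

end

(* Write e and f for the odd root vectors of spo(2|1) and H = E11 - E22. Since e f + f e = - H, e^2 = E12 and
   f^2 = - E21, a module is determined by e and f, and a vector v with e v = 0, H v = a v generates vectors f^k v
   with e f^k v a known multiple of f^(k-1) v; irreducibility forces f^(2a+1) v = 0, so f^k v (k <= 2a) is a basis.
   In the same way an irreducible gl(1|1)-module of highest weight (b, c) has basis w, E21 w, where E21 w = 0 iff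
   b + c = 0. This gives every module in the theorem a basis on which the joint action has explicit structure
   constants, and two modules with the same constants are isomorphic.

   On S^d(E) one has F12 F21 + F21 F12 = d, so S_inv d = K + F21 K (direct, for d > 0) with K the kernel of F12.
   Comparing coefficients in D12 p = D22 p = F12 p = 0 shows that p in K is determined by its coefficients at the
   monomials of degree at most 1 in x3 without eta1, eta2, and at eta1 eta2 eta3. By weights these coordinates are
   dual, up to scalars, to the vectors f^k q for q = x1^d, q = x1^(d-1) x3 + x1^(d-2) eta1 eta3 (d >= 2) and
   q = x3^2 eta3 + x2 x3 eta1 - x1 x3 eta2 + eta1 eta2 eta3 (d = 3 only). *)

theory Submission
  imports Defs
begin

section \<open>Linear combinations in function spaces\<close>

text \<open>The modules \<open>V a\<close> and \<open>W b c\<close> are arbitrary irreducible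
  modules inside arbitrary function spaces; neither finite dimension nor the parity of a highest
  weight vector is given. So the isomorphisms are built from bases instead of a dimension count, and
  each summand carries a parity shift chosen to match the parity of its vector in S(E). Koszul signs
  are the other obstacle: the odd operators of the two algebras anticommute, so E21 picks up (-1)^k
  on passing f^k, and the sign rule of the outer tensor product has to be brought to this normal
  form by rescaling. On S(E) the shifts by 1/2 in F11 and F22 cancel in the sum, which is the degree
  operator. Hence b + c = d in every summand, only d = 0 is atypical, and c tells the summands
  apart. The vectors f^k q are eigenvectors of H and F22, and so are all monomials; each f^k q is
  therefore zero at every selected monomial except its own. That the selected coordinates separate
  the elements of K then gives spanning, independence and f^k q = 0 for k > 2a together.\<close>

lemma cscale_apply [simp]: "cscale c v i = c * v i"
  by (simp add: cscale_def)

lemma cscale_add: "cscale c (u + v) = cscale c u + cscale c v"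
  and cscale_diff: "cscale c (u - v) = cscale c u - cscale c v"
  and cscale_cscale: "cscale c (cscale c' u) = cscale (c * c') u"
  and cscale_zero_right [simp]: "cscale c 0 = 0"
  and cscale_zero_left [simp]: "cscale 0 u = 0"
  and cscale_one [simp]: "cscale 1 u = u"
  by (auto simp: fun_eq_iff algebra_simps)

lemma cscale_eq_0_iff: "cscale c u = 0 \<longleftrightarrow> c = 0 \<or> u = 0"
  by (auto simp: fun_eq_iff)

section \<open>Creation and annihilation operators on \<open>S(E)\<close>\<close>

text \<open>Degree and support are left free, so the operator identities below hold for all degrees
  at once. Vanishing outside monomials is what makes them true: \<open>pd\<close> of an odd variable
  may read a coefficient with exponent 2 in that variable, which has to be 0.\<close>

definition S_all :: "((gen \<Rightarrow> nat) \<Rightarrow> complex) set" where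
  "S_all = {p. \<forall>m. p m \<noteq> 0 \<longrightarrow> is_monomial m}"

lemma S_deg_subset_S_all: "p \<in> S_deg d \<Longrightarrow> p \<in> S_all"
  by (auto simp: S_deg_def S_all_def)

definition sgn_gen :: "gen \<Rightarrow> gen \<Rightarrow> complex" where
  "sgn_gen g h = (if odd_gen g \<and> odd_gen h then -1 else 1)"

lemma S_all_0 [simp]: "0 \<in> S_all"
  and S_all_add [simp]: "p \<in> S_all \<Longrightarrow> q \<in> S_all \<Longrightarrow> p + q \<in> S_all"
  and S_all_diff [simp]: "p \<in> S_all \<Longrightarrow> q \<in> S_all \<Longrightarrow> p - q \<in> S_all"
  and S_all_scale [simp]: "p \<in> S_all \<Longrightarrow> cscale c p \<in> S_all"
  and S_all_minus [simp]: "p \<in> S_all \<Longrightarrow> - p \<in> S_all"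
  by (auto simp: S_all_def) (metis add.right_neutral) +

lemma S_all_gmult [simp]: "gmult g p \<in> S_all"
  by (auto simp: S_all_def gmult_def)

lemma S_all_pd [simp]: "p \<in> S_all \<Longrightarrow> pd g p \<in> S_all"
  by (cases g) (fastforce simp: S_all_def pd_def is_monomial_def split: if_splits)+

lemma gmult_add: "gmult g (p + q) = gmult g p + gmult g q"
  and gmult_diff: "gmult g (p - q) = gmult g p - gmult g q"
  and gmult_minus: "gmult g (- p) = - gmult g p"
  and gmult_cscale: "gmult g (cscale c p) = cscale c (gmult g p)"
  and gmult_0: "gmult g 0 = 0"
  by (auto simp: fun_eq_iff gmult_def algebra_simps)

lemma pd_add: "pd g (p + q) = pd g p + pd g q"
  and pd_diff: "pd g (p - q) = pd g p - pd g q"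
  and pd_minus: "pd g (- p) = - pd g p"
  and pd_cscale: "pd g (cscale c p) = cscale c (pd g p)"
  and pd_0: "pd g 0 = 0"
  by (auto simp: fun_eq_iff pd_def algebra_simps)

lemma le_Suc_0_cases: "(n::nat) \<le> Suc 0 \<Longrightarrow> n = 0 \<or> n = 1"
  by auto

lemma S_all_zero: "p \<in> S_all \<Longrightarrow> \<not> is_monomial m \<Longrightarrow> p m = 0"
  by (auto simp: S_all_def)

lemma pd_pd:
  assumes "p \<in> S_all"
  shows "pd g (pd h p) = cscale (sgn_gen g h) (pd h (pd g p))"
proof
  fix m
  show "pd g (pd h p) m = cscale (sgn_gen g h) (pd h (pd g p)) m"
  proof (cases "g = h")
    case True
    then show ?thesis
      \<comment> \<open>For odd \<open>g\<close> the rule makes the square its own negative; both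
        sides are 0 because they read \<open>p\<close> at exponent at least 2 in
        \<open>g\<close>.\<close>
      using S_all_zero[OF assms, of "m(g := Suc (Suc (m g)))"]
      by (cases h) (auto simp: pd_def sgn_gen_def is_monomial_def)
  next
    case False
    then show ?thesis
      by (cases g; cases h) (simp_all add: pd_def sgn_gen_def power_add fun_upd_twist)
  qed
qed

lemma pd_pd_odd:
  assumes "p \<in> S_all" "odd_gen g"
  shows "pd g (pd g p) = 0"
proof -
  have "pd g (pd g p) m = 0" for m
    using pd_pd[OF assms(1), of g g] assms(2) by (auto simp: sgn_gen_def fun_eq_iff)
  then show ?thesis by (auto simp: fun_eq_iff)
qed

lemma gmult_gmult:
  shows "gmult g (gmult h p) = cscale (sgn_gen g h) (gmult h (gmult g p))"
proof
  fix m :: "gen \<Rightarrow> nat"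
  have *: "m(g := m g - 1, h := m h - 1) = m(h := m h - 1, g := m g - 1)" if "g \<noteq> h"
    using that by (simp add: fun_upd_twist)
  show "gmult g (gmult h p) m = cscale (sgn_gen g h) (gmult h (gmult g p)) m"
  proof (cases "g = h")
    case True
    then show ?thesis
      by (cases h) (auto simp: gmult_def sgn_gen_def is_monomial_def)
  next
    case False
    show ?thesis
      using False *[OF False]
      by (cases g; cases h)
        (auto simp: gmult_def sgn_gen_def is_monomial_def fun_upd_twist dest: le_Suc_0_cases)
  qed
qed

lemma gmult_gmult_odd:
  assumes "odd_gen g"
  shows "gmult g (gmult g p) = 0"
proof -
  have "gmult g (gmult g p) m = 0" for m
    using gmult_gmult[of g g p] assms by (auto simp: sgn_gen_def fun_eq_iff)
  then show ?thesis by (auto simp: fun_eq_iff)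
qed

text \<open>The relation of the Weyl-Clifford algebra: an anticommutator for two odd generators and
  a commutator otherwise. Together with \<open>pd_pd\<close> and \<open>gmult_gmult\<close> it
  reduces identities between the operators below to a comparison of normal forms.\<close>

lemma pd_gmult:
  assumes "p \<in> S_all"
  shows "pd g (gmult h p) = (if g = h then p else 0) + cscale (sgn_gen g h) (gmult h (pd g p))"
proof
  fix m
  show "pd g (gmult h p) m = ((if g = h then p else 0) + cscale (sgn_gen g h) (gmult h (pd g p))) m"
  proof (cases "is_monomial m")
    case True
    then show ?thesis
      using S_all_zero[OF assms, of "m(g := Suc (m g), h := (m(g := Suc (m g))) h - 1)"]
      by (cases g; cases h)
        (auto simp: gmult_def pd_def sgn_gen_def is_monomial_def fun_upd_twist fun_upd_idem algebra_simps dest!: le_Suc_0_cases)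
  next
    case False
    then show ?thesis
      using S_all_zero[OF assms False] 
      by (cases g; cases h)
         (auto simp: gmult_def pd_def sgn_gen_def is_monomial_def fun_upd_twist fun_upd_idem algebra_simps)
  qed
qed

text \<open>An arbitrary linear order of the generators: the supercommutation rules would loop as
  rewrite rules, so they are oriented to sort each product by this rank.\<close>

fun gen_rank :: "gen \<Rightarrow> nat" where
  "gen_rank X1 = 0" | "gen_rank X2 = 1" | "gen_rank X3 = 2"
| "gen_rank Eta1 = 3" | "gen_rank Eta2 = 4" | "gen_rank Eta3 = 5"

lemma gmult_sort: "gen_rank h < gen_rank g \<Longrightarrow> gmult g (gmult h p) = cscale (sgn_gen g h) (gmult h (gmult g p))"
  and pd_sort: "gen_rank h < gen_rank g \<Longrightarrow> p \<in> S_all \<Longrightarrow> pd g (pd h p) = cscale (sgn_gen g h) (pd h (pd g p))"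
  by (rule gmult_gmult, rule pd_pd)

lemmas normal_order = pd_gmult gmult_sort pd_sort gmult_gmult_odd pd_pd_odd
  gmult_add gmult_diff gmult_cscale gmult_minus gmult_0 pd_add pd_diff pd_cscale pd_minus pd_0 sgn_gen_def

section \<open>The operators of spo(2|1) and gl(1|1) on S(E) and their relations\<close>

definition e_op :: "((gen \<Rightarrow> nat) \<Rightarrow> complex) \<Rightarrow> ((gen \<Rightarrow> nat) \<Rightarrow> complex)" where
  "e_op p = gmult X1 (pd Eta3 p) + gmult Eta1 (pd X3 p) + gmult Eta3 (pd X2 p) + gmult X3 (pd Eta2 p)"

definition f_op :: "((gen \<Rightarrow> nat) \<Rightarrow> complex) \<Rightarrow> ((gen \<Rightarrow> nat) \<Rightarrow> complex)" where
  "f_op p = gmult X2 (pd Eta3 p) + gmult Eta2 (pd X3 p) - gmult Eta3 (pd X1 p) - gmult X3 (pd Eta1 p)"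

definition h_op :: "((gen \<Rightarrow> nat) \<Rightarrow> complex) \<Rightarrow> ((gen \<Rightarrow> nat) \<Rightarrow> complex)" where
  "h_op p = gmult X1 (pd X1 p) + gmult Eta1 (pd Eta1 p) - gmult X2 (pd X2 p) - gmult Eta2 (pd Eta2 p)"

lemmas op_defs = e_op_def f_op_def h_op_def F11_def F22_def F12_def F21_def D12_def D22_def

lemma ops_S_all [simp]:
  "e_op p \<in> S_all" "f_op p \<in> S_all" "h_op p \<in> S_all" "F12 p \<in> S_all" "F21 p \<in> S_all"
  by (auto simp: op_defs)

lemma 
  assumes "p \<in> S_all"
  shows e_op_f_op: "e_op (f_op p) = - h_op p - f_op (e_op p)"
    and h_op_e_op: "h_op (e_op p) = e_op (h_op p) + e_op p"
    and h_op_f_op: "h_op (f_op p) = f_op (h_op p) - f_op p"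
  using assms
  by (simp_all add: op_defs normal_order)

text \<open>\<open>D12\<close> is odd and \<open>D22\<close> is even, and both supercommute with
  spo(2|1); hence the sign for \<open>D12\<close> only. This makes the spaces \<open>S_inv d\<close>
  stable under \<open>e_op\<close> and \<open>f_op\<close>.\<close>

lemma 
  assumes "p \<in> S_all"
  shows D12_e_op: "D12 (e_op p) = - e_op (D12 p)"
    and D12_f_op: "D12 (f_op p) = - f_op (D12 p)"
    and D22_e_op: "D22 (e_op p) = e_op (D22 p)"
    and D22_f_op: "D22 (f_op p) = f_op (D22 p)"
  using assms
     apply (simp_all add: op_defs normal_order)
     apply (simp_all add: fun_eq_iff algebra_simps)
  done

text \<open>The actions of the two superalgebras supercommute on S(E), so the odd operators
  \<open>F12\<close> and \<open>F21\<close> anticommute with \<open>e_op\<close> and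
  \<open>f_op\<close>. This is the origin of the factor (-1)^k in \<open>std_act\<close>.\<close>

lemma 
  assumes "p \<in> S_all"
  shows F12_e_op: "F12 (e_op p) = - e_op (F12 p)"
    and F12_f_op: "F12 (f_op p) = - f_op (F12 p)"
    and F21_e_op: "F21 (e_op p) = - e_op (F21 p)"
    and F21_f_op: "F21 (f_op p) = - f_op (F21 p)"
    and F11_e_op: "F11 (e_op p) = e_op (F11 p)"
    and F11_f_op: "F11 (f_op p) = f_op (F11 p)"
    and F22_e_op: "F22 (e_op p) = e_op (F22 p)"
    and F22_f_op: "F22 (f_op p) = f_op (F22 p)"
  using assms
         apply (simp_all add: op_defs normal_order)
         apply (simp_all add: fun_eq_iff algebra_simps)
  done

text \<open>gl(1|1) mixes the two equations: bracketing with \<open>F12\<close> turns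
  \<open>D12\<close> into \<open>D22\<close>, and bracketing with \<open>F21\<close> turns
  \<open>D22\<close> into a multiple of \<open>D12\<close>. So it is the common kernel that is
  stable.\<close>

lemma
  assumes "p \<in> S_all"
  shows D12_F12: "D12 (F12 p) = D22 p - F12 (D12 p)"
    and D12_F21: "D12 (F21 p) = - F21 (D12 p)"
    and D22_F12: "D22 (F12 p) = F12 (D22 p)"
    and D22_F21: "D22 (F21 p) = F21 (D22 p) + cscale 2 (D12 p)"
  using assms
  apply (simp_all add: op_defs normal_order)
  apply (simp_all add: fun_eq_iff algebra_simps)
  done

lemma
  assumes "p \<in> S_all"
  shows F12_F21: "F12 (F21 p) = F11 p + F22 p - F21 (F12 p)"
    and F12_F12: "F12 (F12 p) = 0"
    and F21_F21: "F21 (F21 p) = 0"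
    and F11_F21: "F11 (F21 p) = F21 (F11 p) - F21 p"
    and F22_F21: "F22 (F21 p) = F21 (F22 p) + F21 p"
  using assms
  apply (simp_all add: op_defs normal_order)
  apply (simp_all add: fun_eq_iff algebra_simps)
  done

lemma spo21_entries:
  assumes "X \<in> spo21"
  shows "X $ 2 $ 2 = - X $ 1 $ 1" "X $ 3 $ 1 = - X $ 2 $ 3" "X $ 3 $ 2 = X $ 1 $ 3" "X $ 3 $ 3 = 0"
  using assms by (auto simp: spo21_def)

lemma spo_op_eq:
  assumes "p \<in> S_all" "X \<in> spo21"
  shows "spo_op X p = cscale (X $ 1 $ 1) (h_op p) + cscale (X $ 1 $ 2) (e_op (e_op p))
    - cscale (X $ 2 $ 1) (f_op (f_op p)) + cscale (X $ 1 $ 3) (e_op p) + cscale (X $ 2 $ 3) (f_op p)"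
  using assms(1)
  apply (simp add: spo_op_def sum_3 sum_2 E_basis_def spo21_entries[OF assms(2)] op_defs normal_order)
  apply (simp add: fun_eq_iff algebra_simps)
  done

section \<open>Bases with prescribed structure constants\<close>

definition lc :: "'x set \<Rightarrow> ('x \<Rightarrow> complex) \<Rightarrow> ('x \<Rightarrow> 'i \<Rightarrow> complex) \<Rightarrow> 'i \<Rightarrow> complex" where
  "lc I c B = (\<Sum>x\<in>I. cscale (c x) (B x))"

lemma sum_fun_apply: "(\<Sum>x\<in>I. F x) i = (\<Sum>x\<in>I. F x i :: complex)"
  by (induction I rule: infinite_finite_induct) auto

lemma lc_apply: "lc I c B i = (\<Sum>x\<in>I. c x * B x i)"
  by (simp add: lc_def sum_fun_apply)

lemma lc_add: "lc I (\<lambda>x. c x + d x) B = lc I c B + lc I d B"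
  and lc_cscale: "lc I (\<lambda>x. r * c x) B = cscale r (lc I c B)"
  and lc_diff: "lc I (\<lambda>x. c x - d x) B = lc I c B - lc I d B"
  and lc_zero: "lc I (\<lambda>x. 0) B = 0"
  by (auto simp: fun_eq_iff lc_apply algebra_simps sum.distrib sum_distrib_left sum_subtractf)

lemma lc_cong: "(\<And>x. x \<in> I \<Longrightarrow> c x = d x) \<Longrightarrow> (\<And>x. x \<in> I \<Longrightarrow> B x = C x) \<Longrightarrow> lc I c B = lc I d C"
  by (simp add: lc_def)

lemma lc_indicator:
  assumes "finite I" "x \<in> I"
  shows "lc I (\<lambda>y. if y = x then 1 else 0) B = B x"
proof -
  have "lc I (\<lambda>y. if y = x then 1 else 0) B = (\<Sum>y\<in>I. if y = x then B y else 0)"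
    unfolding lc_def by (rule sum.cong) auto
  then show ?thesis using assms by simp
qed

lemma lc_insert: "finite I \<Longrightarrow> x \<notin> I \<Longrightarrow> lc (insert x I) c B = cscale (c x) (B x) + lc I c B"
  unfolding lc_def by (rule sum.insert)

lemma subspace_lc: "cfun.subspace U \<Longrightarrow> (\<And>x. x \<in> I \<Longrightarrow> B x \<in> U) \<Longrightarrow> lc I c B \<in> U"
  unfolding lc_def by (intro cfun.subspace_sum cfun.subspace_scale) auto

lemma subspace_range_lc: "cfun.subspace (range (\<lambda>c. lc I c B))"
proof (rule cfun.subspaceI)
  show "0 \<in> range (\<lambda>c. lc I c B)"
    using lc_zero[of I B] by (metis rangeI)
  fix u v assume "u \<in> range (\<lambda>c. lc I c B)" "v \<in> range (\<lambda>c. lc I c B)"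
  then show "u + v \<in> range (\<lambda>c. lc I c B)"
    by (auto simp: lc_add[symmetric])
next
  fix r u assume "u \<in> range (\<lambda>c. lc I c B)"
  then show "cscale r u \<in> range (\<lambda>c. lc I c B)"
    by (auto simp: lc_cscale[symmetric])
qed

lemma linear_onD:
  assumes "linear_on U f"
  shows "u \<in> U \<Longrightarrow> v \<in> U \<Longrightarrow> f (u + v) = f u + f v"
    and "u \<in> U \<Longrightarrow> f (cscale c u) = cscale c (f u)"
  using assms by (auto simp: linear_on_def)

lemma linear_on_0:
  assumes "linear_on U f" "cfun.subspace U"
  shows "f 0 = 0"
  using linear_onD(2)[OF assms(1) cfun.subspace_0[OF assms(2)], of 0] by simp

lemma linear_on_diff:
  assumes "linear_on U f" "cfun.subspace U" "u \<in> U" "v \<in> U"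
  shows "f (u - v) = f u - f v"
proof -
  have "cscale (-1) v \<in> U" using assms(2,4) by (rule cfun.subspace_scale)
  then have "f (u + cscale (-1) v) = f u + cscale (-1) (f v)"
    using linear_onD(1)[OF assms(1,3)] linear_onD(2)[OF assms(1,4)] by metis
  moreover have "u + cscale (-1) v = u - v" "f u + cscale (-1) (f v) = f u - f v"
    by (auto simp: fun_eq_iff)
  ultimately show ?thesis by simp
qed

lemma linear_on_lc:
  assumes "linear_on U f" "cfun.subspace U" "\<And>x. x \<in> I \<Longrightarrow> B x \<in> U"
  shows "f (lc I c B) = lc I c (\<lambda>x. f (B x))"
  using assms(3)
proof (induction I rule: infinite_finite_induct)
  case (insert x I)
  have "lc I c B \<in> U" "cscale (c x) (B x) \<in> U"
    using insert assms(2) by (auto intro: subspace_lc cfun.subspace_scale)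
  then have "f (cscale (c x) (B x) + lc I c B) = cscale (c x) (f (B x)) + f (lc I c B)"
    using insert.prems linear_onD[OF assms(1)] by auto
  moreover have "f (lc I c B) = lc I c (\<lambda>x. f (B x))"
    by (rule insert.IH) (simp add: insert.prems)
  ultimately show ?case
    by (simp only: lc_insert[OF insert.hyps])
qed (auto simp: lc_def linear_on_0[OF assms(1,2)])

lemma hom_part_apply [simp]: "hom_part p s v i = (if p i = s then v i else 0)"
  by (simp add: hom_part_def)

lemma hom_part_zero [simp]: "hom_part p s 0 = 0"
  and hom_part_add: "hom_part p s (u + v) = hom_part p s u + hom_part p s v"
  and hom_part_cscale: "hom_part p s (cscale c v) = cscale c (hom_part p s v)"
  and hom_part_idem: "hom_part p s (hom_part p s v) = hom_part p s v"
  and hom_part_split: "v = hom_part p True v + hom_part p False v"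
  by (auto simp: fun_eq_iff)

lemma hom_part_eq_iff: "hom_part p s v = v \<longleftrightarrow> (\<forall>i. v i \<noteq> 0 \<longrightarrow> p i = s)"
  by (auto simp: fun_eq_iff)

lemma hom_part_lc:
  assumes "\<And>x. x \<in> I \<Longrightarrow> hom_part p (par x) (B x) = B x"
  shows "hom_part p s (lc I c B) = lc I (\<lambda>x. if par x = s then c x else 0) B"
proof
  fix i
  have "par x = p i \<or> B x i = 0" if "x \<in> I" for x
    using assms[OF that] unfolding hom_part_eq_iff by metis
  then have "lc I (\<lambda>x. if par x = s then c x else 0) B i = (\<Sum>x\<in>I. if p i = s then c x * B x i else 0)"
    unfolding lc_apply by (intro sum.cong) force+
  then show "hom_part p s (lc I c B) i = lc I (\<lambda>x. if par x = s then c x else 0) B i"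
    by (simp add: lc_apply)
qed

text \<open>The family is required to vanish off the index set so that formulas such as
  \<open>std_act\<close> may name neighbours of an index without asking whether they are still in
  range.\<close>

definition basis_on :: "'x set \<Rightarrow> ('x \<Rightarrow> 'i \<Rightarrow> complex) \<Rightarrow> ('i \<Rightarrow> complex) set \<Rightarrow> bool" where
  "basis_on I B U \<longleftrightarrow> finite I \<and> (\<forall>x. x \<notin> I \<longrightarrow> B x = 0) \<and> U = range (\<lambda>c. lc I c B) \<and>
     (\<forall>c. lc I c B = 0 \<longrightarrow> (\<forall>x\<in>I. c x = 0))"

lemma basis_onD:
  assumes "basis_on I B U"
  shows "finite I" "x \<notin> I \<Longrightarrow> B x = 0" "lc I c B \<in> U" "u \<in> U \<Longrightarrow> \<exists>c. u = lc I c B"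
    "cfun.subspace U" "B x \<in> U"
proof -
  show *: "finite I" using assms by (auto simp: basis_on_def)
  show **: "x \<notin> I \<Longrightarrow> B x = 0" using assms by (auto simp: basis_on_def)
  show "u \<in> U \<Longrightarrow> \<exists>c. u = lc I c B" using assms by (auto simp: basis_on_def)
  have lcU: "lc I c B \<in> U" for c using assms by (auto simp: basis_on_def)
  show "lc I c B \<in> U" by (rule lcU)
  show "cfun.subspace U"
    using assms subspace_range_lc[of I B] by (auto simp: basis_on_def)
  show "B x \<in> U"
    using lc_indicator[OF *, of x B] lcU[of "\<lambda>y. if y = x then 1 else 0"] lcU[of "\<lambda>_. 0"] **
    by (cases "x \<in> I") (auto simp: lc_zero)
qed

lemma basis_on_unique:
  assumes "basis_on I B U" "lc I c B = lc I d B" "x \<in> I"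
  shows "c x = d x"
proof -
  have "lc I (\<lambda>x. c x - d x) B = 0" using assms(2) by (simp add: lc_diff)
  then show ?thesis using assms by (auto simp: basis_on_def)
qed

lemma basis_on_linear_map:
  assumes B: "basis_on I B U" and B': "basis_on I B' U'"
  obtains \<Phi> where "linear_on U \<Phi>" "bij_betw \<Phi> U U'" "\<And>c. \<Phi> (lc I c B) = lc I c B'" "\<And>x. \<Phi> (B x) = B' x"
proof -
  \<comment> \<open>The chosen coefficients are arbitrary off \<open>I\<close>, but on
    \<open>I\<close> they agree with any other choice by \<open>basis_on_unique\<close>.\<close>
  define \<Phi> where "\<Phi> u = lc I (SOME c. u = lc I c B) B'" for u
  have \<Phi>: "\<Phi> (lc I c B) = lc I c B'" for c
  proof -
    have "lc I c B = lc I (SOME d. lc I c B = lc I d B) B"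
      by (rule someI[of "\<lambda>d. lc I c B = lc I d B" c]) simp
    from basis_on_unique[OF B this] show ?thesis
      unfolding \<Phi>_def by (intro lc_cong) auto
  qed
  have "linear_on U \<Phi>"
    unfolding linear_on_def
  proof (intro conjI ballI allI)
    fix u v assume "u \<in> U" "v \<in> U"
    then obtain c d where "u = lc I c B" "v = lc I d B"
      using basis_onD(4)[OF B] by blast
    then show "\<Phi> (u + v) = \<Phi> u + \<Phi> v"
      by (simp only: \<Phi> lc_add[symmetric])
  next
    fix r u assume "u \<in> U"
    then obtain c where "u = lc I c B"
      using basis_onD(4)[OF B] by blast
    then show "\<Phi> (cscale r u) = cscale r (\<Phi> u)"
      by (simp only: \<Phi> lc_cscale[symmetric])
  qed
  moreover have "bij_betw \<Phi> U U'"
    unfolding bij_betw_def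
  proof
    show "inj_on \<Phi> U"
    proof (rule inj_onI)
      fix u v assume "u \<in> U" "v \<in> U" "\<Phi> u = \<Phi> v"
      then obtain c d where cd: "u = lc I c B" "v = lc I d B"
        using basis_onD(4)[OF B] by blast
      then have "lc I c B' = lc I d B'" using \<open>\<Phi> u = \<Phi> v\<close> by (simp add: \<Phi>)
      from basis_on_unique[OF B' this] show "u = v" unfolding cd by (intro lc_cong) auto
    qed
    show "\<Phi> ` U = U'"
      using B B' by (auto simp: basis_on_def image_iff \<Phi>)
  qed
  moreover have "\<Phi> (B x) = B' x" for x
    using \<Phi>[of "\<lambda>y. if y = x then 1 else 0"] \<Phi>[of "\<lambda>y. 0"] basis_onD(1,2)[OF B] basis_onD(2)[OF B']
    by (cases "x \<in> I") (auto simp: lc_indicator lc_zero)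
  ultimately show ?thesis using that \<Phi> by blast
qed

text \<open>The scalar in \<open>e (f\<^sup>k v) = e_coeff a k f\<^sup>k\<^sup>-\<^sup>1 v\<close> for a highest weight vector \<open>v\<close> of weight \<open>a\<close>.\<close>

definition e_coeff :: "complex \<Rightarrow> nat \<Rightarrow> complex" where
  "e_coeff a k = (if even k then of_nat (k div 2) else of_nat (k div 2) - a)"

lemma e_coeff_0 [simp]: "e_coeff a 0 = 0"
  by (simp add: e_coeff_def)

text \<open>Applying e f = - H - f e to f^k v, which has weight a - k, produces this
  recursion.\<close>

lemma e_coeff_Suc: "e_coeff a (Suc k) = of_nat k - a - e_coeff a k"
  by (auto simp: e_coeff_def elim!: evenE oddE)

text \<open>The first zero at a positive index is at 2a + 1, which is where the chain of the f^k v
  ends in an irreducible module.\<close>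

lemma e_coeff_nonzero:
  assumes "0 < k" "k \<le> 2 * a"
  shows "e_coeff (of_nat a) k \<noteq> 0"
proof (cases "even k")
  case True
  then show ?thesis using assms by (auto simp: e_coeff_def elim!: evenE)
next
  case False
  then obtain j where "k = Suc (2 * j)" by (auto elim: oddE)
  then show ?thesis using assms by (auto simp: e_coeff_def)
qed

text \<open>A summand with parameters \<open>(a, b, c, s)\<close> has highest weights \<open>(a)\<close> and \<open>(b, c)\<close> and highest weight
  vector of parity \<open>s\<close>.  The index \<open>(j, k, l)\<close> stands for \<open>f\<^sup>k E\<^sub>2\<^sub>1\<^sup>l\<close> applied to the highest weight
  vector of the \<open>j\<close>-th summand.\<close>

type_synonym params = "nat \<times> complex \<times> complex \<times> bool"

definition gl_len :: "complex \<Rightarrow> complex \<Rightarrow> nat" where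
  "gl_len b c = (if b + c = 0 then 0 else 1)"

definition idx :: "params list \<Rightarrow> (nat \<times> nat \<times> nat) set" where
  "idx ps = {(j, k, l). j < length ps \<and> (case ps ! j of (a, b, c, s) \<Rightarrow> k \<le> 2 * a \<and> l \<le> gl_len b c)}"

text \<open>Indices may leave the range in both directions. Upwards, a family as in
  \<open>basis_on\<close> is 0. Downwards, truncated subtraction returns a wrong index, but its
  coefficient is 0: \<open>e_coeff\<close> vanishes at 0, the product of two of them vanishes also
  at k = 1, and the last term is guarded by l = 1. The factor (-1)^k moves an odd element of gl(1|1)
  past f^k.\<close>

definition std_act :: "params list \<Rightarrow> complex^3^3 \<Rightarrow> complex^2^2 \<Rightarrow> (nat \<times> nat \<times> nat \<Rightarrow> 'i \<Rightarrow> complex)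
    \<Rightarrow> nat \<times> nat \<times> nat \<Rightarrow> 'i \<Rightarrow> complex" where
  "std_act ps X Y B = (\<lambda>(j, k, l). case ps ! j of (a, b, c, s) \<Rightarrow>
     cscale (X $ 1 $ 1 * (of_nat a - of_nat k)) (B (j, k, l))
     + cscale (X $ 1 $ 2 * e_coeff (of_nat a) k * e_coeff (of_nat a) (k - 1)) (B (j, k - 2, l))
     - cscale (X $ 2 $ 1) (B (j, k + 2, l))
     + cscale (X $ 1 $ 3 * e_coeff (of_nat a) k) (B (j, k - 1, l))
     + cscale (X $ 2 $ 3) (B (j, k + 1, l))
     + cscale (Y $ 1 $ 1 * (b - of_nat l) + Y $ 2 $ 2 * (c + of_nat l)) (B (j, k, l))
     + cscale ((-1) ^ k * Y $ 2 $ 1) (B (j, k, l + 1))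
     + cscale ((-1) ^ k * Y $ 1 $ 2 * (if l = 1 then b + c else 0)) (B (j, k, l - 1)))"

definition std_par :: "params list \<Rightarrow> nat \<times> nat \<times> nat \<Rightarrow> bool" where
  "std_par ps = (\<lambda>(j, k, l). case ps ! j of (a, b, c, s) \<Rightarrow> odd (k + l) \<noteq> s)"

definition std_basis :: "'i joint_module \<Rightarrow> params list \<Rightarrow> (nat \<times> nat \<times> nat \<Rightarrow> 'i \<Rightarrow> complex) \<Rightarrow> bool" where
  "std_basis M ps B \<longleftrightarrow> basis_on (idx ps) B (space M) \<and>
     (\<forall>x\<in>idx ps. hom_part (odd_idx M) (std_par ps x) (B x) = B x) \<and>
     (\<forall>X\<in>spo21. \<forall>Y. linear_on (space M) (act M (X, Y)) \<and>
        (\<forall>x\<in>idx ps. act M (X, Y) (B x) = std_act ps X Y B x))"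

lemma finite_idx: "finite (idx ps)"
proof -
  have "idx ps \<subseteq> (\<Union>j<length ps. {j} \<times> {..2 * fst (ps ! j)} \<times> {..1})"
    by (force simp: idx_def gl_len_def split: prod.splits if_splits)
  then show ?thesis by (rule finite_subset) auto
qed

lemma std_act_in:
  assumes "basis_on I B U"
  shows "std_act ps X Y B x \<in> U"
  using basis_onD(5,6)[OF assms]
  by (auto simp: std_act_def split: prod.splits
      intro!: cfun.subspace_add cfun.subspace_diff cfun.subspace_scale)

lemma std_act_image:
  assumes "basis_on I B U" "linear_on U \<Phi>" "\<And>x. \<Phi> (B x) = B' x"
  shows "\<Phi> (std_act ps X Y B x) = std_act ps X Y B' x"
proof -
  have "cfun.subspace U" "\<And>x. B x \<in> U" using basis_onD(5,6)[OF assms(1)] by auto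
  then show ?thesis
    by (simp add: std_act_def linear_onD[OF assms(2)] linear_on_diff[OF assms(2)]
        cfun.subspace_add cfun.subspace_diff cfun.subspace_scale assms(3) split: prod.splits)
qed

theorem std_basis_iso:
  assumes M: "std_basis M ps B" and N: "std_basis N ps B'"
  shows "M \<cong> N"
proof -
  have bM: "basis_on (idx ps) B (space M)" and bN: "basis_on (idx ps) B' (space N)"
    using M N by (auto simp: std_basis_def)
  obtain \<Phi> where \<Phi>: "linear_on (space M) \<Phi>" "bij_betw \<Phi> (space M) (space N)"
    "\<And>c. \<Phi> (lc (idx ps) c B) = lc (idx ps) c B'" "\<And>x. \<Phi> (B x) = B' x"
    by (rule basis_on_linear_map[OF bM bN]) blast
  have hom: "\<Phi> (hom_part (odd_idx M) s v) = hom_part (odd_idx N) s (\<Phi> v)" if v: "v \<in> space M" for v s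
  proof -
    obtain c where c: "v = lc (idx ps) c B" using basis_onD(4)[OF bM v] by blast
    have "hom_part (odd_idx M) s v = lc (idx ps) (\<lambda>x. if std_par ps x = s then c x else 0) B"
      unfolding c using M by (intro hom_part_lc) (auto simp: std_basis_def)
    moreover have "hom_part (odd_idx N) s (\<Phi> v) = lc (idx ps) (\<lambda>x. if std_par ps x = s then c x else 0) B'"
      unfolding c \<Phi>(3) using N by (intro hom_part_lc) (auto simp: std_basis_def)
    ultimately show ?thesis by (simp add: \<Phi>(3))
  qed
  have equiv: "act M (X, Y) v \<in> space M \<and> \<Phi> (act M (X, Y) v) = act N (X, Y) (\<Phi> v)"
    if X: "X \<in> spo21" and v: "v \<in> space M" for X Y v
  proof -
    obtain c where c: "v = lc (idx ps) c B" using basis_onD(4)[OF bM v] by blast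
    have "act M (X, Y) v = lc (idx ps) c (\<lambda>x. act M (X, Y) (B x))"
      unfolding c using M X basis_onD(5,6)[OF bM] by (intro linear_on_lc) (auto simp: std_basis_def)
    also have "\<dots> = lc (idx ps) c (std_act ps X Y B)"
      using M X by (intro lc_cong) (auto simp: std_basis_def)
    finally have 1: "act M (X, Y) v = lc (idx ps) c (std_act ps X Y B)" .
    have "act N (X, Y) (\<Phi> v) = lc (idx ps) c (\<lambda>x. act N (X, Y) (B' x))"
      unfolding c \<Phi>(3) using N X basis_onD(5,6)[OF bN] by (intro linear_on_lc) (auto simp: std_basis_def)
    also have "\<dots> = lc (idx ps) c (std_act ps X Y B')"
      using N X by (intro lc_cong) (auto simp: std_basis_def)
    also have "\<dots> = lc (idx ps) c (\<lambda>x. \<Phi> (std_act ps X Y B x))"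
      by (simp add: std_act_image[OF bM \<Phi>(1,4)])
    also have "\<dots> = \<Phi> (act M (X, Y) v)"
      unfolding 1 using std_act_in[OF bM] basis_onD(5)[OF bM]
      by (intro linear_on_lc[OF \<Phi>(1), symmetric]) auto
    finally show ?thesis
      using subspace_lc[OF basis_onD(5)[OF bM] std_act_in[OF bM]] by (simp add: 1)
  qed
  show ?thesis unfolding joint_iso_def using \<Phi>(1,2) hom equiv by blast
qed

lemma hom_part_shift: "hom_part (\<lambda>i. p i \<noteq> s) (t \<noteq> s) v = hom_part p t v"
  by (auto simp: fun_eq_iff)

lemma std_basis_parity_shift:
  assumes "std_basis M [(a, b, c, s)] B"
  shows "std_basis (parity_shift t M) [(a, b, c, s \<noteq> t)] B"
proof -
  have "idx [(a, b, c, s \<noteq> t)] = idx [(a, b, c, s)]" by (auto simp: idx_def)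
  moreover have "std_act [(a, b, c, s \<noteq> t)] X Y B x = std_act [(a, b, c, s)] X Y B x"
    and "std_par [(a, b, c, s \<noteq> t)] x = (std_par [(a, b, c, s)] x \<noteq> t)"
    if "x \<in> idx [(a, b, c, s)]" for X Y x
    using that by (auto simp: idx_def std_act_def std_par_def)
  ultimately show ?thesis
    using assms by (auto simp: std_basis_def parity_shift_def hom_part_shift[of _ t, simplified])
qed

lemma idx_Cons: "idx (q # ps) = idx [q] \<union> (\<lambda>(j, k, l). (Suc j, k, l)) ` idx ps"
proof -
  have "(j, k, l) \<in> idx (q # ps) \<longleftrightarrow> (j, k, l) \<in> idx [q] \<union> (\<lambda>(j, k, l). (Suc j, k, l)) ` idx ps" for j k l
    by (cases j) (auto simp: idx_def image_iff)
  then show ?thesis by auto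
qed

lemma case_sum_add: "case_sum u v + case_sum u' v' = case_sum (u + u') (v + v')"
  and case_sum_diff: "case_sum u v - case_sum u' v' = case_sum (u - u') (v - v')"
  and case_sum_cscale: "cscale r (case_sum u v) = case_sum (cscale r u) (cscale r v)"
  and case_sum_hom_part: "hom_part (case_sum p q) s (case_sum u v) = case_sum (hom_part p s u) (hom_part q s v)"
  and case_sum_Inl: "case_sum u v \<circ> Inl = u" and case_sum_Inr: "case_sum u v \<circ> Inr = v"
  by (auto simp: fun_eq_iff split: sum.splits)

lemma case_sum_inject: "case_sum u v = case_sum u' v' \<longleftrightarrow> u = u' \<and> v = v'"
  by (auto simp: fun_eq_iff split: sum.splits)

text \<open>A list of parameters is matched to a right-nested sum one head at a time: the head keeps
  summand index 0 and the tail is moved up by \<open>S\<close>.\<close>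

lemma std_basis_direct_sum:
  assumes M: "std_basis M [q] B" and N: "std_basis N ps B'"
  shows "\<exists>C. std_basis (M \<oplus> N) (q # ps) C"
proof -
  define S :: "nat \<times> nat \<times> nat \<Rightarrow> nat \<times> nat \<times> nat" where "S = (\<lambda>(j, k, l). (Suc j, k, l))"
  define C where "C = (\<lambda>(j, k, l). case j of 0 \<Rightarrow> case_sum (B (0, k, l)) 0 | Suc j' \<Rightarrow> case_sum 0 (B' (j', k, l)))"
  have bM: "basis_on (idx [q]) B (space M)" and bN: "basis_on (idx ps) B' (space N)"
    using M N by (auto simp: std_basis_def)
  have idx: "idx (q # ps) = idx [q] \<union> S ` idx ps"
    unfolding S_def by (rule idx_Cons)
  have dj: "idx [q] \<inter> S ` idx ps = {}" by (auto simp: idx_def S_def)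
  have inj: "inj S" by (auto simp: inj_on_def S_def)
  have zero_case: "case_sum 0 0 = (0 :: 'a + 'b \<Rightarrow> complex)" by (auto simp: fun_eq_iff split: sum.splits)
  have C0: "C (0, y) = case_sum (B (0, y)) 0" for y by (cases y) (simp add: C_def)
  have B0: "C x = case_sum (B x) 0" if "x \<in> idx [q]" for x
    using that C0 by (auto simp: idx_def)
  have BS: "C (S x) = case_sum 0 (B' x)" for x by (cases x) (simp add: C_def S_def)
  have lc: "lc (idx (q # ps)) c C = case_sum (lc (idx [q]) c B) (lc (idx ps) (\<lambda>x. c (S x)) B')" for c
  proof -
    have "lc (idx (q # ps)) c C = lc (idx [q]) c C + lc (S ` idx ps) c C"
      unfolding idx lc_def using dj by (intro sum.union_disjoint) (auto simp: finite_idx)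
    also have "lc (idx [q]) c C = case_sum (lc (idx [q]) c B) 0"
      by (auto simp: fun_eq_iff lc_apply B0 split: sum.splits)
    also have "lc (S ` idx ps) c C = lc (idx ps) (\<lambda>x. c (S x)) (\<lambda>x. C (S x))"
      unfolding lc_def by (subst sum.reindex[OF inj_on_subset[OF inj subset_UNIV]]) (simp add: o_def)
    also have "\<dots> = case_sum 0 (lc (idx ps) (\<lambda>x. c (S x)) B')"
      unfolding BS by (auto simp: fun_eq_iff lc_apply split: sum.splits)
    finally show ?thesis by (simp only: case_sum_add add_0_left add_0_right)
  qed
  have space: "space (M \<oplus> N) = {case_sum v w |v w. v \<in> space M \<and> w \<in> space N}"
    by (simp add: direct_sum_def)
  have "basis_on (idx (q # ps)) C (space (M \<oplus> N))"
    unfolding basis_on_def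
  proof (intro conjI allI impI ballI)
    show "finite (idx (q # ps))" by (rule finite_idx)
    fix x assume x: "x \<notin> idx (q # ps)"
    show "C x = 0"
    proof (cases "fst x")
      case 0
      then have "x = (0, snd x)" by (cases x) auto
      moreover have "B x = 0" using x by (auto simp: idx intro: basis_onD(2)[OF bM])
      ultimately show ?thesis using C0[of "snd x"] by (simp add: zero_case)
    next
      case (Suc j)
      then have y: "x = S (j, snd x)" by (cases x) (auto simp: S_def)
      then have "B' (j, snd x) = 0" using x unfolding idx by (intro basis_onD(2)[OF bN]) auto
      then show ?thesis using BS[of "(j, snd x)"] y by (simp add: zero_case)
    qed
  next
    show "space (M \<oplus> N) = range (\<lambda>c. lc (idx (q # ps)) c C)"
    proof
      show "space (M \<oplus> N) \<subseteq> range (\<lambda>c. lc (idx (q # ps)) c C)"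
      proof
        fix u assume "u \<in> space (M \<oplus> N)"
        then obtain c d where u: "u = case_sum (lc (idx [q]) c B) (lc (idx ps) d B')"
          using basis_onD(4)[OF bM] basis_onD(4)[OF bN] unfolding space by blast
        define r where "r x = (if x \<in> idx [q] then c x else d (inv S x))" for x
        have "lc (idx [q]) c B = lc (idx [q]) r B"
          by (rule lc_cong) (simp_all add: r_def)
        moreover have "lc (idx ps) d B' = lc (idx ps) (\<lambda>x. r (S x)) B'"
          using dj by (intro lc_cong) (auto simp: r_def inj)
        ultimately have "u = lc (idx (q # ps)) r C" unfolding lc u by simp
        then show "u \<in> range (\<lambda>c. lc (idx (q # ps)) c C)" by blast
      qed
      show "range (\<lambda>c. lc (idx (q # ps)) c C) \<subseteq> space (M \<oplus> N)"
        unfolding space lc using basis_onD(3)[OF bM] basis_onD(3)[OF bN] by auto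
    qed
  next
    fix c x assume "lc (idx (q # ps)) c C = 0" and x: "x \<in> idx (q # ps)"
    then have "lc (idx [q]) c B = 0" "lc (idx ps) (\<lambda>x. c (S x)) B' = 0"
      unfolding lc zero_case[symmetric] case_sum_inject by auto
    then have "\<forall>y\<in>idx [q]. c y = 0" "\<forall>y\<in>idx ps. c (S y) = 0"
      using bM bN unfolding basis_on_def by blast+
    then show "c x = 0" using x unfolding idx by blast
  qed
  moreover have "hom_part (odd_idx (M \<oplus> N)) (std_par (q # ps) x) (C x) = C x" if "x \<in> idx (q # ps)" for x
    using that unfolding idx
  proof
    assume x: "x \<in> idx [q]"
    then have "std_par (q # ps) x = std_par [q] x" by (auto simp: idx_def std_par_def)
    then show ?thesis
      using x M B0 by (simp add: direct_sum_def case_sum_hom_part std_basis_def)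
  next
    assume "x \<in> S ` idx ps"
    then obtain y where y: "x = S y" "y \<in> idx ps" by blast
    then have "std_par (q # ps) x = std_par ps y" by (auto simp: std_par_def S_def)
    then show ?thesis
      using y N BS by (simp add: direct_sum_def case_sum_hom_part std_basis_def)
  qed
  moreover have "linear_on (space (M \<oplus> N)) (act (M \<oplus> N) (X, Y)) \<and>
      (\<forall>x\<in>idx (q # ps). act (M \<oplus> N) (X, Y) (C x) = std_act (q # ps) X Y C x)" if X: "X \<in> spo21" for X Y
  proof -
    have lM: "linear_on (space M) (act M (X, Y))" and lN: "linear_on (space N) (act N (X, Y))"
      using M N X by (auto simp: std_basis_def)
    have M0: "act M (X, Y) 0 = 0" and N0: "act N (X, Y) 0 = 0"
      using linear_on_0[OF lM basis_onD(5)[OF bM]] linear_on_0[OF lN basis_onD(5)[OF bN]] .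
    have act: "act (M \<oplus> N) (X, Y) (case_sum v w) = case_sum (act M (X, Y) v) (act N (X, Y) w)" for v w
      by (simp add: direct_sum_def case_sum_Inl case_sum_Inr)
    have "linear_on (space (M \<oplus> N)) (act (M \<oplus> N) (X, Y))"
      unfolding linear_on_def
    proof (intro conjI ballI allI)
      fix u v assume "u \<in> space (M \<oplus> N)" "v \<in> space (M \<oplus> N)"
      then show "act (M \<oplus> N) (X, Y) (u + v) = act (M \<oplus> N) (X, Y) u + act (M \<oplus> N) (X, Y) v"
        unfolding space using linear_onD(1)[OF lM] linear_onD(1)[OF lN]
        by (fastforce simp only: act case_sum_add)
    next
      fix r u assume "u \<in> space (M \<oplus> N)"
      then show "act (M \<oplus> N) (X, Y) (cscale r u) = cscale r (act (M \<oplus> N) (X, Y) u)"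
        unfolding space using linear_onD(2)[OF lM] linear_onD(2)[OF lN]
        by (fastforce simp only: act case_sum_cscale)
    qed
    moreover have "act (M \<oplus> N) (X, Y) (C x) = std_act (q # ps) X Y C x" if "x \<in> idx (q # ps)" for x
      using that unfolding idx
    proof
      assume x: "x \<in> idx [q]"
      then have "std_act (q # ps) X Y C x = case_sum (std_act [q] X Y B x) 0"
        by (auto simp: idx_def std_act_def case_sum_cscale case_sum_add case_sum_diff C0 split: prod.splits)
      then show ?thesis
        using x M B0 X by (simp add: act N0 std_basis_def)
    next
      assume "x \<in> S ` idx ps"
      then obtain y where y: "x = S y" "y \<in> idx ps" by blast
      have BS': "C (Suc j, z) = case_sum 0 (B' (j, z))" for j z
        using BS[of "(j, z)"] by (cases z) (simp add: S_def)
      have "std_act (q # ps) X Y C x = case_sum 0 (std_act ps X Y B' y)"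
        unfolding y(1)
        by (auto simp: S_def std_act_def case_sum_cscale case_sum_add case_sum_diff BS' split: prod.splits)
      then show ?thesis
        using y N BS X by (simp add: act M0 std_basis_def)
    qed
    ultimately show ?thesis by blast
  qed
  ultimately have "std_basis (M \<oplus> N) (q # ps) C" unfolding std_basis_def by blast
  then show ?thesis by blast
qed

section \<open>Tensor products\<close>

text \<open>The part of \<open>std_act\<close> coming from a single factor; no Koszul sign occurs
  before the tensor product is formed. The vector \<open>v k\<close> stands for f^k applied to the
  highest weight vector.\<close>

definition spo_basis :: "(complex^3^3, 'i) super_module \<Rightarrow> nat \<Rightarrow> bool \<Rightarrow> (nat \<Rightarrow> 'i \<Rightarrow> complex) \<Rightarrow> bool" where
  "spo_basis V a s v \<longleftrightarrow> basis_on {..2 * a} v (space V) \<and>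
     (\<forall>k\<le>2 * a. hom_part (odd_idx V) (odd k \<noteq> s) (v k) = v k) \<and>
     (\<forall>X\<in>spo21. linear_on (space V) (act V X) \<and>
        (\<forall>k\<le>2 * a. act V X (v k) =
           cscale (X $ 1 $ 1 * (of_nat a - of_nat k)) (v k)
           + cscale (X $ 1 $ 2 * e_coeff (of_nat a) k * e_coeff (of_nat a) (k - 1)) (v (k - 2))
           - cscale (X $ 2 $ 1) (v (k + 2))
           + cscale (X $ 1 $ 3 * e_coeff (of_nat a) k) (v (k - 1))
           + cscale (X $ 2 $ 3) (v (k + 1))))"

definition gl_basis :: "(complex^2^2, 'i) super_module \<Rightarrow> complex \<Rightarrow> complex \<Rightarrow> bool \<Rightarrow> (nat \<Rightarrow> 'i \<Rightarrow> complex) \<Rightarrow> bool" where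
  "gl_basis W b c s w \<longleftrightarrow> basis_on {..gl_len b c} w (space W) \<and>
     (\<forall>l\<le>gl_len b c. hom_part (odd_idx W) (odd l \<noteq> s) (w l) = w l) \<and>
     (\<forall>Y. linear_on (space W) (act W Y) \<and>
        (\<forall>l\<le>gl_len b c. act W Y (w l) =
           cscale (Y $ 1 $ 1 * (b - of_nat l) + Y $ 2 $ 2 * (c + of_nat l)) (w l)
           + cscale (Y $ 2 $ 1) (w (l + 1))
           + cscale (Y $ 1 $ 2 * (if l = 1 then b + c else 0)) (w (l - 1))))"

definition tens :: "('i \<Rightarrow> complex) \<Rightarrow> ('j \<Rightarrow> complex) \<Rightarrow> ('i \<times> 'j \<Rightarrow> complex)" where
  "tens v w = (\<lambda>(i, j). v i * w j)"

lemma tens_apply [simp]: "tens v w (i, j) = v i * w j"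
  by (simp add: tens_def)

lemma tens_lc_lc: "tens (lc I c v) (lc J d w) = lc (I \<times> J) (\<lambda>(k, l). c k * d l) (\<lambda>(k, l). tens (v k) (w l))"
  by (auto simp: fun_eq_iff lc_apply sum_product sum.cartesian_product intro!: sum.cong)

lemma mat_part_even2: "mat_part odd2 False Y $ 1 $ 1 = Y $ 1 $ 1" "mat_part odd2 False Y $ 2 $ 2 = Y $ 2 $ 2"
    "mat_part odd2 False Y $ 1 $ 2 = 0" "mat_part odd2 False Y $ 2 $ 1 = 0"
  and mat_part_odd2: "mat_part odd2 True Y $ 1 $ 1 = 0" "mat_part odd2 True Y $ 2 $ 2 = 0"
    "mat_part odd2 True Y $ 1 $ 2 = Y $ 1 $ 2" "mat_part odd2 True Y $ 2 $ 1 = Y $ 2 $ 1"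
  by (simp_all add: mat_part_def odd2_def)

lemma idx_single: "idx [(a, b, c, s)] = {0} \<times> {..2 * a} \<times> {..gl_len b c}"
  by (auto simp: idx_def)

lemma space_outer_tensor: "space (V \<otimes> W) = cfun.span {tens v w | v w. v \<in> space V \<and> w \<in> space W}"
  by (simp add: outer_tensor_def tens_def)

text \<open>Module operators are linear only on the underlying space, whereas the tensor action
  applies them to columns and rows of an arbitrary element. These have to be located in the factors,
  which is checked on pure tensors and passes to the span.\<close>

lemma outer_tensor_rows_columns:
  assumes "t \<in> space (V \<otimes> W)" "cfun.subspace (space V)" "cfun.subspace (space W)"
  shows "(\<lambda>i. t (i, j)) \<in> space V" and "(\<lambda>j. t (i, j)) \<in> space W"
proof -
  let ?T = "{t. (\<forall>j. (\<lambda>i. t (i, j)) \<in> space V) \<and> (\<forall>i. (\<lambda>j. t (i, j)) \<in> space W)}"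
  have "cfun.subspace ?T"
    using assms(2,3) unfolding cfun.subspace_def
    by (auto simp: zero_fun_def plus_fun_def cscale_def)
  moreover have "{tens v w | v w. v \<in> space V \<and> w \<in> space W} \<subseteq> ?T"
  proof clarify
    fix v w assume vw: "v \<in> space V" "w \<in> space W"
    have "(\<lambda>i. tens v w (i, j)) = cscale (w j) v" "(\<lambda>j. tens v w (i, j)) = cscale (v i) w" for i j
      by (auto simp: fun_eq_iff)
    then show "(\<forall>j. (\<lambda>i. tens v w (i, j)) \<in> space V) \<and> (\<forall>i. (\<lambda>j. tens v w (i, j)) \<in> space W)"
      using assms(2,3) vw by (simp add: cfun.subspace_scale)
  qed
  ultimately have "t \<in> ?T"
    using assms(1) unfolding space_outer_tensor by (metis (lifting) cfun.span_minimal subsetD)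
  then show "(\<lambda>i. t (i, j)) \<in> space V" and "(\<lambda>j. t (i, j)) \<in> space W" by auto
qed

lemma basis_on_tensor:
  assumes v: "basis_on I v (space V)" and w: "basis_on J w (space W)"
  shows "basis_on (I \<times> J) (\<lambda>(k, l). tens (v k) (w l)) (space (V \<otimes> W))" (is "basis_on _ ?B _")
  unfolding basis_on_def
proof (intro conjI allI impI)
  show "finite (I \<times> J)" using basis_onD(1)[OF v] basis_onD(1)[OF w] by simp
  fix x assume "x \<notin> I \<times> J"
  then show "?B x = 0"
    using basis_onD(2)[OF v] basis_onD(2)[OF w] by (cases x) (auto simp: fun_eq_iff)
next
  have gen: "?B x \<in> space (V \<otimes> W)" for x
    unfolding space_outer_tensor using basis_onD(6)[OF v] basis_onD(6)[OF w]
    by (cases x) (auto intro!: cfun.span_base)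
  show "space (V \<otimes> W) = range (\<lambda>c. lc (I \<times> J) c ?B)"
  proof
    have "{tens v w | v w. v \<in> space V \<and> w \<in> space W} \<subseteq> range (\<lambda>c. lc (I \<times> J) c ?B)"
    proof clarify
      fix x y assume "x \<in> space V" "y \<in> space W"
      then obtain c d where "x = lc I c v" "y = lc J d w"
        using basis_onD(4)[OF v] basis_onD(4)[OF w] by blast
      then show "tens x y \<in> range (\<lambda>c. lc (I \<times> J) c ?B)" by (simp add: tens_lc_lc)
    qed
    then show "space (V \<otimes> W) \<subseteq> range (\<lambda>c. lc (I \<times> J) c ?B)"
      unfolding space_outer_tensor by (rule cfun.span_minimal) (rule subspace_range_lc)
    have "cfun.subspace (space (V \<otimes> W))" by (simp add: space_outer_tensor)
    then show "range (\<lambda>c. lc (I \<times> J) c ?B) \<subseteq> space (V \<otimes> W)"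
      using gen by (auto intro: subspace_lc)
  qed
next
  fix c assume 0: "lc (I \<times> J) c ?B = 0"
  \<comment> \<open>For fixed \<open>i\<close>, row \<open>i\<close> of the combination expresses 0
    through the basis \<open>w\<close>, with coefficients that are themselves combinations of
    \<open>v\<close> evaluated at \<open>i\<close>. Independence is then used first for
    \<open>w\<close> and afterwards for \<open>v\<close>.\<close>
  have "lc J (\<lambda>l. lc I (\<lambda>k. c (k, l)) v i) w j = 0" for i j
  proof -
    have "0 = lc (I \<times> J) c ?B (i, j)" by (simp add: 0)
    also have "\<dots> = (\<Sum>k\<in>I. \<Sum>l\<in>J. c (k, l) * (v k i * w l j))"
      by (simp add: lc_apply sum.cartesian_product) (auto intro: sum.cong)
    also have "\<dots> = (\<Sum>l\<in>J. \<Sum>k\<in>I. c (k, l) * (v k i * w l j))" by (rule sum.swap)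
    also have "\<dots> = lc J (\<lambda>l. lc I (\<lambda>k. c (k, l)) v i) w j"
      by (simp add: lc_apply sum_distrib_right mult.assoc)
    finally show ?thesis by simp
  qed
  then have "lc J (\<lambda>l. lc I (\<lambda>k. c (k, l)) v i) w = 0" for i by (auto simp: fun_eq_iff)
  then have "lc I (\<lambda>k. c (k, l)) v i = 0" if "l \<in> J" for i l
    using w that unfolding basis_on_def by blast
  then have "lc I (\<lambda>k. c (k, l)) v = 0" if "l \<in> J" for l using that by (auto simp: fun_eq_iff)
  then have "c (k, l) = 0" if "k \<in> I" "l \<in> J" for k l
    using v that unfolding basis_on_def by blast
  then show "\<forall>x\<in>I \<times> J. c x = 0" by auto
qed

text \<open>Serves to reshape index tuples and to absorb the signs that separate a natural basis
  from one in the normal form of \<open>std_act\<close>.\<close>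

lemma basis_on_reindex_scale:
  assumes B: "basis_on I B U" and h: "bij_betw h I' I" "\<And>x. x \<notin> I' \<Longrightarrow> C x = 0"
    and C: "\<And>x. x \<in> I' \<Longrightarrow> C x = cscale (r x) (B (h x))" and r: "\<And>x. r x \<noteq> 0"
  shows "basis_on I' C U"
proof -
  have lc: "lc I' c C = lc I (\<lambda>y. c (the_inv_into I' h y) * r (the_inv_into I' h y)) B" for c
  proof -
    have "lc I' c C = (\<Sum>x\<in>I'. cscale (c x * r x) (B (h x)))"
      unfolding lc_def by (rule sum.cong) (simp_all add: C)
    also have "\<dots> = (\<Sum>x\<in>I'. cscale (c (the_inv_into I' h (h x)) * r (the_inv_into I' h (h x))) (B (h x)))"
      using h(1) by (intro sum.cong) (simp_all add: bij_betw_def the_inv_into_f_f)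
    also have "\<dots> = (\<Sum>y\<in>I. cscale (c (the_inv_into I' h y) * r (the_inv_into I' h y)) (B y))"
      by (rule sum.reindex_bij_betw[OF h(1)])
    finally show ?thesis unfolding lc_def .
  qed
  have inv: "the_inv_into I' h (h x) = x" if "x \<in> I'" for x
    using h(1) that by (simp add: bij_betw_def the_inv_into_f_f)
  have himg: "h ` I' = I" using h(1) by (simp add: bij_betw_def)
  show ?thesis
    unfolding basis_on_def
  proof (intro conjI allI impI ballI h(2))
    show "finite I'" using basis_onD(1)[OF B] bij_betw_finite[OF h(1)] by simp
    show "U = range (\<lambda>c. lc I' c C)"
    proof
      show "U \<subseteq> range (\<lambda>c. lc I' c C)"
      proof
        fix u assume "u \<in> U"
        then obtain d where "u = lc I d B" using basis_onD(4)[OF B] by blast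
        also have "\<dots> = lc I' (\<lambda>x. d (h x) / r x) C"
          unfolding lc using r h(1) by (intro lc_cong) (auto simp: bij_betw_def f_the_inv_into_f)
        finally show "u \<in> range (\<lambda>c. lc I' c C)" by blast
      qed
      show "range (\<lambda>c. lc I' c C) \<subseteq> U" unfolding lc using basis_onD(3)[OF B] by blast
    qed
    fix c x assume "lc I' c C = 0" "x \<in> I'"
    then have "c (the_inv_into I' h (h x)) * r (the_inv_into I' h (h x)) = 0"
      using B himg unfolding lc basis_on_def by blast
    then show "c x = 0" using r inv[OF \<open>x \<in> I'\<close>] by simp
  qed
qed

lemma outer_tensor_act:
  "act (V \<otimes> W) (X, Y) t (i, j) =
     act V X (\<lambda>i'. t (i', j)) i + act W (mat_part odd2 False Y) (\<lambda>j'. t (i, j')) j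
     + (if odd_idx V i then - 1 else 1) * act W (mat_part odd2 True Y) (\<lambda>j'. t (i, j')) j"
  by (simp add: outer_tensor_def)

theorem std_basis_tensor:
  assumes V: "spo_basis V a s v" and W: "gl_basis W b c t w"
  shows "\<exists>B. std_basis (V \<otimes> W) [(a, b, c, s \<noteq> t)] B"
proof -
  \<comment> \<open>An odd element passing \<open>v k\<close> gives the sign (-1)^k times
    \<open>\<sigma>\<close>, where \<open>\<sigma>\<close> is the sign for the parity of
    \<open>v 0\<close>. Scaling by \<open>\<sigma> ^ l\<close> removes this constant: raising
    \<open>l\<close> adds one factor, and lowering it uses that \<open>\<sigma>\<close> squares to
    1.\<close>
  define \<sigma> :: complex where "\<sigma> = (if s then -1 else 1)"
  have \<sigma>\<sigma>: "\<sigma> * \<sigma> = 1" and \<sigma>0: "\<sigma> \<noteq> 0" by (auto simp: \<sigma>_def)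
  define B where "B = (\<lambda>(j :: nat, k, l). if j = 0 then cscale (\<sigma> ^ l) (tens (v k) (w l)) else 0)"
  let ?I = "{..2 * a}" and ?J = "{..gl_len b c}"
  have bv: "basis_on ?I v (space V)" and bw: "basis_on ?J w (space W)"
    using V W by (auto simp: spo_basis_def gl_basis_def)
  note sV = basis_onD(5)[OF bv] and sW = basis_onD(5)[OF bw]
  have basis: "basis_on (idx [(a, b, c, s \<noteq> t)]) B (space (V \<otimes> W))"
  proof (rule basis_on_reindex_scale[OF basis_on_tensor[OF bv bw]])
    show "bij_betw snd (idx [(a, b, c, s \<noteq> t)]) (?I \<times> ?J)"
      by (auto simp: idx_single bij_betw_def inj_on_def)
    show "B x = 0" if "x \<notin> idx [(a, b, c, s \<noteq> t)]" for x
      using that basis_onD(2)[OF bv] basis_onD(2)[OF bw]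
      by (cases x) (auto simp: B_def idx_single fun_eq_iff)
    show "B x = cscale (\<sigma> ^ snd (snd x)) (case snd x of (k, l) \<Rightarrow> tens (v k) (w l))"
      if "x \<in> idx [(a, b, c, s \<noteq> t)]" for x
      using that by (auto simp: B_def idx_single)
    show "\<sigma> ^ snd (snd x) \<noteq> 0" for x :: "nat \<times> nat \<times> nat" using \<sigma>0 by simp
  qed
  have par: "hom_part (odd_idx (V \<otimes> W)) (std_par [(a, b, c, s \<noteq> t)] x) (B x) = B x"
    if x: "x \<in> idx [(a, b, c, s \<noteq> t)]" for x
  proof -
    obtain k l where kl: "x = (0, k, l)" "k \<le> 2 * a" "l \<le> gl_len b c"
      using x by (auto simp: idx_single)
    have "odd_idx V i = (odd k \<noteq> s)" if "v k i \<noteq> 0" for i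
      using V kl(2) that unfolding spo_basis_def hom_part_eq_iff by blast
    moreover have "odd_idx W j = (odd l \<noteq> t)" if "w l j \<noteq> 0" for j
      using W kl(3) that unfolding gl_basis_def hom_part_eq_iff by blast
    ultimately show ?thesis
      unfolding hom_part_eq_iff
      by (auto simp: kl(1) B_def std_par_def outer_tensor_def)
  qed
  have lin: "linear_on (space (V \<otimes> W)) (act (V \<otimes> W) (X, Y))" if X: "X \<in> spo21" for X Y
  proof -
    have lV: "linear_on (space V) (act V X)" and lW: "linear_on (space W) (act W Y)" for Y
      using V W X by (auto simp: spo_basis_def gl_basis_def)
    define col :: "('a \<times> 'b \<Rightarrow> complex) \<Rightarrow> 'b \<Rightarrow> 'a \<Rightarrow> complex" where "col u j = (\<lambda>i. u (i, j))" for u j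
    define row :: "('a \<times> 'b \<Rightarrow> complex) \<Rightarrow> 'a \<Rightarrow> 'b \<Rightarrow> complex" where "row u i = (\<lambda>j. u (i, j))" for u i
    have act: "act (V \<otimes> W) (X, Y) u (i, j) = act V X (col u j) i + act W (mat_part odd2 False Y) (row u i) j
        + (if odd_idx V i then - 1 else 1) * act W (mat_part odd2 True Y) (row u i) j" for u i j
      by (simp add: outer_tensor_act col_def row_def)
    have cr: "col u j \<in> space V" "row u i \<in> space W" if "u \<in> space (V \<otimes> W)" for u i j
      using outer_tensor_rows_columns[OF that sV sW] by (simp_all add: col_def row_def)
    have cr_lin: "col (u + u') j = col u j + col u' j" "row (u + u') i = row u i + row u' i"
      "col (cscale r u) j = cscale r (col u j)" "row (cscale r u) i = cscale r (row u i)" for u u' i j r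
      by (auto simp: fun_eq_iff col_def row_def)
    show ?thesis
      unfolding linear_on_def
    proof (intro conjI ballI allI)
      fix u u' assume u: "u \<in> space (V \<otimes> W)" "u' \<in> space (V \<otimes> W)"
      have *: "act (V \<otimes> W) (X, Y) (u + u') (i, j) = act (V \<otimes> W) (X, Y) u (i, j) + act (V \<otimes> W) (X, Y) u' (i, j)"
        for i j
        unfolding act cr_lin linear_onD(1)[OF lV cr(1)[OF u(1)] cr(1)[OF u(2)]]
          linear_onD(1)[OF lW cr(2)[OF u(1)] cr(2)[OF u(2)]]
        by (simp add: algebra_simps)
      show "act (V \<otimes> W) (X, Y) (u + u') = act (V \<otimes> W) (X, Y) u + act (V \<otimes> W) (X, Y) u'"
        using *[of "fst x" "snd x" for x] by (intro ext) (simp only: prod.collapse plus_fun_apply)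
    next
      fix r u assume u: "u \<in> space (V \<otimes> W)"
      have *: "act (V \<otimes> W) (X, Y) (cscale r u) (i, j) = r * act (V \<otimes> W) (X, Y) u (i, j)" for i j
        unfolding act cr_lin linear_onD(2)[OF lV cr(1)[OF u]] linear_onD(2)[OF lW cr(2)[OF u]]
        by (simp add: algebra_simps)
      show "act (V \<otimes> W) (X, Y) (cscale r u) = cscale r (act (V \<otimes> W) (X, Y) u)"
        using *[of "fst x" "snd x" for x] by (intro ext) (simp only: prod.collapse cscale_apply)
    qed
  qed
  have act: "act (V \<otimes> W) (X, Y) (B x) = std_act [(a, b, c, s \<noteq> t)] X Y B x"
    if X: "X \<in> spo21" and x: "x \<in> idx [(a, b, c, s \<noteq> t)]" for X Y x
  proof -
    obtain k l where kl: "x = (0, k, l)" "k \<le> 2 * a" "l \<le> gl_len b c"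
      using x by (auto simp: idx_single)
    have lV: "linear_on (space V) (act V X)" and lW: "linear_on (space W) (act W Y)" for Y
      using V W X by (auto simp: spo_basis_def gl_basis_def)
    have aV: "act V X (v k) = cscale (X $ 1 $ 1 * (of_nat a - of_nat k)) (v k)
           + cscale (X $ 1 $ 2 * e_coeff (of_nat a) k * e_coeff (of_nat a) (k - 1)) (v (k - 2))
           - cscale (X $ 2 $ 1) (v (k + 2))
           + cscale (X $ 1 $ 3 * e_coeff (of_nat a) k) (v (k - 1))
           + cscale (X $ 2 $ 3) (v (k + 1))"
      using V X kl(2) unfolding spo_basis_def by blast
    have aW: "act W Y (w l) = cscale (Y $ 1 $ 1 * (b - of_nat l) + Y $ 2 $ 2 * (c + of_nat l)) (w l)
           + cscale (Y $ 2 $ 1) (w (l + 1))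
           + cscale (Y $ 1 $ 2 * (if l = 1 then b + c else 0)) (w (l - 1))" for Y
      using W kl(3) unfolding gl_basis_def by blast
    have Bx: "B x = cscale (\<sigma> ^ l) (tens (v k) (w l))" by (simp add: B_def kl(1))
    have "act (V \<otimes> W) (X, Y) (B x) (i, j) = std_act [(a, b, c, s \<noteq> t)] X Y B x (i, j)" for i j
    proof -
      have col: "(\<lambda>i'. B x (i', j)) = cscale (\<sigma> ^ l * w l j) (v k)"
        and row: "(\<lambda>j'. B x (i, j')) = cscale (\<sigma> ^ l * v k i) (w l)"
        by (auto simp: fun_eq_iff Bx)
      have vin: "v k \<in> space V" "w l \<in> space W" using basis_onD(6)[OF bv] basis_onD(6)[OF bw] by auto
      \<comment> \<open>The sign in \<open>outer_tensor\<close> depends on the index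
        \<open>i\<close>, but \<open>v k\<close> is homogeneous, so on its support the sign is
        constant.\<close>
      have sign: "(if odd_idx V i then - 1 else 1) * v k i = (-1) ^ k * \<sigma> * v k i"
      proof (cases "v k i = 0")
        case False
        then have "odd_idx V i = (odd k \<noteq> s)"
          using V kl(2) unfolding spo_basis_def hom_part_eq_iff by blast
        then show ?thesis by (auto simp: \<sigma>_def)
      qed simp
      have "act (V \<otimes> W) (X, Y) (B x) (i, j) =
          \<sigma> ^ l * w l j * act V X (v k) i + \<sigma> ^ l * v k i * act W (mat_part odd2 False Y) (w l) j
          + \<sigma> ^ l * ((if odd_idx V i then - 1 else 1) * v k i) * act W (mat_part odd2 True Y) (w l) j"
        unfolding outer_tensor_act col row
        by (simp add: linear_onD(2)[OF lV] linear_onD(2)[OF lW] vin)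
      also have "\<dots> = std_act [(a, b, c, s \<noteq> t)] X Y B x (i, j)"
        unfolding sign aV aW mat_part_even2 mat_part_odd2 kl(1) std_act_def B_def
        apply (simp add: algebra_simps)
        using kl(3) \<sigma>\<sigma>
        apply (auto simp: gl_len_def split: if_splits)
        done
      finally show ?thesis .
    qed
    then show ?thesis by auto
  qed
  show ?thesis unfolding std_basis_def using basis par lin act by blast
qed

section \<open>Irreducible modules\<close>

text \<open>As simp rules, these equations also rewrite unapplied occurrences of \<open>+\<close>, \<open>0\<close>, \<open>cscale\<close>.\<close>

lemmas pointwise = fun_eq_iff cscale_apply hom_part_apply plus_fun_apply zero_fun_apply minus_apply uminus_apply

declare cscale_apply [simp del] hom_part_apply [simp del] plus_fun_apply [simp del] zero_fun_apply [simp del]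
  minus_apply [simp del] uminus_apply [simp del]

text \<open>Vectors of the family may be zero, so the conclusion is about the terms instead of the
  coefficients. As usual, \<open>H\<close> is applied to the relation and a multiple of the relation
  is subtracted to remove one vector.\<close>

lemma eigenvectors_lc_zero:
  assumes H: "linear_on U H" "cfun.subspace U" and "finite I"
    and "\<And>x. x \<in> I \<Longrightarrow> B x \<in> U" "\<And>x. x \<in> I \<Longrightarrow> H (B x) = cscale (\<mu> x) (B x)"
    and "inj_on \<mu> I" "lc I c B = 0" "x \<in> I"
  shows "cscale (c x) (B x) = 0"
  using assms(3-)
proof (induction I arbitrary: c x rule: finite_induct)
  case (insert y I)
  have sum: "cscale (c y) (B y) + lc I c B = 0"
    using insert.prems(4) by (simp only: lc_insert[OF insert.hyps])
  have inU: "lc I c B \<in> U" "cscale (c y) (B y) \<in> U"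
    using insert.prems(1) H(2) by (auto intro: subspace_lc cfun.subspace_scale)
  have "H (lc I c B) = lc I c (\<lambda>x. H (B x))"
    using insert.prems(1) by (intro linear_on_lc[OF H]) auto
  also have "\<dots> = lc I (\<lambda>x. c x * \<mu> x) B"
    unfolding lc_def using insert.prems(2) by (intro sum.cong) (auto simp: cscale_cscale)
  finally have HI: "H (lc I c B) = lc I (\<lambda>x. c x * \<mu> x) B" .
  have "H (cscale (c y) (B y)) = cscale (\<mu> y) (cscale (c y) (B y))"
    using insert.prems(1,2) linear_onD(2)[OF H(1)] by (simp add: cscale_cscale mult.commute)
  then have "cscale (\<mu> y) (cscale (c y) (B y)) + lc I (\<lambda>x. c x * \<mu> x) B = 0"
    using linear_onD(1)[OF H(1) inU(2,1)] sum linear_on_0[OF H] HI by simp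
  moreover have "cscale (\<mu> y) (cscale (c y) (B y)) + cscale (\<mu> y) (lc I c B) = 0"
    using sum by (simp only: cscale_add[symmetric] cscale_zero_right)
  ultimately have "lc I (\<lambda>x. c x * \<mu> x - \<mu> y * c x) B = 0"
    by (simp add: lc_diff lc_cscale add_eq_0_iff)
  then have "cscale (c z * \<mu> z - \<mu> y * c z) (B z) = 0" if "z \<in> I" for z
    using insert.prems(1,2) that inj_on_subset[OF insert.prems(3) subset_insertI] \<open>lc I (\<lambda>x. c x * \<mu> x - \<mu> y * c x) B = 0\<close>
    by (intro insert.IH) auto
  moreover have "\<mu> z \<noteq> \<mu> y" if "z \<in> I" for z
    using insert.prems(3) insert.hyps that by (auto simp: inj_on_def)
  ultimately have I0: "cscale (c z) (B z) = 0" if "z \<in> I" for z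
    using that by (auto simp: cscale_eq_0_iff algebra_simps)
  then have "lc I c B = 0" unfolding lc_def by (intro sum.neutral) blast
  then have "cscale (c y) (B y) = 0" using sum by simp
  then show ?case using I0 insert.prems(5) by auto
qed simp

lemma range_lc_eq_span:
  assumes "finite I"
  shows "range (\<lambda>c. lc I c B) = cfun.span (B ` I)"
proof
  show "range (\<lambda>c. lc I c B) \<subseteq> cfun.span (B ` I)"
    by (auto intro: subspace_lc[OF cfun.subspace_span] cfun.span_base)
  have "B x \<in> range (\<lambda>c. lc I c B)" if "x \<in> I" for x
    using lc_indicator[OF assms that, of B] by (metis rangeI)
  then show "cfun.span (B ` I) \<subseteq> range (\<lambda>c. lc I c B)"
    by (intro cfun.span_minimal subspace_range_lc) auto
qed

lemma graded_span:
  assumes "\<And>x. x \<in> S \<Longrightarrow> \<exists>t. hom_part p t x = x"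
  shows "graded_subspace p (cfun.span S)"
  unfolding graded_subspace_def
proof (intro conjI ballI allI)
  fix u s assume "u \<in> cfun.span S"
  then show "hom_part p s u \<in> cfun.span S"
  proof (induction rule: cfun.span_induct_alt)
    case base
    then show ?case by (simp add: cfun.span_zero)
  next
    case (step c x y)
    obtain t where t: "hom_part p t x = x" using assms step by blast
    have "hom_part p s x = (if s = t then x else 0)"
      using t unfolding hom_part_eq_iff by (auto simp: pointwise)
    then have "hom_part p s x \<in> cfun.span S"
      using step by (auto intro: cfun.span_base cfun.span_zero)
    then show ?case
      unfolding hom_part_add hom_part_cscale using step by (intro cfun.span_add cfun.span_scale)
  qed
qed simp

lemma span_invariant:
  assumes "linear_on U h" "cfun.subspace U" "S \<subseteq> U" "\<And>x. x \<in> S \<Longrightarrow> h x \<in> cfun.span S" "u \<in> cfun.span S"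
  shows "h u \<in> cfun.span S"
proof -
  have "cfun.subspace {x \<in> U. h x \<in> cfun.span S}"
    unfolding cfun.subspace_def using assms(2) linear_onD[OF assms(1)] linear_on_0[OF assms(1,2)]
    by (auto simp: cfun.span_zero cfun.subspace_0 cfun.subspace_add cfun.subspace_scale
        intro: cfun.span_add cfun.span_scale)
  moreover have "S \<subseteq> {x \<in> U. h x \<in> cfun.span S}" using assms(3,4) by auto
  ultimately show ?thesis using assms(5) cfun.span_minimal by blast
qed

text \<open>Three settings share this calculus: an abstract irreducible module, the model used for
  existence, and \<open>S_inv d\<close>. The three relations suffice because in
  \<open>spo_act\<close> the even root vectors are recovered, up to sign, as squares of
  \<open>e\<close> and \<open>f\<close>.\<close>

locale spo_ops =
  fixes U :: "('i \<Rightarrow> complex) set" and H e f :: "('i \<Rightarrow> complex) \<Rightarrow> ('i \<Rightarrow> complex)"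
  assumes subspace: "cfun.subspace U"
    and H_lin: "linear_on U H" and e_lin: "linear_on U e" and f_lin: "linear_on U f"
    and H_in: "v \<in> U \<Longrightarrow> H v \<in> U" and e_in: "v \<in> U \<Longrightarrow> e v \<in> U" and f_in: "v \<in> U \<Longrightarrow> f v \<in> U"
    and e_f: "v \<in> U \<Longrightarrow> e (f v) = - H v - f (e v)"
    and H_e: "v \<in> U \<Longrightarrow> H (e v) = e (H v) + e v"
    and H_f: "v \<in> U \<Longrightarrow> H (f v) = f (H v) - f v"
begin

definition spo_act :: "complex^3^3 \<Rightarrow> ('i \<Rightarrow> complex) \<Rightarrow> 'i \<Rightarrow> complex" where
  "spo_act X v = cscale (X $ 1 $ 1) (H v) + cscale (X $ 1 $ 2) (e (e v))
    - cscale (X $ 2 $ 1) (f (f v)) + cscale (X $ 1 $ 3) (e v) + cscale (X $ 2 $ 3) (f v)"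

context
  fixes v and \<alpha> :: complex
  assumes v: "v \<in> U" and ev: "e v = 0" and Hv: "H v = cscale \<alpha> v"
begin

abbreviation u :: "nat \<Rightarrow> 'i \<Rightarrow> complex" where "u k \<equiv> (f ^^ k) v"

lemma u_in: "u k \<in> U"
  by (induction k) (auto simp: v f_in)

lemma H_u: "H (u k) = cscale (\<alpha> - of_nat k) (u k)"
proof (induction k)
  case (Suc k)
  have "H (u (Suc k)) = f (H (u k)) - f (u k)" using H_f[OF u_in] by simp
  also have "f (H (u k)) = cscale (\<alpha> - of_nat k) (f (u k))"
    using Suc linear_onD(2)[OF f_lin u_in] by simp
  finally show ?case by (simp add: pointwise algebra_simps)
qed (simp add: Hv)

lemma e_u_Suc: "e (u (Suc k)) = cscale (e_coeff \<alpha> (Suc k)) (u k)"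
proof (induction k)
  case 0
  have "f 0 = 0" using linear_on_0[OF f_lin subspace] .
  then show ?case using e_f[OF v] by (simp add: ev Hv pointwise e_coeff_def)
next
  case (Suc k)
  have "e (u (Suc (Suc k))) = - H (u (Suc k)) - f (e (u (Suc k)))" 
    using e_f[OF u_in[of "Suc k"]] by simp
  also have "f (e (u (Suc k))) = cscale (e_coeff \<alpha> (Suc k)) (u (Suc k))"
    unfolding Suc using linear_onD(2)[OF f_lin u_in] by simp
  finally show ?case
    unfolding H_u by (subst e_coeff_Suc) (simp add: pointwise algebra_simps)
qed

lemma e_u: "e (u k) = cscale (e_coeff \<alpha> k) (u (k - 1))"
  by (cases k) (simp_all add: ev e_u_Suc del: funpow.simps(2))

lemma spo_act_u:
  "spo_act X (u k) = cscale (X $ 1 $ 1 * (\<alpha> - of_nat k)) (u k)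
    + cscale (X $ 1 $ 2 * e_coeff \<alpha> k * e_coeff \<alpha> (k - 1)) (u (k - 2))
    - cscale (X $ 2 $ 1) (u (k + 2)) + cscale (X $ 1 $ 3 * e_coeff \<alpha> k) (u (k - 1))
    + cscale (X $ 2 $ 3) (u (k + 1))"
proof -
  have "e (e (u k)) = cscale (e_coeff \<alpha> k * e_coeff \<alpha> (k - 1)) (u (k - 2))"
    unfolding e_u linear_onD(2)[OF e_lin u_in]
    by (simp add: cscale_cscale numeral_2_eq_2)
  moreover have "u (k + 2) = f (f (u k))" "u (k + 1) = f (u k)" by simp_all
  ultimately show ?thesis
    unfolding spo_act_def e_u H_u by (simp only: cscale_cscale mult.assoc)
qed

lemma u_lc_zero: "finite I \<Longrightarrow> lc I c u = 0 \<Longrightarrow> k \<in> I \<Longrightarrow> cscale (c k) (u k) = 0"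
  by (rule eigenvectors_lc_zero[OF H_lin subspace, where \<mu> = "\<lambda>k. \<alpha> - of_nat k"])
    (auto simp: u_in H_u inj_on_def)

text \<open>\<open>e\<close> carries \<open>u (Suc k)\<close> back to a nonzero multiple of
  \<open>u k\<close> as long as k < 2a.\<close>

lemma u_nonzero:
  assumes "\<alpha> = of_nat a" "v \<noteq> 0" "k \<le> 2 * a"
  shows "u k \<noteq> 0"
  using assms(3)
proof (induction k)
  case (Suc k)
  then have "e (u (Suc k)) \<noteq> 0"
    using e_coeff_nonzero[of "Suc k" a] unfolding e_u_Suc cscale_eq_0_iff by (auto simp: assms(1))
  then show ?case using linear_on_0[OF e_lin subspace] by metis
qed (simp add: assms(2))

text \<open>A submodule criterion for sets of the \<open>u k\<close>, applied to the tail k > 2a and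
  to the head k <= 2a. Stepping down by \<open>e\<close> has to stay in \<open>K\<close> only where
  the coefficient is nonzero, and this is what closes the tail.\<close>

lemma spo_act_span:
  assumes "\<And>k. k \<in> K \<Longrightarrow> u (Suc k) \<in> cfun.span (u ` K)"
    and "\<And>k. k \<in> K \<Longrightarrow> e_coeff \<alpha> k \<noteq> 0 \<Longrightarrow> k - 1 \<in> K" and X: "x \<in> cfun.span (u ` K)"
    and lin: "linear_on U (spo_act X)"
  shows "spo_act X x \<in> cfun.span (u ` K)"
proof (rule span_invariant[OF lin subspace _ _ X])
  show "u ` K \<subseteq> U" using u_in by auto
  have f_inv: "f x \<in> cfun.span (u ` K)" if "x \<in> cfun.span (u ` K)" for x
    using assms(1) u_in by (intro span_invariant[OF f_lin subspace _ _ that]) auto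
  have e_inv: "e x \<in> cfun.span (u ` K)" if "x \<in> cfun.span (u ` K)" for x
  proof (rule span_invariant[OF e_lin subspace _ _ that])
    show "u ` K \<subseteq> U" using u_in by auto
    fix y assume "y \<in> u ` K"
    then obtain k where k: "k \<in> K" "y = u k" by auto
    then show "e y \<in> cfun.span (u ` K)"
      using assms(2)[of k] unfolding k(2) e_u
      by (cases "e_coeff \<alpha> k = 0") (auto simp: cfun.span_zero intro: cfun.span_scale cfun.span_base)
  qed
  fix y assume "y \<in> u ` K"
  then obtain k where k: "k \<in> K" "y = u k" by auto
  then have y: "y \<in> cfun.span (u ` K)" by (auto intro: cfun.span_base)
  then have "H y \<in> cfun.span (u ` K)" by (simp add: k(2) H_u cfun.span_scale)
  then show "spo_act X y \<in> cfun.span (u ` K)"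
    unfolding spo_act_def using y e_inv f_inv
    by (intro cfun.span_add cfun.span_diff cfun.span_scale) auto
qed

end

end

section \<open>From modules over spo(2|1) to the operators of the root vectors\<close>

abbreviation h_mat :: "complex^3^3" where "h_mat \<equiv> mat_unit 1 1 - mat_unit 2 2"
abbreviation e_mat :: "complex^3^3" where "e_mat \<equiv> mat_unit 1 3 + mat_unit 3 2"
abbreviation f_mat :: "complex^3^3" where "f_mat \<equiv> mat_unit 2 3 - mat_unit 3 1"

lemma spo21_iff:
  "X \<in> spo21 \<longleftrightarrow> X $ 2 $ 2 = - X $ 1 $ 1 \<and> X $ 3 $ 1 = - X $ 2 $ 3 \<and> X $ 3 $ 2 = X $ 1 $ 3 \<and> X $ 3 $ 3 = 0"
proof
  assume *: "X $ 2 $ 2 = - X $ 1 $ 1 \<and> X $ 3 $ 1 = - X $ 2 $ 3 \<and> X $ 3 $ 2 = X $ 1 $ 3 \<and> X $ 3 $ 3 = 0"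
  have "X = vector [vector [X $ 1 $ 1, X $ 1 $ 2, X $ 1 $ 3], vector [X $ 2 $ 1, - X $ 1 $ 1, X $ 2 $ 3],
      vector [- X $ 2 $ 3, X $ 1 $ 3, 0]]"
    using * by (simp add: vec_eq_iff forall_3)
  then show "X \<in> spo21" unfolding spo21_def by blast
qed (use spo21_entries in auto)

lemma spo21_generators: "h_mat \<in> spo21" "e_mat \<in> spo21" "f_mat \<in> spo21" "mat_unit 1 2 \<in> spo21" "mat_unit 2 1 \<in> spo21"
  by (simp_all add: spo21_iff mat_unit_def)

lemma spo21_mscale: "X \<in> spo21 \<Longrightarrow> mscale c X \<in> spo21"
  and spo21_add: "X \<in> spo21 \<Longrightarrow> Y \<in> spo21 \<Longrightarrow> X + Y \<in> spo21"
  by (simp_all add: spo21_iff mscale_def)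

lemma spo21_brackets:
  "super_bracket True True e_mat e_mat = mscale 2 (mat_unit 1 2)"
  "super_bracket True True f_mat f_mat = mscale (-2) (mat_unit 2 1)"
  "super_bracket True True e_mat f_mat = mscale (-1) h_mat"
  "super_bracket False True h_mat e_mat = e_mat"
  "super_bracket False True h_mat f_mat = mscale (-1) f_mat"
  by (simp_all add: super_bracket_def mscale_def mat_unit_def matrix_matrix_mult_def vec_eq_iff forall_3 sum_3)

lemma mat_part_generators:
  "mat_part odd3 False h_mat = h_mat" "mat_part odd3 True e_mat = e_mat" "mat_part odd3 True f_mat = f_mat"
  by (simp_all add: mat_part_def odd3_def mat_unit_def vec_eq_iff forall_3)

lemma spo21_decompose:
  assumes "X \<in> spo21"
  shows "X = mscale (X $ 1 $ 1) h_mat + mscale (X $ 1 $ 2) (mat_unit 1 2) + mscale (X $ 2 $ 1) (mat_unit 2 1)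
    + mscale (X $ 1 $ 3) e_mat + mscale (X $ 2 $ 3) f_mat"
  using assms by (simp add: spo21_iff mscale_def mat_unit_def vec_eq_iff forall_3)

lemma is_moduleD:
  assumes "is_module \<pi> \<gg> M"
  shows "cfun.subspace (space M)" "v \<in> space M \<Longrightarrow> hom_part (odd_idx M) t v \<in> space M"
    and "X \<in> \<gg> \<Longrightarrow> v \<in> space M \<Longrightarrow> act M X v \<in> space M"
    and "X \<in> \<gg> \<Longrightarrow> linear_on (space M) (act M X)"
    and "X \<in> \<gg> \<Longrightarrow> Y \<in> \<gg> \<Longrightarrow> v \<in> space M \<Longrightarrow> act M (X + Y) v = act M X v + act M Y v"
    and "X \<in> \<gg> \<Longrightarrow> v \<in> space M \<Longrightarrow> act M (mscale c X) v = cscale c (act M X v)"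
    and "X \<in> \<gg> \<Longrightarrow> v \<in> space M \<Longrightarrow> mat_part \<pi> s X = X \<Longrightarrow> hom_part (odd_idx M) t v = v \<Longrightarrow>
        hom_part (odd_idx M) (s \<noteq> t) (act M X v) = act M X v"
    and "X \<in> \<gg> \<Longrightarrow> Y \<in> \<gg> \<Longrightarrow> v \<in> space M \<Longrightarrow> mat_part \<pi> s X = X \<Longrightarrow> mat_part \<pi> s' Y = Y \<Longrightarrow>
        act M (super_bracket s s' X Y) v =
          (if s \<and> s' then act M X (act M Y v) + act M Y (act M X v)
           else act M X (act M Y v) - act M Y (act M X v))"
  using assms unfolding is_module_def graded_subspace_def by blast+

text \<open>Each homogeneous part of \<open>v\<close> is sent to a definite parity, so the parts of
  the image can be read off. This allows a highest weight vector to be replaced by a nonzero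
  homogeneous component.\<close>

lemma hom_part_act:
  assumes M: "is_module \<pi> \<gg> M" and X: "X \<in> \<gg>" "mat_part \<pi> s X = X" and v: "v \<in> space M"
  shows "act M X (hom_part (odd_idx M) t v) = hom_part (odd_idx M) (s \<noteq> t) (act M X v)"
proof -
  let ?h = "hom_part (odd_idx M)"
  have part: "?h (s \<noteq> r) (act M X (?h r v)) = act M X (?h r v)" for r
    using X v by (intro is_moduleD(7)[OF M]) (auto simp: hom_part_idem is_moduleD(2)[OF M])
  have "v = ?h t v + ?h (\<not> t) v" by (auto simp: pointwise)
  then have "act M X v = act M X (?h t v) + act M X (?h (\<not> t) v)"
    using linear_onD(1)[OF is_moduleD(4)[OF M X(1)]] is_moduleD(2)[OF M v] by metis
  then have "?h (s \<noteq> t) (act M X v) = ?h (s \<noteq> t) (act M X (?h t v)) + ?h (s \<noteq> t) (act M X (?h (\<not> t) v))"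
    by (simp only: hom_part_add)
  also have "?h (s \<noteq> t) (act M X (?h (\<not> t) v)) = 0"
  proof -
    have "?h (s \<noteq> t) (?h (s \<noteq> (\<not> t)) w) = 0" for w by (auto simp: pointwise)
    then show ?thesis using part[of "\<not> t"] by metis
  qed
  finally show ?thesis using part[of t] by simp
qed

lemma spo_ops_module:
  assumes M: "is_module odd3 spo21 V"
  shows "spo_ops (space V) (act V h_mat) (act V e_mat) (act V f_mat)"
    and "X \<in> spo21 \<Longrightarrow> v \<in> space V \<Longrightarrow>
      act V X v = spo_ops.spo_act (act V h_mat) (act V e_mat) (act V f_mat) X v"
proof -
  note mp = mat_part_generators and g = spo21_generators
  show ops: "spo_ops (space V) (act V h_mat) (act V e_mat) (act V f_mat)"
  proof
    fix v assume v: "v \<in> space V"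
    show "act V e_mat (act V f_mat v) = - act V h_mat v - act V f_mat (act V e_mat v)"
      using is_moduleD(8)[OF M g(2,3) v mp(2,3)] is_moduleD(6)[OF M g(1) v, of "-1"]
      by (simp add: spo21_brackets algebra_simps)
    show "act V h_mat (act V e_mat v) = act V e_mat (act V h_mat v) + act V e_mat v"
      using is_moduleD(8)[OF M g(1,2) v mp(1,2)] by (simp add: spo21_brackets algebra_simps)
    show "act V h_mat (act V f_mat v) = act V f_mat (act V h_mat v) - act V f_mat v"
      using is_moduleD(8)[OF M g(1,3) v mp(1,3)] is_moduleD(6)[OF M g(3) v, of "-1"]
      by (simp add: spo21_brackets algebra_simps)
  qed (use g in \<open>auto intro: is_moduleD[OF M]\<close>)
  show "act V X v = spo_ops.spo_act (act V h_mat) (act V e_mat) (act V f_mat) X v"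
    if X: "X \<in> spo21" and v: "v \<in> space V"
  proof -
    \<comment> \<open>The superbracket of an odd element with itself is twice its square, so the
      even root vectors are found after cancelling 2.\<close>
    have "cscale 2 (act V (mat_unit 1 2) v) = cscale 2 (act V e_mat (act V e_mat v))"
      using is_moduleD(8)[OF M g(2,2) v mp(2,2)] is_moduleD(6)[OF M g(4) v, of 2]
      by (simp add: spo21_brackets pointwise)
    then have ee: "act V (mat_unit 1 2) v = act V e_mat (act V e_mat v)" by (simp add: pointwise)
    have "cscale (-2) (act V (mat_unit 2 1) v) = cscale 2 (act V f_mat (act V f_mat v))"
      using is_moduleD(8)[OF M g(3,3) v mp(3,3)] is_moduleD(6)[OF M g(5) v, of "-2"]
      by (simp add: spo21_brackets pointwise)
    then have ff: "act V (mat_unit 2 1) v = - act V f_mat (act V f_mat v)"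
      by (simp add: pointwise) (metis minus_minus)
    have "act V X v = act V (mscale (X $ 1 $ 1) h_mat + mscale (X $ 1 $ 2) (mat_unit 1 2)
        + mscale (X $ 2 $ 1) (mat_unit 2 1) + mscale (X $ 1 $ 3) e_mat + mscale (X $ 2 $ 3) f_mat) v"
      using spo21_decompose[OF X] by simp
    also have "\<dots> = cscale (X $ 1 $ 1) (act V h_mat v) + cscale (X $ 1 $ 2) (act V (mat_unit 1 2) v)
        + cscale (X $ 2 $ 1) (act V (mat_unit 2 1) v)
        + cscale (X $ 1 $ 3) (act V e_mat v) + cscale (X $ 2 $ 3) (act V f_mat v)"
      using g v by (simp only: is_moduleD(5,6)[OF M] spo21_add spo21_mscale)
    also have "\<dots> = spo_ops.spo_act (act V h_mat) (act V e_mat) (act V f_mat) X v"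
      unfolding spo_ops.spo_act_def[OF ops] ee ff by (simp add: pointwise)
    finally show ?thesis .
  qed
qed

lemma irreducible_span:
  assumes irr: "irreducible_module \<pi> \<gg> M" and S: "S \<subseteq> space M" "\<And>x. x \<in> S \<Longrightarrow> \<exists>t. hom_part (odd_idx M) t x = x"
    and stable: "\<And>X x. X \<in> \<gg> \<Longrightarrow> x \<in> cfun.span S \<Longrightarrow> act M X x \<in> cfun.span S"
  shows "cfun.span S = {0} \<or> cfun.span S = space M"
proof -
  have "cfun.subspace (space M)"
    using irr is_moduleD(1)[of \<pi> \<gg> M] by (simp add: irreducible_module_def)
  then have sub: "cfun.span S \<subseteq> space M" using S(1) by (intro cfun.span_minimal)
  have "graded_subspace (odd_idx M) (cfun.span S)" by (rule graded_span[OF S(2)])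
  moreover have "\<forall>X\<in>\<gg>. \<forall>x\<in>cfun.span S. act M X x \<in> cfun.span S" using stable by simp
  moreover have "\<forall>U \<subseteq> space M. graded_subspace (odd_idx M) U \<and> (\<forall>X\<in>\<gg>. \<forall>u\<in>U. act M X u \<in> U) \<longrightarrow>
      U = {0} \<or> U = space M"
    using irr by (simp add: irreducible_module_def)
  ultimately show ?thesis using sub by simp
qed

theorem irr_spo21_basis:
  assumes "irr_spo21 V (of_nat a)"
  shows "\<exists>s v. spo_basis V a s v"
proof -
  have irr: "irreducible_module odd3 spo21 V" and M: "is_module odd3 spo21 V"
    using assms by (auto simp: irr_spo21_def irreducible_module_def)
  let ?H = "act V h_mat" and ?e = "act V e_mat" and ?f = "act V f_mat"
  interpret spo_ops "space V" ?H ?e ?f by (rule spo_ops_module(1)[OF M])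
  obtain v0 where v0: "v0 \<in> space V" "v0 \<noteq> 0" "?H v0 = cscale (of_nat a) v0" "?e v0 = 0"
    using assms by (auto simp: irr_spo21_def)
  obtain s where s: "hom_part (odd_idx V) s v0 \<noteq> 0"
    using hom_part_split[of v0 "odd_idx V"] v0(2) by (metis add.right_neutral)
  define v where "v = hom_part (odd_idx V) s v0"
  have v: "v \<in> space V" "v \<noteq> 0" using s v0(1) is_moduleD(2)[OF M] by (auto simp: v_def)
  have ev: "?e v = 0"
    using hom_part_act[OF M spo21_generators(2) mat_part_generators(2) v0(1), of s] v0(4) by (simp add: v_def)
  have Hv: "?H v = cscale (of_nat a) v"
    using hom_part_act[OF M spo21_generators(1) mat_part_generators(1) v0(1), of s] v0(3)
    by (simp add: v_def hom_part_cscale)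
  let ?u = "\<lambda>k. (?f ^^ k) v"
  note uin = u_in[OF v(1) ev Hv]
  have par: "hom_part (odd_idx V) (odd k \<noteq> s) (?u k) = ?u k" for k
  proof (induction k)
    case (Suc k)
    have "hom_part (odd_idx V) (True \<noteq> (odd k \<noteq> s)) (?f (?u k)) = ?f (?u k)"
      by (rule is_moduleD(7)[OF M spo21_generators(3) uin mat_part_generators(3) Suc])
    moreover have "(True \<noteq> (odd k \<noteq> s)) = (odd (Suc k) \<noteq> s)" by auto
    ultimately show ?case by simp
  qed (simp add: v_def hom_part_idem)
  have lin: "linear_on (space V) (spo_act X)" if "X \<in> spo21" for X
    using is_moduleD(4)[OF M that] spo_ops_module(2)[OF M that] is_moduleD(1)[OF M]
    unfolding linear_on_def by (metis cfun.subspace_add cfun.subspace_scale)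
  have span: "cfun.span (?u ` K) = {0} \<or> cfun.span (?u ` K) = space V"
    if K: "\<And>k. k \<in> K \<Longrightarrow> ?u (Suc k) \<in> cfun.span (?u ` K)" "\<And>k. k \<in> K \<Longrightarrow> e_coeff (of_nat a) k \<noteq> 0 \<Longrightarrow> k - 1 \<in> K" for K
  proof (rule irreducible_span[OF irr])
    show sub: "?u ` K \<subseteq> space V" using uin by auto
    show "\<exists>t. hom_part (odd_idx V) t x = x" if "x \<in> ?u ` K" for x using that par by blast
    fix X x assume X: "X \<in> spo21" "x \<in> cfun.span (?u ` K)"
    then have "x \<in> space V" using sub cfun.span_minimal is_moduleD(1)[OF M] by blast
    then show "act V X x \<in> cfun.span (?u ` K)"
      using spo_act_span[OF v(1) ev Hv K X(2) lin[OF X(1)]] spo_ops_module(2)[OF M X(1)] by simp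
  qed
  \<comment> \<open>If the tail f^k v with k > 2a spanned the module, \<open>v\<close> would be a
    combination of eigenvectors of \<open>H\<close> with eigenvalues other than a.\<close>
  have "cfun.span (?u ` {Suc (2 * a)..}) \<noteq> space V"
  proof
    assume "cfun.span (?u ` {Suc (2 * a)..}) = space V"
    then have "v \<in> cfun.span (?u ` {Suc (2 * a)..})" using v by simp
    then obtain T r where T: "finite T" "T \<subseteq> ?u ` {Suc (2 * a)..}" "v = (\<Sum>x\<in>T. cscale (r x) x)"
      unfolding cfun.span_explicit by blast
    \<comment> \<open>Vectors of the tail may coincide, for instance by being zero, so an index set
      on which they are distinct is selected.\<close>
    then obtain K where K: "K \<subseteq> {Suc (2 * a)..}" "T = ?u ` K" "inj_on ?u K"
      unfolding subset_image_inj by blast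
    then have fK: "finite K" using T(1) finite_image_iff by blast
    have 0: "0 \<notin> K" using K(1) by auto
    \<comment> \<open>The coefficient -1 at index 0 turns the expression for \<open>v\<close> into a
      linear relation.\<close>
    define c where "c k = (if k = 0 then - 1 else r (?u k))" for k
    note T(3)
    also have "(\<Sum>x\<in>T. cscale (r x) x) = (\<Sum>k\<in>K. cscale (r (?u k)) (?u k))"
      unfolding K(2) by (subst sum.reindex[OF K(3)]) simp
    also have "\<dots> = lc K c ?u"
      unfolding lc_def using 0 by (intro sum.cong) (auto simp: c_def)
    finally have "v = lc K c ?u" .
    moreover have "lc (insert 0 K) c ?u = cscale (- 1) v + lc K c ?u"
      by (simp add: lc_insert[OF fK 0] c_def)
    ultimately have "lc (insert 0 K) c ?u = cscale (- 1) v + v" by simp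
    then have "lc (insert 0 K) c ?u = 0" by simp
    from u_lc_zero[OF v(1) ev Hv _ this, of 0] fK show False using v(2) by (simp add: c_def)
  qed
  moreover have "cfun.span (?u ` {Suc (2 * a)..}) = {0} \<or> cfun.span (?u ` {Suc (2 * a)..}) = space V"
  proof (rule span)
    show "?u (Suc k) \<in> cfun.span (?u ` {Suc (2 * a)..})" if "k \<in> {Suc (2 * a)..}" for k
      using that by (intro cfun.span_base imageI) auto
    \<comment> \<open>Here \<open>e\<close> cannot leave the tail: its coefficient at the first
      index 2a + 1 is 0.\<close>
    have "e_coeff (of_nat a) (Suc (2 * a)) = 0" by (simp add: e_coeff_def)
    then show "k - 1 \<in> {Suc (2 * a)..}" if "k \<in> {Suc (2 * a)..}" "e_coeff (of_nat a) k \<noteq> 0" for k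
      using that by (cases "k = Suc (2 * a)") auto
  qed
  ultimately have "cfun.span (?u ` {Suc (2 * a)..}) = {0}" by blast
  then have u0: "?u k = 0" if "k > 2 * a" for k
    using that cfun.span_base[of "?u k" "?u ` {Suc (2 * a)..}"] by auto
  have "cfun.span (?u ` {..2 * a}) = {0} \<or> cfun.span (?u ` {..2 * a}) = space V"
  proof (rule span)
    show "?u (Suc k) \<in> cfun.span (?u ` {..2 * a})" if "k \<in> {..2 * a}" for k
      using u0[of "Suc k"] by (cases "Suc k \<le> 2 * a") (auto intro: cfun.span_base cfun.span_zero simp del: funpow.simps)
  qed auto
  moreover have "v \<in> cfun.span (?u ` {..2 * a})"
    by (rule cfun.span_base, rule image_eqI[of _ _ 0]) auto
  ultimately have span_u: "cfun.span (?u ` {..2 * a}) = space V" using v(2) by auto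
  have "basis_on {..2 * a} ?u (space V)"
    unfolding basis_on_def
  proof (intro conjI allI impI ballI)
    show "space V = range (\<lambda>c. lc {..2 * a} c ?u)"
      using range_lc_eq_span[of "{..2 * a}" ?u] span_u by simp
    show "?u k = 0" if "k \<notin> {..2 * a}" for k using u0 that by simp
    fix c k assume "lc {..2 * a} c ?u = 0" "k \<in> {..2 * a}"
    then show "c k = 0"
      using u_lc_zero[OF v(1) ev Hv, of "{..2 * a}" c k] u_nonzero[OF v(1) ev Hv refl v(2), of k]
      by (simp add: cscale_eq_0_iff)
  qed simp
  then have "spo_basis V a s ?u"
    unfolding spo_basis_def
    using par is_moduleD(4)[OF M] spo_ops_module(2)[OF M _ uin] spo_act_u[OF v(1) ev Hv] by auto
  then show ?thesis by blast
qed

section \<open>Irreducible modules over gl(1|1)\<close>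

lemma gl11_brackets:
  "super_bracket True True (mat_unit 1 2) (mat_unit 2 1) = mat_unit 1 1 + (mat_unit 2 2 :: complex^2^2)"
  "super_bracket True True (mat_unit 2 1) (mat_unit 2 1) = mscale 0 (mat_unit 2 1 :: complex^2^2)"
  "super_bracket False True (mat_unit 1 1) (mat_unit 2 1) = mscale (-1) (mat_unit 2 1 :: complex^2^2)"
  "super_bracket False True (mat_unit 2 2) (mat_unit 2 1) = (mat_unit 2 1 :: complex^2^2)"
  by (simp_all add: super_bracket_def mscale_def mat_unit_def matrix_matrix_mult_def vec_eq_iff forall_2 sum_2)

lemma mat_part_gl11:
  "mat_part odd2 False (mat_unit 1 1) = mat_unit 1 1" "mat_part odd2 False (mat_unit 2 2) = mat_unit 2 2"
  "mat_part odd2 True (mat_unit 1 2) = mat_unit 1 2" "mat_part odd2 True (mat_unit 2 1) = mat_unit 2 1"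
  by (simp_all add: mat_part_def odd2_def mat_unit_def vec_eq_iff forall_2)

lemma gl11_decompose:
  "Y = mscale (Y $ 1 $ 1) (mat_unit 1 1) + mscale (Y $ 2 $ 2) (mat_unit 2 2)
    + mscale (Y $ 2 $ 1) (mat_unit 2 1) + mscale (Y $ 1 $ 2) (mat_unit 1 2 :: complex^2^2)"
  by (simp add: mscale_def mat_unit_def vec_eq_iff forall_2)

theorem irr_gl11_basis:
  assumes "irr_gl11 W b c"
  shows "\<exists>s w. gl_basis W b c s w"
proof -
  have irr: "irreducible_module odd2 gl11 W" and M: "is_module odd2 gl11 W"
    using assms by (auto simp: irr_gl11_def irreducible_module_def)
  let ?G11 = "act W (mat_unit 1 1)" and ?G22 = "act W (mat_unit 2 2)"
    and ?G12 = "act W (mat_unit 1 2)" and ?G21 = "act W (mat_unit 2 1)"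
  have gl [simp]: "Y \<in> gl11" for Y by (simp add: gl11_def)
  note sub = is_moduleD(1)[OF M] and act_in = is_moduleD(3)[OF M gl] and lin = is_moduleD(4)[OF M gl]
  have act_eq: "act W Y v = cscale (Y $ 1 $ 1) (?G11 v) + cscale (Y $ 2 $ 2) (?G22 v)
      + cscale (Y $ 2 $ 1) (?G21 v) + cscale (Y $ 1 $ 2) (?G12 v)" if "v \<in> space W" for Y v
  proof -
    have "act W Y v = act W (mscale (Y $ 1 $ 1) (mat_unit 1 1) + mscale (Y $ 2 $ 2) (mat_unit 2 2)
        + mscale (Y $ 2 $ 1) (mat_unit 2 1) + mscale (Y $ 1 $ 2) (mat_unit 1 2)) v"
      using gl11_decompose[of Y] by simp
    also have "\<dots> = cscale (Y $ 1 $ 1) (?G11 v) + cscale (Y $ 2 $ 2) (?G22 v)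
        + cscale (Y $ 2 $ 1) (?G21 v) + cscale (Y $ 1 $ 2) (?G12 v)"
      using that by (simp only: is_moduleD(5,6)[OF M] gl)
    finally show ?thesis .
  qed
  obtain v0 where v0: "v0 \<in> space W" "v0 \<noteq> 0" "?G11 v0 = cscale b v0" "?G22 v0 = cscale c v0" "?G12 v0 = 0"
    using assms by (auto simp: irr_gl11_def)
  obtain s where s: "hom_part (odd_idx W) s v0 \<noteq> 0"
    using hom_part_split[of v0 "odd_idx W"] v0(2) by (metis add.right_neutral)
  define v where "v = hom_part (odd_idx W) s v0"
  have v: "v \<in> space W" "v \<noteq> 0" using s v0(1) is_moduleD(2)[OF M] by (auto simp: v_def)
  have hv: "?G11 v = cscale b v" "?G22 v = cscale c v" "?G12 v = 0"
    using hom_part_act[OF M gl mat_part_gl11(1) v0(1), of s] hom_part_act[OF M gl mat_part_gl11(2) v0(1), of s]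
      hom_part_act[OF M gl mat_part_gl11(3) v0(1), of s] v0(3-5) by (simp_all add: v_def hom_part_cscale)
  define w where "w k = (?G21 ^^ k) v" for k
  have w_in: "w k \<in> space W" for k
    by (induction k) (auto simp: w_def v act_in)
  have w0: "w 0 = v" and w_Suc: "w (Suc k) = ?G21 (w k)" for k by (simp_all add: w_def)
  have par: "hom_part (odd_idx W) (odd k \<noteq> s) (w k) = w k" for k
  proof (induction k)
    case (Suc k)
    have "hom_part (odd_idx W) (True \<noteq> (odd k \<noteq> s)) (?G21 (w k)) = ?G21 (w k)"
      by (rule is_moduleD(7)[OF M gl w_in mat_part_gl11(4) Suc])
    moreover have "(True \<noteq> (odd k \<noteq> s)) = (odd (Suc k) \<noteq> s)" by auto
    ultimately show ?case by (simp add: w_Suc)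
  qed (simp add: w0 v_def hom_part_idem)
  have G21_0: "?G21 0 = 0" by (rule linear_on_0[OF lin sub])
  have w2: "w (Suc (Suc k)) = 0" for k
  proof -
    \<comment> \<open>The bracket of E21 with itself is 0, written as \<open>mscale 0\<close> so
      that the scalar axiom of modules yields the zero vector.\<close>
    have "?G21 (?G21 (w k)) + ?G21 (?G21 (w k)) = 0"
      using is_moduleD(8)[OF M gl gl w_in mat_part_gl11(4,4)] is_moduleD(6)[OF M gl w_in, where c = 0]
      by (simp add: gl11_brackets)
    then show ?thesis by (simp add: w_Suc pointwise)
  qed
  have w1: "?G11 (w 1) = cscale (b - 1) (w 1)" "?G22 (w 1) = cscale (c + 1) (w 1)" "?G12 (w 1) = cscale (b + c) v"
  proof -
    have G21v: "?G21 (cscale r v) = cscale r (w 1)" for r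
      using linear_onD(2)[OF lin v(1)] by (simp add: w_Suc w0)
    have "?G11 (?G21 v) - ?G21 (?G11 v) = cscale (-1) (?G21 v)"
      using is_moduleD(8)[OF M gl gl v(1) mat_part_gl11(1,4)] is_moduleD(6)[OF M gl v(1)]
      by (simp add: gl11_brackets)
    then show "?G11 (w 1) = cscale (b - 1) (w 1)"
      unfolding hv G21v by (simp add: w_Suc w0 pointwise algebra_simps)
    have "?G22 (?G21 v) - ?G21 (?G22 v) = ?G21 v"
      using is_moduleD(8)[OF M gl gl v(1) mat_part_gl11(2,4)] by (simp add: gl11_brackets)
    then show "?G22 (w 1) = cscale (c + 1) (w 1)"
      unfolding hv G21v by (simp add: w_Suc w0 pointwise algebra_simps)
    have "?G12 (?G21 v) + ?G21 (?G12 v) = ?G11 v + ?G22 v"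
      using is_moduleD(8)[OF M gl gl v(1) mat_part_gl11(3,4)] is_moduleD(5)[OF M gl gl v(1)]
      by (simp add: gl11_brackets)
    then show "?G12 (w 1) = cscale (b + c) v"
      unfolding hv G21_0 by (simp add: w_Suc w0 pointwise algebra_simps)
  qed
  have act_w: "act W Y (w l) = cscale (Y $ 1 $ 1 * (b - of_nat l) + Y $ 2 $ 2 * (c + of_nat l)) (w l)
           + cscale (Y $ 2 $ 1) (w (l + 1))
           + cscale (Y $ 1 $ 2 * (if l = 1 then b + c else 0)) (w (l - 1))" if "l \<le> 1" for l Y
  proof -
    from that consider "l = 0" | "l = 1" by linarith
    then show ?thesis
    proof cases
      case 1
      then show ?thesis
        using act_eq[OF v(1), of Y] by (simp add: w0 w_Suc hv pointwise algebra_simps)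
    next
      case 2
      then show ?thesis
        using act_eq[OF w_in, of Y 1, unfolded w1] w2[of 0] w_Suc[of 1] by (simp add: w0 pointwise algebra_simps)
    qed
  qed
  have span: "cfun.span (w ` K) = {0} \<or> cfun.span (w ` K) = space W"
    if K: "K \<subseteq> {..1}" "0 \<in> K \<Longrightarrow> w 1 \<in> cfun.span (w ` K)" "b + c \<noteq> 0 \<Longrightarrow> 1 \<in> K \<Longrightarrow> 0 \<in> K" for K
  proof (rule irreducible_span[OF irr])
    show wK: "w ` K \<subseteq> space W" using w_in by auto
    show "\<exists>t. hom_part (odd_idx W) t x = x" if "x \<in> w ` K" for x using that par by blast
    fix Y x assume x: "x \<in> cfun.span (w ` K)"
    show "act W Y x \<in> cfun.span (w ` K)"
    proof (rule span_invariant[OF lin sub wK _ x])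
      fix y assume "y \<in> w ` K"
      then obtain l where l: "l \<in> K" "l \<le> 1" "y = w l" using K(1) by auto
      have "cscale r (w l) \<in> cfun.span (w ` K)" for r
        using l(1) by (intro cfun.span_scale cfun.span_base) auto
      moreover have "cscale (Y $ 1 $ 2 * (if l = 1 then b + c else 0)) (w (l - 1)) \<in> cfun.span (w ` K)"
        using K(3) l by (cases "l = 1 \<and> b + c \<noteq> 0") (auto simp: cfun.span_zero intro: cfun.span_scale cfun.span_base)
      moreover have "cscale r (w (l + 1)) \<in> cfun.span (w ` K)" for r
        using K(2) l w2[of 0] by (intro cfun.span_scale, cases "l = 0") (auto simp: cfun.span_zero le_Suc_eq)
      ultimately show "act W Y y \<in> cfun.span (w ` K)"
        unfolding l(3) act_w[OF l(2)] by (intro cfun.span_add)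
    qed
  qed
  \<comment> \<open>For b + c = 0 also E12 kills \<open>w 1\<close>, so \<open>w 1\<close> spans a
    submodule. It cannot contain \<open>v\<close>, whose eigenvalue under E11 is b instead of b -
    1.\<close>
  have w1_0: "w 1 = 0" if "b + c = 0"
  proof -
    have "cfun.span (w ` {1}) = {0} \<or> cfun.span (w ` {1}) = space W"
      using that by (intro span) auto
    moreover have "v \<notin> cfun.span (w ` {1})"
    proof
      assume "v \<in> cfun.span (w ` {1})"
      then obtain r where r: "v = cscale r (w 1)" by (auto simp: cfun.span_singleton)
      then have "?G11 v = cscale r (?G11 (w 1))" using linear_onD(2)[OF lin w_in] by simp
      then have "cscale b v = cscale (b - 1) v" unfolding hv w1 using r by (simp add: cscale_cscale mult.commute)
      then show False using v(2) by (simp add: pointwise algebra_simps)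
    qed
    ultimately show ?thesis using v(1) cfun.span_base[of "w 1" "w ` {1}"] by auto
  qed
  have w1_nz: "w 1 \<noteq> 0" if "b + c \<noteq> 0"
    using that w1(3) v(2) linear_on_0[OF lin sub] by (metis cscale_eq_0_iff)
  have w_out: "w k = 0" if k: "k > gl_len b c" for k
  proof (cases "k = 1")
    case False
    then obtain j where "k = Suc (Suc j)"
      using k by (cases k; cases "k - 1") auto
    then show ?thesis by (simp add: w2)
  qed (use k w1_0 in \<open>auto simp: gl_len_def split: if_splits\<close>)
  have "cfun.span (w ` {..gl_len b c}) = {0} \<or> cfun.span (w ` {..gl_len b c}) = space W"
    using w1_0 by (intro span) (auto simp: gl_len_def cfun.span_zero intro: cfun.span_base)
  moreover have "v \<in> cfun.span (w ` {..gl_len b c})"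
    by (rule cfun.span_base, rule image_eqI[of _ _ 0]) (auto simp: w0)
  ultimately have span_w: "cfun.span (w ` {..gl_len b c}) = space W" using v(2) by auto
  have G11w: "?G11 (w l) = cscale (b - of_nat l) (w l)" if "l \<le> gl_len b c" for l
    using that w1(1) hv(1) by (cases "l = 0") (auto simp: w0 gl_len_def le_Suc_eq split: if_splits)
  have "basis_on {..gl_len b c} w (space W)"
    unfolding basis_on_def
  proof (intro conjI allI impI ballI)
    show "space W = range (\<lambda>c'. lc {..gl_len b c} c' w)"
      using range_lc_eq_span[of "{..gl_len b c}" w] span_w by simp
    show "w k = 0" if "k \<notin> {..gl_len b c}" for k using w_out that by simp
    fix r k assume "lc {..gl_len b c} r w = 0" and k: "k \<in> {..gl_len b c}"
    then have "cscale (r k) (w k) = 0"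
      using G11w w_in
      by (intro eigenvectors_lc_zero[OF lin[of "mat_unit 1 1"] sub, where \<mu> = "\<lambda>k. b - of_nat k"]) (auto simp: inj_on_def)
    moreover have "w k \<noteq> 0"
      using k w1_nz v(2) by (cases "k = 0") (auto simp: w0 gl_len_def le_Suc_eq split: if_splits)
    ultimately show "r k = 0" by (simp add: cscale_eq_0_iff)
  qed simp
  moreover have "gl_len b c \<le> 1" by (simp add: gl_len_def)
  ultimately have "gl_basis W b c s w"
    unfolding gl_basis_def using par lin act_w by auto
  then show ?thesis by blast
qed

section \<open>Existence\<close>

text \<open>Coordinates with respect to w and E21 w. When b + c = 0 the second coordinate is absent:
  the factor \<open>gl_len b c\<close> suppresses E21, while E12 is switched off by its own
  coefficient b + c.\<close>

definition gl_model :: "complex \<Rightarrow> complex \<Rightarrow> (complex^2^2, nat) super_module" where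
  "gl_model b c = \<lparr>space = {v. \<forall>l>gl_len b c. v l = 0}, odd_idx = odd,
     act = (\<lambda>Y v l. if l = 0 then (Y $ 1 $ 1 * b + Y $ 2 $ 2 * c) * v 0 + Y $ 1 $ 2 * (b + c) * v 1
       else if l = 1 then (Y $ 1 $ 1 * (b - 1) + Y $ 2 $ 2 * (c + 1)) * v 1 + Y $ 2 $ 1 * of_nat (gl_len b c) * v 0
       else 0)\<rparr>"

lemma mat_part_odd2_iff:
  "mat_part odd2 s Y = Y \<longleftrightarrow> (if s then Y $ 1 $ 1 = 0 \<and> Y $ 2 $ 2 = 0 else Y $ 1 $ 2 = 0 \<and> Y $ 2 $ 1 = 0)"
  by (cases s) (auto simp: mat_part_def odd2_def vec_eq_iff forall_2)

lemma is_module_gl_model: "is_module odd2 gl11 (gl_model b c)"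
proof -
  let ?A = "act (gl_model b c)" and ?U = "space (gl_model b c)"
  have A: "?A Y v l = (if l = 0 then (Y $ 1 $ 1 * b + Y $ 2 $ 2 * c) * v 0 + Y $ 1 $ 2 * (b + c) * v 1
       else if l = 1 then (Y $ 1 $ 1 * (b - 1) + Y $ 2 $ 2 * (c + 1)) * v 1 + Y $ 2 $ 1 * of_nat (gl_len b c) * v 0
       else 0)" for Y v l
    by (simp add: gl_model_def)
  have U: "v \<in> ?U \<longleftrightarrow> (\<forall>l>gl_len b c. v l = 0)" for v by (simp add: gl_model_def)
  have sub: "graded_subspace odd ?U"
    unfolding graded_subspace_def cfun.subspace_def by (auto simp: U pointwise)
  have "?A Y v \<in> ?U" if "v \<in> ?U" for Y v
    using that by (auto simp: U A gl_len_def split: if_splits)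
  moreover have "linear_on ?U (?A Y)" for Y
    unfolding linear_on_def fun_eq_iff by (auto simp: A pointwise algebra_simps)
  moreover have "?A (X + Y) v = ?A X v + ?A Y v" "?A (mscale r X) v = cscale r (?A X v)" for X Y v r
    unfolding fun_eq_iff by (auto simp: A pointwise mscale_def algebra_simps)
  moreover have "hom_part odd (s \<noteq> t) (?A X v) = ?A X v" if "mat_part odd2 s X = X" "hom_part odd t v = v" for X v s t
  proof -
    have "v 0 = 0 \<or> \<not> t" "v 1 = 0 \<or> t" 
      using that(2) unfolding hom_part_eq_iff by (metis even_zero, metis odd_one)
    then show ?thesis
      using that(1) unfolding mat_part_odd2_iff fun_eq_iff hom_part_apply
      by (auto simp: A split: if_splits)
  qed
  moreover have "?A (super_bracket s t X Y) v =
          (if s \<and> t then ?A X (?A Y v) + ?A Y (?A X v) else ?A X (?A Y v) - ?A Y (?A X v))"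
    if s: "mat_part odd2 s X = X" and t: "mat_part odd2 t Y = Y" and v: "v \<in> ?U" for X Y v s t
  proof
    fix l
    have v1: "v 1 = 0 \<or> (b + c \<noteq> 0 \<and> gl_len b c = 1)" using v by (auto simp: U gl_len_def)
    have len: "gl_len b c = 0 \<and> c = - b \<or> gl_len b c = 1"
      by (auto simp: gl_len_def eq_neg_iff_add_eq_0 add.commute)
    show "?A (super_bracket s t X Y) v l =
          (if s \<and> t then ?A X (?A Y v) + ?A Y (?A X v) else ?A X (?A Y v) - ?A Y (?A X v)) l"
      using s t v1 len unfolding mat_part_odd2_iff
      by (cases s; cases t)
        (auto simp: A super_bracket_def matrix_matrix_mult_def sum_2 plus_fun_apply minus_apply algebra_simps)
  qed
  moreover have "odd_idx (gl_model b c) = odd" by (simp add: gl_model_def)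
  ultimately show ?thesis using sub unfolding is_module_def by simp
qed

lemma subspace_full:
  fixes n :: nat
  assumes "cfun.subspace U" "\<And>k. k \<le> n \<Longrightarrow> (\<lambda>i. if i = k then 1 else 0) \<in> U" "\<And>k. k > n \<Longrightarrow> v k = 0"
  shows "v \<in> U"
proof -
  have "v = lc {..n} v (\<lambda>k i. if i = k then 1 else 0)"
  proof
    fix i
    have "(\<Sum>k\<le>n. v k * (if i = k then 1 else 0)) = (if i \<le> n then v i else 0)"
      by (simp add: if_distrib[of "\<lambda>x. _ * x"] sum.delta' cong: if_cong)
    then show "v i = lc {..n} v (\<lambda>k i. if i = k then 1 else 0) i"
      using assms(3)[of i] by (simp add: lc_apply)
  qed
  also have "\<dots> \<in> U" using assms(1,2) by (intro subspace_lc) auto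
  finally show ?thesis .
qed

theorem irr_gl11_exists: "\<exists>M :: (complex^2^2, nat) super_module. irr_gl11 M b c"
proof -
  let ?M = "gl_model b c"
  let ?A = "act ?M"
  define \<delta> :: "nat \<Rightarrow> nat \<Rightarrow> complex" where "\<delta> k = (\<lambda>i. if i = k then 1 else 0)" for k
  have \<delta>_in: "\<delta> 0 \<in> space ?M" by (simp add: gl_model_def \<delta>_def)
  have "irreducible_module odd2 gl11 ?M"
    unfolding irreducible_module_def
  proof (intro conjI allI impI is_module_gl_model)
    have "\<delta> 0 \<noteq> 0" by (simp add: \<delta>_def pointwise)
    then show "space ?M \<noteq> {0}" using \<delta>_in by auto
    fix U assume U: "U \<subseteq> space ?M" and *: "graded_subspace (odd_idx ?M) U \<and> (\<forall>X\<in>gl11. \<forall>u\<in>U. ?A X u \<in> U)"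
    have sub: "cfun.subspace U" using * by (simp add: graded_subspace_def)
    show "U = {0} \<or> U = space ?M"
    proof (cases "U = {0}")
      case False
      then obtain u where u: "u \<in> U" "u \<noteq> 0" using cfun.subspace_0[OF sub] by blast
      \<comment> \<open>A nonzero vector either is a multiple of the highest weight vector or is
        sent to a nonzero multiple of it by E12.\<close>
      have \<delta>0: "\<delta> 0 \<in> U"
      proof (cases "u 1 = 0")
        case True
        have "u i = 0" if "i \<noteq> 0" for i
          using that True U u(1) by (cases "i = 1") (auto simp: gl_model_def gl_len_def split: if_splits)
        then have "u = cscale (u 0) (\<delta> 0)" by (auto simp: pointwise \<delta>_def)
        moreover from this have "u 0 \<noteq> 0" using u(2) by auto
        ultimately have "\<delta> 0 = cscale (1 / u 0) u" by (metis cscale_cscale cscale_one nonzero_eq_divide_eq)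
        then show ?thesis using u(1) sub by (metis cfun.subspace_scale)
      next
        case False
        then have bc: "b + c \<noteq> 0" using U u(1) by (auto simp: gl_model_def gl_len_def)
        have "?A (mat_unit 1 2) u = cscale ((b + c) * u 1) (\<delta> 0)"
          by (auto simp: gl_model_def pointwise \<delta>_def mat_unit_def)
        then have "\<delta> 0 = cscale (1 / ((b + c) * u 1)) (?A (mat_unit 1 2) u)"
          using False bc by (simp add: cscale_cscale)
        moreover have "?A (mat_unit 1 2) u \<in> U" using * u(1) by (simp add: gl11_def)
        ultimately show ?thesis using sub by (metis cfun.subspace_scale)
      qed
      have "\<delta> k \<in> U" if "k \<le> gl_len b c" for k
      proof (cases "k = 0")
        case False
        then have k: "k = 1" "gl_len b c = 1" using that by (auto simp: gl_len_def split: if_splits)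
        then have "?A (mat_unit 2 1) (\<delta> 0) = \<delta> k"
          by (auto simp: gl_model_def pointwise \<delta>_def mat_unit_def)
        moreover have "?A (mat_unit 2 1) (\<delta> 0) \<in> U" using * \<delta>0 by (simp add: gl11_def)
        ultimately show ?thesis by simp
      qed (use \<delta>0 in simp)
      then have "v \<in> U" if "v \<in> space ?M" for v
        using subspace_full[OF sub, of "gl_len b c" v, folded \<delta>_def] that by (simp add: gl_model_def)
      then show ?thesis using U by blast
    qed simp
  qed
  moreover have "?A (mat_unit 1 1) (\<delta> 0) = cscale b (\<delta> 0)" "?A (mat_unit 2 2) (\<delta> 0) = cscale c (\<delta> 0)"
    "?A (mat_unit 1 2) (\<delta> 0) = 0"
    by (auto simp: gl_model_def pointwise \<delta>_def mat_unit_def)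
  moreover have "\<delta> 0 \<noteq> 0" by (simp add: \<delta>_def pointwise)
  ultimately show ?thesis unfolding irr_gl11_def using \<delta>_in by blast
qed

lemma mat_part_odd3_iff:
  assumes "X \<in> spo21"
  shows "mat_part odd3 s X = X \<longleftrightarrow>
    (if s then X $ 1 $ 1 = 0 \<and> X $ 1 $ 2 = 0 \<and> X $ 2 $ 1 = 0 else X $ 1 $ 3 = 0 \<and> X $ 2 $ 3 = 0)"
  using assms by (cases s) (auto simp: spo21_iff mat_part_def odd3_def vec_eq_iff forall_3)

text \<open>Converse of \<open>spo_ops_module\<close>: on a graded space, the three relations and
  the oddness of \<open>e\<close> and \<open>f\<close> imply the axioms of an spo(2|1)-module. The
  bracket axiom reduces to normal forms in \<open>H\<close>, \<open>e\<close> and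
  \<open>f\<close>.\<close>

lemma (in spo_ops) is_module_spo_act:
  assumes graded: "graded_subspace p U"
    and e_par: "\<And>v t. v \<in> U \<Longrightarrow> hom_part p t v = v \<Longrightarrow> hom_part p (\<not> t) (e v) = e v"
    and f_par: "\<And>v t. v \<in> U \<Longrightarrow> hom_part p t v = v \<Longrightarrow> hom_part p (\<not> t) (f v) = f v"
  shows "is_module odd3 spo21 \<lparr>space = U, odd_idx = p, act = spo_act\<rparr>"
proof -
  note in_U [simp] = H_in e_in f_in cfun.subspace_add[OF subspace] cfun.subspace_diff[OF subspace]
    cfun.subspace_scale[OF subspace]
  note lin = linear_onD[OF H_lin] linear_onD[OF e_lin] linear_onD[OF f_lin]
    linear_on_diff[OF H_lin subspace] linear_on_diff[OF e_lin subspace] linear_on_diff[OF f_lin subspace]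
  have neg: "h (- v) = - h v" if "linear_on U h" "v \<in> U" for h v
    using linear_onD(2)[OF that, of "-1"] by simp
  note normal = e_f H_e H_f neg[OF H_lin] neg[OF e_lin] neg[OF f_lin] cfun.subspace_neg[OF subspace]
  have act_in: "spo_act X v \<in> U" if "v \<in> U" for X v
    using that by (simp add: spo_act_def)
  have act_lin: "linear_on U (spo_act X)" for X
    unfolding linear_on_def by (simp add: spo_act_def lin) (simp add: pointwise algebra_simps)
  have act_add: "spo_act (X + Y) v = spo_act X v + spo_act Y v" for X Y v
    by (simp add: spo_act_def) (simp add: pointwise algebra_simps)
  have act_mscale: "spo_act (mscale r X) v = cscale r (spo_act X v)" for X r v
    by (simp add: spo_act_def mscale_def) (simp add: pointwise algebra_simps)
  \<comment> \<open>\<open>H\<close> is - (e f + f e), so its evenness follows from the oddness of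
    \<open>e\<close> and \<open>f\<close>.\<close>
  have H_par: "hom_part p t (H v) = H v" if "v \<in> U" "hom_part p t v = v" for v t
  proof -
    have "hom_part p t (e (f v)) = e (f v)" "hom_part p t (f (e v)) = f (e v)"
      using e_par[OF f_in f_par[OF that]] f_par[OF e_in e_par[OF that]] that(1) by auto
    moreover have "H v i = - e (f v) i - f (e v) i" for i
      using e_f[OF that(1)] by (simp add: pointwise)
    ultimately show ?thesis unfolding hom_part_eq_iff by force
  qed
  have act_par: "hom_part p (s \<noteq> t) (spo_act X v) = spo_act X v"
    if X: "X \<in> spo21" "mat_part odd3 s X = X" and v: "v \<in> U" "hom_part p t v = v" for X v s t
  proof -
    have ev: "hom_part p (\<not> t) (e v) = e v" and fv: "hom_part p (\<not> t) (f v) = f v"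
      and Hv: "hom_part p t (H v) = H v"
      using e_par f_par H_par v by auto
    have eev: "hom_part p t (e (e v)) = e (e v)" and ffv: "hom_part p t (f (f v)) = f (f v)"
      using e_par[OF _ ev] f_par[OF _ fv] v by auto
    show ?thesis
    proof (cases s)
      case True
      then have "spo_act X v = cscale (X $ 1 $ 3) (e v) + cscale (X $ 2 $ 3) (f v)"
        using X by (simp add: mat_part_odd3_iff spo_act_def)
      then show ?thesis using True ev fv by (simp add: hom_part_add hom_part_cscale)
    next
      case False
      then have "spo_act X v = cscale (X $ 1 $ 1) (H v) + cscale (X $ 1 $ 2) (e (e v)) + cscale (- X $ 2 $ 1) (f (f v))"
        using X by (simp add: mat_part_odd3_iff spo_act_def)
      then show ?thesis using False Hv eev ffv by (simp only: hom_part_add hom_part_cscale) simp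
    qed
  qed
  have bracket: "spo_act (super_bracket s t X Y) v =
      (if s \<and> t then spo_act X (spo_act Y v) + spo_act Y (spo_act X v)
       else spo_act X (spo_act Y v) - spo_act Y (spo_act X v))"
    if X: "X \<in> spo21" "mat_part odd3 s X = X" and Y: "Y \<in> spo21" "mat_part odd3 t Y = Y" and v: "v \<in> U" for X Y s t v
  proof -
    have X': "if s then X $ 1 $ 1 = 0 \<and> X $ 1 $ 2 = 0 \<and> X $ 2 $ 1 = 0 else X $ 1 $ 3 = 0 \<and> X $ 2 $ 3 = 0"
      and Y': "if t then Y $ 1 $ 1 = 0 \<and> Y $ 1 $ 2 = 0 \<and> Y $ 2 $ 1 = 0 else Y $ 1 $ 3 = 0 \<and> Y $ 2 $ 3 = 0"
      using X Y by (simp_all add: mat_part_odd3_iff)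
    show ?thesis
      using X' Y' v
      by (cases s; cases t)
        (simp_all add: spo_act_def super_bracket_def matrix_matrix_mult_def sum_3 spo21_entries[OF X(1)] spo21_entries[OF Y(1)]
          lin normal, simp_all add: pointwise algebra_simps)
  qed
  show ?thesis
    unfolding is_module_def using graded act_in act_lin act_add act_mscale act_par bracket by simp
qed

theorem irr_spo21_exists: "\<exists>M :: (complex^3^3, nat) super_module. irr_spo21 M (of_nat a)"
proof -
  \<comment> \<open>Here \<open>v k\<close> is the coefficient of f^k applied to the highest weight
    vector, so \<open>e\<close> reads coordinate k + 1 with a factor from \<open>e_coeff\<close>,
    and \<open>f\<close> shifts.\<close>
  define U :: "(nat \<Rightarrow> complex) set" where "U = {v. \<forall>k>2 * a. v k = 0}"
  define H :: "(nat \<Rightarrow> complex) \<Rightarrow> nat \<Rightarrow> complex" where "H v k = (of_nat a - of_nat k) * v k" for v k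
  define e :: "(nat \<Rightarrow> complex) \<Rightarrow> nat \<Rightarrow> complex" where "e v k = e_coeff (of_nat a) (Suc k) * v (Suc k)" for v k
  define f :: "(nat \<Rightarrow> complex) \<Rightarrow> nat \<Rightarrow> complex" where "f v k = (if 0 < k \<and> k \<le> 2 * a then v (k - 1) else 0)" for v k
  have U: "v \<in> U \<longleftrightarrow> (\<forall>k>2 * a. v k = 0)" for v by (simp add: U_def)
  have sub: "cfun.subspace U" unfolding cfun.subspace_def by (auto simp: U pointwise)
  interpret spo_ops U H e f
  proof
    fix v assume v: "v \<in> U"
    show "e (f v) = - H v - f (e v)"
    proof
      fix k
      \<comment> \<open>Cutting the chain after index 2a is compatible with the relation because
        \<open>e\<close> has coefficient 0 from 2a + 1 to 2a.\<close>
      have top: "e_coeff (of_nat a) (Suc (2 * a)) = 0" by (simp add: e_coeff_def)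
      consider "k > 2 * a" | "k = 2 * a" | "k < 2 * a" by linarith
      then show "e (f v) k = (- H v - f (e v)) k"
      proof cases
        case 1
        then show ?thesis using v by (simp add: H_def e_def f_def pointwise U)
      next
        case 2
        then show ?thesis using top e_coeff_Suc[of "of_nat a" "2 * a"]
          by (auto simp: H_def e_def f_def pointwise algebra_simps)
      next
        case 3
        then show ?thesis
          by (cases k) (auto simp: H_def e_def f_def pointwise algebra_simps e_coeff_Suc)
      qed
    qed
    show "H (e v) = e (H v) + e v" by (auto simp: H_def e_def pointwise algebra_simps)
    show "H (f v) = f (H v) - f v"
    proof
      show "H (f v) k = (f (H v) - f v) k" for k
        by (cases k) (auto simp: H_def f_def pointwise algebra_simps)
    qed
  qed (use sub in \<open>auto simp: linear_on_def pointwise U H_def e_def f_def algebra_simps\<close>)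
  define M where "M = \<lparr>space = U, odd_idx = odd, act = spo_act\<rparr>"
  define \<delta> :: "nat \<Rightarrow> nat \<Rightarrow> complex" where "\<delta> k = (\<lambda>i. if i = k then 1 else 0)" for k
  have "is_module odd3 spo21 M"
    unfolding M_def
  proof (rule is_module_spo_act)
    show "graded_subspace odd U" unfolding graded_subspace_def using sub by (auto simp: U pointwise)
    show "hom_part odd (\<not> t) (e v) = e v" if "hom_part odd t v = v" for v t
      using that unfolding hom_part_eq_iff e_def by force
    show "hom_part odd (\<not> t) (f v) = f v" if "hom_part odd t v = v" for v t
      using that unfolding hom_part_eq_iff f_def by (auto split: if_splits)
  qed
  have \<delta>U: "\<delta> k \<in> U" if "k \<le> 2 * a" for k using that by (auto simp: U \<delta>_def)
  have \<delta>0: "\<delta> 0 \<noteq> 0" by (simp add: \<delta>_def pointwise)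
  have e\<delta>: "e (\<delta> 0) = 0" and H\<delta>: "H (\<delta> 0) = cscale (of_nat a) (\<delta> 0)"
    by (auto simp: e_def H_def \<delta>_def pointwise)
  have act_e: "spo_act e_mat v = e v" and act_f: "spo_act f_mat v = f v" for v
    by (simp_all add: spo_act_def mat_unit_def)
  have "irreducible_module odd3 spo21 M"
    unfolding irreducible_module_def
  proof (intro conjI allI impI)
    show "space M \<noteq> {0}" using \<delta>U[of 0] \<delta>0 by (auto simp: M_def)
    fix T assume T: "T \<subseteq> space M" and *: "graded_subspace (odd_idx M) T \<and> (\<forall>X\<in>spo21. \<forall>u\<in>T. act M X u \<in> T)"
    have Tsub: "cfun.subspace T" using * by (simp add: graded_subspace_def)
    have "act M X u \<in> T" if "X \<in> spo21" "u \<in> T" for X u using * that by blast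
    from this[OF spo21_generators(2)] this[OF spo21_generators(3)]
    have Te: "e u \<in> T" and Tf: "f u \<in> T" if "u \<in> T" for u
      using that by (simp_all add: M_def act_e act_f)
    show "T = {0} \<or> T = space M"
    proof (cases "T = {0}")
      case False
      then obtain u where u: "u \<in> T" "u \<noteq> 0" using cfun.subspace_0[OF Tsub] by blast
      \<comment> \<open>Induction on the last nonzero coordinate: \<open>e\<close> lowers its index
        by one without killing it, until a multiple of \<open>\<delta> 0\<close> is left.\<close>
      have top: "\<delta> 0 \<in> T" if "u \<in> T" "u n \<noteq> 0" "\<forall>k>n. u k = 0" "n \<le> 2 * a" for u n
        using that
      proof (induction n arbitrary: u)
        case 0
        then have "\<delta> 0 = cscale (1 / u 0) u" by (auto simp: \<delta>_def pointwise)
        then show ?case using 0 Tsub by (simp add: cfun.subspace_scale)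
      next
        case (Suc n)
        show ?case
        proof (rule Suc.IH)
          show "e u \<in> T" using Te Suc.prems(1) .
        qed (use Suc.prems e_coeff_nonzero[of "Suc n" a] in \<open>auto simp: e_def\<close>)
      qed
      obtain i where i: "u i \<noteq> 0" using u(2) by (auto simp: pointwise)
      have bound: "k \<le> 2 * a" if "u k \<noteq> 0" for k
      proof -
        have "u \<in> U" using u(1) T by (auto simp: M_def)
        then show ?thesis using that U not_le by blast
      qed
      define n where "n = Max {k. u k \<noteq> 0}"
      have fin: "finite {k. u k \<noteq> 0}" by (rule finite_subset[of _ "{..2 * a}"]) (auto dest: bound)
      have n: "u n \<noteq> 0" "\<forall>k>n. u k = 0"
        using Max_in[OF fin] Max_ge[OF fin] i unfolding n_def by (blast, force)
      have \<delta>0T: "\<delta> 0 \<in> T" by (rule top[OF u(1) n bound[OF n(1)]])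
      have \<delta>T: "\<delta> k \<in> T" if "k \<le> 2 * a" for k
        using that
      proof (induction k)
        case (Suc k)
        then have "f (\<delta> k) = \<delta> (Suc k)" by (auto simp: f_def \<delta>_def fun_eq_iff)
        then show ?case using Tf[of "\<delta> k"] Suc by simp
      qed (simp add: \<delta>0T)
      have "v \<in> T" if "v \<in> U" for v
        using subspace_full[OF Tsub, of "2 * a" v, folded \<delta>_def] \<delta>T that by (simp add: U)
      then show ?thesis using T by (auto simp: M_def)
    qed simp
  qed fact
  moreover have "act M h_mat (\<delta> 0) = cscale (of_nat a) (\<delta> 0)" "act M (mat_unit 1 2) (\<delta> 0) = 0" "act M e_mat (\<delta> 0) = 0"
    using linear_on_0[OF e_lin sub] by (simp_all add: M_def spo_act_def mat_unit_def H\<delta> e\<delta>)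
  ultimately have "irr_spo21 M (of_nat a)"
    unfolding irr_spo21_def using \<delta>U[of 0] \<delta>0 by (auto simp: M_def)
  then show ?thesis by blast
qed

section \<open>The kernel of \<open>F\<^sub>1\<^sub>2\<close>\<close>

definition mon :: "nat \<Rightarrow> nat \<Rightarrow> nat \<Rightarrow> nat \<Rightarrow> nat \<Rightarrow> nat \<Rightarrow> gen \<Rightarrow> nat" where
  "mon i j k r s t = (\<lambda>g. case g of X1 \<Rightarrow> i | X2 \<Rightarrow> j | X3 \<Rightarrow> k | Eta1 \<Rightarrow> r | Eta2 \<Rightarrow> s | Eta3 \<Rightarrow> t)"

lemma mon_simps [simp]:
  "mon i j k r s t X1 = i" "mon i j k r s t X2 = j" "mon i j k r s t X3 = k"
  "mon i j k r s t Eta1 = r" "mon i j k r s t Eta2 = s" "mon i j k r s t Eta3 = t"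
  "(mon i j k r s t)(X1 := n) = mon n j k r s t" "(mon i j k r s t)(X2 := n) = mon i n k r s t"
  "(mon i j k r s t)(X3 := n) = mon i j n r s t" "(mon i j k r s t)(Eta1 := n) = mon i j k n s t"
  "(mon i j k r s t)(Eta2 := n) = mon i j k r n t" "(mon i j k r s t)(Eta3 := n) = mon i j k r s n"
  by (auto simp: mon_def fun_eq_iff split: gen.splits)

lemma mon_exhaust: "m = mon (m X1) (m X2) (m X3) (m Eta1) (m Eta2) (m Eta3)"
  by (auto simp: mon_def fun_eq_iff split: gen.splits)

lemma is_monomial_mon [simp]: "is_monomial (mon i j k r s t) \<longleftrightarrow> r \<le> 1 \<and> s \<le> 1 \<and> t \<le> 1"
  by (simp add: is_monomial_def)

lemma p_mon_zero:
  assumes "p \<in> S_all" "1 < r \<or> 1 < s \<or> 1 < t"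
  shows "p (mon i j k r s t) = 0"
  using assms by (intro S_all_zero) auto

text \<open>With A and B as coefficients of power series in x1 and x2, the hypotheses read x1 A + x2
  B = 0 and dB/dx1 = dA/dx2. The second makes (A, B) a gradient, and by Euler's formula the first
  kills every part of positive degree of the potential. In coefficients this is the factor i + j + 2
  in front of \<open>A i (Suc j)\<close>.\<close>

lemma curl_system_zero:
  fixes A B :: "nat \<Rightarrow> nat \<Rightarrow> complex"
  assumes "\<And>i j. A i (Suc j) + B (Suc i) j = 0" "\<And>i. A i 0 = 0" "\<And>j. B 0 j = 0"
    and "\<And>i j. (1 + of_nat i) * B (Suc i) j = (1 + of_nat j) * A i (Suc j)"
  shows "A i j = 0" "B i j = 0"
proof -
  have A: "A i (Suc j) = 0" for i j
  proof -
    have "B (Suc i) j = - A i (Suc j)" using assms(1)[of i j] by (simp add: add_eq_0_iff)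
    then have "(of_nat (Suc (Suc (i + j))) :: complex) * A i (Suc j) = 0"
      using assms(4)[of i j] by (simp add: algebra_simps minus_equation_iff add_eq_0_iff)
    then show ?thesis by (simp del: of_nat_Suc)
  qed
  then show "A i j = 0" using assms(2) by (cases j) auto
  show "B i j = 0" using assms(1)[of "i - 1" j] A assms(3) by (cases i) auto
qed

lemma F12_kernel_zero:
  assumes p: "p \<in> S_all" and "F12 p = 0" "D12 p = 0" "D22 p = 0"
    and H0: "\<And>i j t. t \<le> 1 \<Longrightarrow> p (mon i j 0 0 0 t) = 0"
    and H1: "\<And>i j t. t \<le> 1 \<Longrightarrow> p (mon i j 1 0 0 t) = 0"
    and H2: "p (mon 0 0 0 1 1 1) = 0"
  shows "p = 0"
proof -
  note z = p_mon_zero[OF p]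
  have F12: "F12 p m = 0" and D12: "D12 p m = 0" and D22: "D22 p m = 0" for m
    using assms(2-4) by (simp_all add: zero_fun_apply)
  note expand = F12_def D12_def D22_def gmult_def pd_def pointwise z
  have H1': "p (mon i j (Suc 0) 0 0 0) = 0" "p (mon i j (Suc 0) 0 0 (Suc 0)) = 0" for i j
    using H1[of 0] H1[of 1] by auto
  have s1: "p (mon i j 0 1 0 0) = 0" "p (mon i j 0 0 1 0) = 0" for i j
  proof -
    note * = curl_system_zero[of "\<lambda>i j. p (mon i j 0 1 0 0)" "\<lambda>i j. p (mon i j 0 0 1 0)"]
    have "p (mon i (Suc j) 0 1 0 0) + p (mon (Suc i) j 0 0 1 0) = 0" for i j
      using F12[of "mon (Suc i) (Suc j) 0 0 0 0"] by (simp add: expand) (metis add.right_inverse)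
    moreover have "p (mon i 0 0 1 0 0) = 0" for i
      using F12[of "mon (Suc i) 0 0 0 0 0"] by (simp add: expand)
    moreover have "p (mon 0 j 0 0 1 0) = 0" for j
      using F12[of "mon 0 (Suc j) 0 0 0 0"] by (simp add: expand)
    moreover have "(1 + of_nat i) * p (mon (Suc i) j 0 0 1 0) = (1 + of_nat j) * p (mon i (Suc j) 0 1 0 0)" for i j
      using D12[of "mon i j 0 0 0 0"] by (simp add: expand H1')
    ultimately show "p (mon i j 0 1 0 0) = 0" "p (mon i j 0 0 1 0) = 0" using * by blast+
  qed
  have s2: "p (mon i j 0 1 0 1) = 0" "p (mon i j 0 0 1 1) = 0" for i j
  proof -
    note * = curl_system_zero[of "\<lambda>i j. p (mon i j 0 1 0 1)" "\<lambda>i j. p (mon i j 0 0 1 1)"]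
    have "p (mon i (Suc j) 0 1 0 1) + p (mon (Suc i) j 0 0 1 1) = 0" for i j
      using F12[of "mon (Suc i) (Suc j) 0 0 0 1"] by (simp add: expand H1') (metis add.right_inverse)
    moreover have "p (mon i 0 0 1 0 1) = 0" for i
      using F12[of "mon (Suc i) 0 0 0 0 1"] by (simp add: expand H1')
    moreover have "p (mon 0 j 0 0 1 1) = 0" for j
      using F12[of "mon 0 (Suc j) 0 0 0 1"] by (simp add: expand H1')
    moreover have "(1 + of_nat i) * p (mon (Suc i) j 0 0 1 1) = (1 + of_nat j) * p (mon i (Suc j) 0 1 0 1)" for i j
      using D12[of "mon i j 0 0 0 1"] by (simp add: expand)
    ultimately show "p (mon i j 0 1 0 1) = 0" "p (mon i j 0 0 1 1) = 0" using * by blast+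
  qed
  have s3: "p (mon i j 0 1 1 0) = 0" for i j
    using F12[of "mon i (Suc j) 0 1 0 0"] by (simp add: expand split: if_splits)
  \<comment> \<open>\<open>D12\<close> lowers x2 together with eta1, or x1 together with eta2, so it
    reaches this coefficient only if a factor x1 or x2 is present. The remaining monomial eta1 eta2
    eta3 is the assumption \<open>H2\<close>, and is the source of the third summand for d =
    3.\<close>
  have s4: "p (mon i j 0 1 1 1) = 0" for i j
  proof (cases j)
    case (Suc j')
    then show ?thesis
      using D12[of "mon i j' 0 0 1 1"] of_nat_neq_0[of j', where 'a = complex] by (simp add: expand)
  next
    case 0
    then show ?thesis
      using D12[of "mon (i - 1) 0 0 1 0 1"] of_nat_neq_0[of "i - 1", where 'a = complex] H2
      by (cases i) (simp_all add: expand)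
  qed
  \<comment> \<open>The terms of x3-degree 2 come in already here, since \<open>F12\<close> and
    \<open>D12\<close> both contain a derivative in x3 and bring them into the equations of
    x3-degree 1.\<close>
  have s5: "p (mon i j 2 0 0 0) = 0" "p (mon i j 2 0 0 1) = 0" for i j
    using D22[of "mon i j 0 0 0 0"] D22[of "mon i j 0 0 0 1"] s3 s4 by (simp_all add: expand numeral_2_eq_2)
  have s6: "p (mon i j 1 1 0 0) = 0" "p (mon i j 1 0 1 0) = 0" for i j
  proof -
    note * = curl_system_zero[of "\<lambda>i j. p (mon i j 1 1 0 0)" "\<lambda>i j. p (mon i j 1 0 1 0)"]
    have "p (mon i (Suc j) 1 1 0 0) + p (mon (Suc i) j 1 0 1 0) = 0" for i j
      using F12[of "mon (Suc i) (Suc j) 1 0 0 0"] by (simp add: expand) (metis add.right_inverse)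
    moreover have "p (mon i 0 1 1 0 0) = 0" for i
      using F12[of "mon (Suc i) 0 1 0 0 0"] by (simp add: expand)
    moreover have "p (mon 0 j 1 0 1 0) = 0" for j
      using F12[of "mon 0 (Suc j) 1 0 0 0"] by (simp add: expand)
    moreover have "(1 + of_nat i) * p (mon (Suc i) j 1 0 1 0) = (1 + of_nat j) * p (mon i (Suc j) 1 1 0 0)" for i j
      using D12[of "mon i j 1 0 0 0"] s5 by (simp add: expand numeral_2_eq_2)
    ultimately show "p (mon i j 1 1 0 0) = 0" "p (mon i j 1 0 1 0) = 0" using * by blast+
  qed
  have s7: "p (mon i j 1 1 1 0) = 0" for i j
    using F12[of "mon i (Suc j) 1 1 0 0"] by (simp add: expand split: if_splits)
  have s8: "p (mon i j 1 1 0 1) = 0" "p (mon i j 1 0 1 1) = 0" for i j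
  proof -
    note * = curl_system_zero[of "\<lambda>i j. p (mon i j 1 1 0 1)" "\<lambda>i j. p (mon i j 1 0 1 1)"]
    have s5': "p (mon i j (Suc (Suc 0)) 0 0 0) = 0" for i j using s5 by (simp add: numeral_2_eq_2)
    have "p (mon i (Suc j) 1 1 0 1) + p (mon (Suc i) j 1 0 1 1) = 0" for i j
      using F12[of "mon (Suc i) (Suc j) 1 0 0 1"] by (simp add: expand s5') (metis add.right_inverse)
    moreover have "p (mon i 0 1 1 0 1) = 0" for i
      using F12[of "mon (Suc i) 0 1 0 0 1"] by (simp add: expand s5')
    moreover have "p (mon 0 j 1 0 1 1) = 0" for j
      using F12[of "mon 0 (Suc j) 1 0 0 1"] by (simp add: expand s5')
    moreover have "(1 + of_nat i) * p (mon (Suc i) j 1 0 1 1) = (1 + of_nat j) * p (mon i (Suc j) 1 1 0 1)" for i j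
      using D12[of "mon i j 1 0 0 1"] by (simp add: expand)
    ultimately show "p (mon i j 1 1 0 1) = 0" "p (mon i j 1 0 1 1) = 0" using * by blast+
  qed
  have s9: "p (mon i j 1 1 1 1) = 0" for i j
    using D12[of "mon i j 0 1 1 0"] by (simp add: expand)
  \<comment> \<open>In the equation of \<open>D22\<close> the second x3-derivative is balanced by
    the coefficient with eta1 eta2 added and x3-degree \<open>k\<close>, which is 0 by
    assumption.\<close>
  have two_step: "p (mon i j (Suc (Suc k)) r s t) = 0"
    if "\<And>r s t. p (mon i j k r s t) = 0" for i j k r s t
  proof -
    have "(1 + of_nat k) * ((2 + of_nat k) * p (mon i j (Suc (Suc k)) r s t)) = 0"
      using D22[of "mon i j k r s t"] that by (simp add: expand)
    moreover have "(1 + of_nat k :: complex) \<noteq> 0" "(2 + of_nat k :: complex) \<noteq> 0"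
      using of_nat_neq_0[of k, where 'a = complex] of_nat_neq_0[of "Suc k", where 'a = complex]
      by (simp_all add: add.assoc[symmetric])
    ultimately show ?thesis by simp
  qed
  have all: "p (mon i j k r s t) = 0" for i j k r s t
  proof (induction k arbitrary: r s t rule: nat_induct2)
    case 0
    show ?case
      using H0[of 0 i j] H0[of 1 i j] s1[of i j] s2[of i j] s3[of i j] s4[of i j] z[of r s t i j 0]
      by (cases "r \<le> 1 \<and> s \<le> 1 \<and> t \<le> 1") (auto simp: le_Suc_eq)
  next
    case 1
    show ?case
      using H1[of 0 i j] H1[of 1 i j] s6[of i j] s7[of i j] s8[of i j] s9[of i j] z[of r s t i j 1]
      by (cases "r \<le> 1 \<and> s \<le> 1 \<and> t \<le> 1") (auto simp: le_Suc_eq)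
  next
    case (step k)
    then show ?case using two_step by simp
  qed
  show ?thesis
  proof
    show "p m = 0 m" for m using all by (subst mon_exhaust) (simp add: pointwise)
  qed
qed

section \<open>Weights, degree and stability of the spaces \<open>S_inv d\<close>\<close>

lemma gmult_pd_diag:
  assumes "p \<in> S_all"
  shows "gmult g (pd g p) m = of_nat (m g) * p m"
proof (cases "is_monomial m")
  case True
  then show ?thesis
    by (cases g) (auto simp: gmult_def pd_def is_monomial_def fun_upd_idem dest!: le_Suc_0_cases)
next
  case False
  then show ?thesis using assms by (auto simp: gmult_def S_all_def)
qed

lemma S_deg_gmult_pd:
  assumes "p \<in> S_deg d"
  shows "gmult g (pd h p) \<in> S_deg d"
proof -
  have "total_degree m = d" if "gmult g (pd h p) m \<noteq> 0" for m
  proof -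
    have *: "0 < m g" "p ((m(g := m g - 1))(h := Suc ((m(g := m g - 1)) h))) \<noteq> 0"
      using that by (auto simp: gmult_def pd_def split: if_splits)
    then have "total_degree ((m(g := m g - 1))(h := Suc ((m(g := m g - 1)) h))) = d"
      using assms by (auto simp: S_deg_def)
    then show ?thesis using *(1) by (cases g; cases h) (auto simp: total_degree_def)
  qed
  then show ?thesis by (auto simp: S_deg_def gmult_def split: if_splits)
qed

lemma subspace_S_deg: "cfun.subspace (S_deg d)"
  unfolding cfun.subspace_def by (auto simp: S_deg_def pointwise) (metis add_0)+

lemma S_deg_ops:
  assumes "p \<in> S_deg d"
  shows "e_op p \<in> S_deg d" "f_op p \<in> S_deg d" "F12 p \<in> S_deg d" "F21 p \<in> S_deg d"
  using S_deg_gmult_pd[OF assms] subspace_S_deg[of d]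
  by (simp_all add: op_defs cfun.subspace_add cfun.subspace_diff)

lemma S_deg_0_ops:
  assumes "p \<in> S_deg 0"
  shows "F12 p = 0" "F21 p = 0"
proof -
  have "pd g p = 0" for g
  proof
    fix m
    have "total_degree (m(g := Suc (m g))) \<noteq> 0" by (cases g) (auto simp: total_degree_def)
    then show "pd g p m = 0 m" using assms by (auto simp: pd_def S_deg_def pointwise)
  qed
  then show "F12 p = 0" "F21 p = 0" by (simp_all add: op_defs gmult_0)
qed

text \<open>Monomials are joint eigenvectors of \<open>h_op\<close> and \<open>F22\<close>, so a
  weight vector has nonzero coefficients only at monomials of its own weight.\<close>

lemma h_op_diag: "p \<in> S_all \<Longrightarrow> h_op p m = (of_nat (m X1) + of_nat (m Eta1) - of_nat (m X2) - of_nat (m Eta2)) * p m"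
  and F22_diag: "p \<in> S_all \<Longrightarrow> F22 p m = (of_nat (m Eta1 + m Eta2 + m X3) - 1 / 2) * p m"
  by (simp_all add: h_op_def F22_def pointwise gmult_pd_diag algebra_simps)

lemma F11_F22:
  assumes "p \<in> S_deg d"
  shows "F11 p + F22 p = cscale (of_nat d) p"
proof
  fix m
  have "(F11 p + F22 p) m = of_nat (total_degree m) * p m"
    using S_deg_subset_S_all[OF assms] by (simp add: F11_def F22_def pointwise gmult_pd_diag total_degree_def algebra_simps)
  then show "(F11 p + F22 p) m = cscale (of_nat d) p m"
    using assms by (cases "p m = 0") (auto simp: S_deg_def pointwise)
qed

lemma op_linear:
  "e_op (p + q) = e_op p + e_op q" "e_op (cscale c p) = cscale c (e_op p)" "e_op 0 = 0"
  "f_op (p + q) = f_op p + f_op q" "f_op (cscale c p) = cscale c (f_op p)" "f_op 0 = 0"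
  "h_op (p + q) = h_op p + h_op q" "h_op (cscale c p) = cscale c (h_op p)" "h_op 0 = 0"
  "F12 (p + q) = F12 p + F12 q" "F12 (cscale c p) = cscale c (F12 p)" "F12 0 = 0"
  "F21 (p + q) = F21 p + F21 q" "F21 (cscale c p) = cscale c (F21 p)" "F21 0 = 0"
  "F11 (p + q) = F11 p + F11 q" "F11 (cscale c p) = cscale c (F11 p)" "F11 0 = 0"
  "F22 (p + q) = F22 p + F22 q" "F22 (cscale c p) = cscale c (F22 p)" "F22 0 = 0"
  "D12 (p + q) = D12 p + D12 q" "D12 (cscale c p) = cscale c (D12 p)" "D12 0 = 0"
  "D22 (p + q) = D22 p + D22 q" "D22 (cscale c p) = cscale c (D22 p)" "D22 0 = 0"
  by (simp_all add: op_defs pd_add pd_cscale pd_0 gmult_add gmult_cscale gmult_0)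
    (simp_all add: pointwise algebra_simps)

lemma linear_on_ops:
  "linear_on U e_op" "linear_on U f_op" "linear_on U h_op" "linear_on U F12" "linear_on U F21"
  by (simp_all add: linear_on_def op_linear)

lemma linear_on_joint: "linear_on U (\<lambda>p. spo_op X p + gl_op Y p)"
proof -
  have "spo_op X (p + q) = spo_op X p + spo_op X q" "spo_op X (cscale c p) = cscale c (spo_op X p)" for p q c
    unfolding spo_op_def
    by (simp_all add: pd_add pd_cscale gmult_add gmult_cscale cscale_add sum.distrib cfun.scale_sum_right)
      (simp add: cscale_cscale mult.commute)
  moreover have "gl_op Y (p + q) = gl_op Y p + gl_op Y q" "gl_op Y (cscale c p) = cscale c (gl_op Y p)" for p q c
    by (simp_all add: gl_op_def op_linear) (simp_all add: pointwise algebra_simps)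
  ultimately show ?thesis
    by (simp add: linear_on_def cscale_add add_ac)
qed

lemma subspace_S_inv: "cfun.subspace (space (S_inv d))"
  using subspace_S_deg[of d] unfolding cfun.subspace_def S_inv_def by (simp add: op_linear)

lemma S_inv_ops:
  assumes "p \<in> space (S_inv d)"
  shows "e_op p \<in> space (S_inv d)" "f_op p \<in> space (S_inv d)" "h_op p \<in> space (S_inv d)"
    "F12 p \<in> space (S_inv d)" "F21 p \<in> space (S_inv d)"
proof -
  have p: "p \<in> S_deg d" "p \<in> S_all" "D12 p = 0" "D22 p = 0"
    using assms S_deg_subset_S_all by (auto simp: S_inv_def)
  have e: "e_op p \<in> space (S_inv d)" and f: "f_op p \<in> space (S_inv d)"
    if "p \<in> S_deg d" "p \<in> S_all" "D12 p = 0" "D22 p = 0" for p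
    using that S_deg_ops by (simp_all add: S_inv_def D12_e_op D12_f_op D22_e_op D22_f_op op_linear)
  show "e_op p \<in> space (S_inv d)" "f_op p \<in> space (S_inv d)"
    using e f p by auto
  show "F12 p \<in> space (S_inv d)" "F21 p \<in> space (S_inv d)"
    using p S_deg_ops by (simp_all add: S_inv_def D12_F12 D12_F21 D22_F12 D22_F21 op_linear)
  \<comment> \<open>\<open>h_op\<close> is obtained from \<open>e_op\<close> and
    \<open>f_op\<close>, which spares separate commutation rules with \<open>D12\<close> and
    \<open>D22\<close>.\<close>
  have "e_op (f_op p) \<in> space (S_inv d)" "f_op (e_op p) \<in> space (S_inv d)"
    using e[of "f_op p"] f[of p] f[of "e_op p"] e[of p] p by (auto simp: S_inv_def)
  moreover have "h_op p = - e_op (f_op p) - f_op (e_op p)"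
    using e_op_f_op[OF p(2)] by (simp add: pointwise)
  ultimately show "h_op p \<in> space (S_inv d)"
    using subspace_S_inv by (metis cfun.subspace_diff cfun.subspace_neg)
qed

lemma S_inv_in_S_all: "p \<in> space (S_inv d) \<Longrightarrow> p \<in> S_all"
  using S_deg_subset_S_all by (auto simp: S_inv_def)

lemma spo_ops_S_inv: "spo_ops (space (S_inv d)) h_op e_op f_op"
  by unfold_locales
    (auto simp: subspace_S_inv linear_on_ops S_inv_ops e_op_f_op h_op_e_op h_op_f_op dest: S_inv_in_S_all)

lemma h_op_F21: "p \<in> S_all \<Longrightarrow> h_op (F21 p) = F21 (h_op p)"
  by (simp add: op_defs normal_order)

lemma hom_part_gmult:
  "hom_part odd_monomial t p = p \<Longrightarrow> hom_part odd_monomial (odd_gen g \<noteq> t) (gmult g p) = gmult g p"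
  unfolding hom_part_eq_iff by (cases g) (auto simp: gmult_def odd_monomial_def split: if_splits)

lemma hom_part_pd:
  "hom_part odd_monomial t p = p \<Longrightarrow> hom_part odd_monomial (odd_gen g \<noteq> t) (pd g p) = pd g p"
  unfolding hom_part_eq_iff by (cases g) (auto simp: pd_def odd_monomial_def)

lemma hom_part_ops:
  assumes "hom_part odd_monomial t p = p"
  shows "hom_part odd_monomial (\<not> t) (f_op p) = f_op p" "hom_part odd_monomial (\<not> t) (F21 p) = F21 p"
proof -
  have *: "hom_part odd_monomial (\<not> t) (gmult g (pd h p)) = gmult g (pd h p)" if "odd_gen g \<noteq> odd_gen h" for g h
    using hom_part_gmult[OF hom_part_pd[OF assms], of g h] that by (cases t; cases "odd_gen g") auto
  have diff: "hom_part q s (u - v) = hom_part q s u - hom_part q s v" for q :: "'x \<Rightarrow> bool" and s u v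
    by (auto simp: pointwise)
  show "hom_part odd_monomial (\<not> t) (f_op p) = f_op p" "hom_part odd_monomial (\<not> t) (F21 p) = F21 p"
    by (simp_all add: op_defs hom_part_add diff *)
qed

text \<open>The coefficients at \<open>m x\<close> are dual to the \<open>B x\<close> up to nonzero
  scalars. An element minus the combination with the same coordinates has all coordinates 0, so
  \<open>sep\<close> yields spanning without a dimension count.\<close>

lemma basis_on_dual:
  assumes "finite I" "cfun.subspace U" "\<And>x. x \<in> I \<Longrightarrow> B x \<in> U" "\<And>x. x \<notin> I \<Longrightarrow> B x = 0"
    and off: "\<And>x y. x \<in> I \<Longrightarrow> y \<in> I \<Longrightarrow> x \<noteq> y \<Longrightarrow> B x (m y) = 0"
    and diag: "\<And>x. x \<in> I \<Longrightarrow> B x (m x) \<noteq> 0"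
    and sep: "\<And>p. p \<in> U \<Longrightarrow> (\<And>x. x \<in> I \<Longrightarrow> p (m x) = 0) \<Longrightarrow> p = 0"
  shows "basis_on I B U"
  unfolding basis_on_def
proof (intro conjI allI impI ballI)
  have coord: "lc I c B (m y) = c y * B y (m y)" if "y \<in> I" for c y
  proof -
    have "lc I c B (m y) = (\<Sum>x\<in>I. if x = y then c y * B y (m y) else 0)"
      unfolding lc_apply using off that by (intro sum.cong) auto
    then show ?thesis using assms(1) that by simp
  qed
  show "U = range (\<lambda>c. lc I c B)"
  proof
    show "range (\<lambda>c. lc I c B) \<subseteq> U" using assms(2,3) by (auto intro: subspace_lc)
    show "U \<subseteq> range (\<lambda>c. lc I c B)"
    proof
      fix p assume p: "p \<in> U"
      define c where "c x = p (m x) / B x (m x)" for x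
      have "p - lc I c B = 0"
      proof (rule sep)
        show "p - lc I c B \<in> U" using p assms(2,3) by (auto intro: subspace_lc cfun.subspace_diff)
        show "(p - lc I c B) (m x) = 0" if "x \<in> I" for x
          using coord[OF that] diag[OF that] by (simp add: pointwise c_def)
      qed
      then show "p \<in> range (\<lambda>c. lc I c B)" by simp
    qed
  qed
  fix c x assume "lc I c B = 0" "x \<in> I"
  then show "c x = 0" using coord[of x c] diag[of x] by (simp add: pointwise)
qed (use assms in auto)

text \<open>For a space that is the direct sum of \<open>K\<close> and its image under
  \<open>G\<close>; \<open>indep\<close> also contains the injectivity of \<open>G\<close> on
  \<open>K\<close>. It is meant for \<open>G\<close> = \<open>F21\<close> and \<open>K\<close> the
  kernel of \<open>F12\<close>.\<close>

lemma basis_on_double: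
  assumes u: "basis_on I u K" and "K \<subseteq> A" "cfun.subspace A" and G: "linear_on A G" "\<And>p. p \<in> A \<Longrightarrow> G p \<in> A"
    and spans: "\<And>p. p \<in> A \<Longrightarrow> \<exists>k\<in>K. \<exists>k'\<in>K. p = k + G k'"
    and indep: "\<And>k k'. k \<in> K \<Longrightarrow> k' \<in> K \<Longrightarrow> k + G k' = 0 \<Longrightarrow> k = 0 \<and> k' = 0"
  shows "basis_on (I \<times> {..1::nat}) (\<lambda>(x, l). if l = 0 then u x else if l = 1 then G (u x) else 0) A"
    (is "basis_on _ ?B _")
proof -
  have uA: "u x \<in> A" for x using basis_onD(6)[OF u] assms(2) by blast
  have lc: "lc (I \<times> {..1::nat}) c ?B = lc I (\<lambda>x. c (x, 0)) u + G (lc I (\<lambda>x. c (x, 1)) u)" for c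
  proof -
    have "lc (I \<times> {..1::nat}) c ?B = (\<Sum>x\<in>I. \<Sum>l\<le>1. cscale (c (x, l)) (?B (x, l)))"
      unfolding lc_def sum.cartesian_product by (rule sum.cong) auto
    also have "\<dots> = lc I (\<lambda>x. c (x, 0)) u + lc I (\<lambda>x. c (x, 1)) (\<lambda>x. G (u x))"
      by (simp add: lc_def sum.distrib)
    also have "lc I (\<lambda>x. c (x, 1)) (\<lambda>x. G (u x)) = G (lc I (\<lambda>x. c (x, 1)) u)"
      using linear_on_lc[OF G(1) assms(3), of I u "\<lambda>x. c (x, 1)"] uA by simp
    finally show ?thesis .
  qed
  show ?thesis
    unfolding basis_on_def
  proof (intro conjI allI impI ballI)
    show "finite (I \<times> {..1::nat})" using basis_onD(1)[OF u] by simp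
    show "?B x = 0" if "x \<notin> I \<times> {..1::nat}" for x
      using that basis_onD(2)[OF u] linear_on_0[OF G(1) assms(3)] by (cases x) auto
    show "A = range (\<lambda>c. lc (I \<times> {..1::nat}) c ?B)"
    proof
      show "A \<subseteq> range (\<lambda>c. lc (I \<times> {..1::nat}) c ?B)"
      proof
        fix p assume "p \<in> A"
        then obtain c c' where p: "p = lc I c u + G (lc I c' u)"
          using spans basis_onD(4)[OF u] by metis
        define r where "r = (\<lambda>(x, l :: nat). if l = 0 then c x else c' x)"
        have "p = lc (I \<times> {..1::nat}) r ?B" unfolding lc p by (simp add: r_def)
        then show "p \<in> range (\<lambda>c. lc (I \<times> {..1::nat}) c ?B)" by blast
      qed
      have "lc I c u \<in> A" for c using uA assms(3) by (intro subspace_lc) auto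
      then show "range (\<lambda>c. lc (I \<times> {..1::nat}) c ?B) \<subseteq> A"
        unfolding lc using assms(3) G(2) by (auto intro: cfun.subspace_add)
    qed
    fix c x assume "lc (I \<times> {..1::nat}) c ?B = 0" and x: "x \<in> I \<times> {..1::nat}"
    then have "lc I (\<lambda>x. c (x, 0)) u = 0" "lc I (\<lambda>x. c (x, 1)) u = 0"
      unfolding lc using indep basis_onD(3)[OF u] by blast+
    then have "\<forall>x\<in>I. c (x, 0) = 0" "\<forall>x\<in>I. c (x, 1) = 0"
      using u unfolding basis_on_def by blast+
    then show "c x = 0" using x by (auto simp: le_Suc_eq)
  qed
qed

text \<open>The coefficient at the monomial \<open>mo j k\<close> is the coordinate detecting \<open>f\<^sup>k (q j)\<close>.\<close>

theorem S_inv_std_basis: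
  fixes ps :: "params list" and q :: "nat \<Rightarrow> (gen \<Rightarrow> nat) \<Rightarrow> complex" and mo :: "nat \<Rightarrow> nat \<Rightarrow> gen \<Rightarrow> nat"
  assumes q: "\<And>j a b c s. j < length ps \<Longrightarrow> ps ! j = (a, b, c, s) \<Longrightarrow>
      q j \<in> space (S_inv d) \<and> q j \<noteq> 0 \<and> F12 (q j) = 0 \<and> e_op (q j) = 0 \<and>
      h_op (q j) = cscale (of_nat a) (q j) \<and> F22 (q j) = cscale c (q j) \<and>
      hom_part odd_monomial s (q j) = q j \<and> b + c = of_nat d"
    and mo: "\<And>j a b c s k. j < length ps \<Longrightarrow> ps ! j = (a, b, c, s) \<Longrightarrow> k \<le> 2 * a \<Longrightarrow>
      of_nat (mo j k X1) + of_nat (mo j k Eta1) - of_nat (mo j k X2) - of_nat (mo j k Eta2) = of_nat a - (of_nat k :: complex) \<and>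
      of_nat (mo j k Eta1 + mo j k Eta2 + mo j k X3) - 1 / 2 = c"
    and inj: "distinct (map (\<lambda>(a, b, c, s). c) ps)"
    and sep: "\<And>p. p \<in> space (S_inv d) \<Longrightarrow> F12 p = 0 \<Longrightarrow>
      (\<And>j k. j < length ps \<Longrightarrow> k \<le> 2 * fst (ps ! j) \<Longrightarrow> p (mo j k) = 0) \<Longrightarrow> p = 0"
  shows "\<exists>B. std_basis (S_inv d) ps B"
proof -
  let ?A = "space (S_inv d)"
  interpret spo_ops ?A h_op e_op f_op by (rule spo_ops_S_inv)
  define K where "K = {p \<in> ?A. F12 p = 0}"
  define I where "I = {(j, k). j < length ps \<and> k \<le> 2 * fst (ps ! j)}"
  define V where "V j k l = (f_op ^^ k) ((F21 ^^ l) (q j))" for j k l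
  define B where "B = (\<lambda>(j, k, l). if (j, k, l) \<in> idx ps then V j k l else 0)"
  note A_all [simp] = S_inv_in_S_all[where d = d]
  have d_unique: "F11 p + F22 p = cscale (of_nat d) p" if "p \<in> ?A" for p
    using F11_F22 that by (simp add: S_inv_def)
  \<comment> \<open>Since b + c = d in every summand, the length of the gl(1|1)-factor depends on d
    alone.\<close>
  have len: "gl_len b c = (if d = 0 then 0 else 1)" if "j < length ps" "ps ! j = (a, b, c, s)" for j a b c s
    using q[OF that] by (auto simp: gl_len_def)
  have F21_0: "F21 p = 0" and F12_0: "F12 p = 0" if "p \<in> ?A" "d = 0" for p
    using that S_deg_0_ops by (auto simp: S_inv_def)
  have VA: "V j k l \<in> ?A" and V_F21: "V j k (Suc l) = cscale ((-1) ^ k) (F21 (V j k l))"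
    and V_F22: "F22 (V j k l) = cscale (c + of_nat l) (V j k l)"
    and V_F12: "F12 (V j k l) = cscale ((-1) ^ k * (if l = 1 then b + c else 0)) (V j k (l - 1))"
    and V_par: "hom_part odd_monomial (odd (k + l) \<noteq> s) (V j k l) = V j k l"
    and V_sing: "e_op (V j 0 l) = 0" "h_op (V j 0 l) = cscale (of_nat a) (V j 0 l)"
    and V_2: "V j k (Suc (Suc l)) = 0"
    if j: "j < length ps" "ps ! j = (a, b, c, s)" for j k l a b c s
  proof -
    have V0: "V j 0 (Suc l) = F21 (V j 0 l)" and VS: "V j (Suc k) l = f_op (V j k l)" for k l
      by (simp_all add: V_def)
    have A0: "V j 0 l \<in> ?A" for l
      by (induction l) (use q[OF j] in \<open>auto simp: V_def S_inv_ops\<close>)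
    show A: "V j k l \<in> ?A" for k l
      by (induction k) (auto simp: A0 VS S_inv_ops)
    show V21: "V j k (Suc l) = cscale ((-1) ^ k) (F21 (V j k l))" for k l
      by (induction k) (simp_all add: V0 VS op_linear F21_f_op[OF A_all[OF A]] cscale_cscale)
    have F220: "F22 (V j 0 l) = cscale (c + of_nat l) (V j 0 l)" for l
    proof (induction l)
      case (Suc l)
      then show ?case
        by (simp add: V0 F22_F21[OF A_all[OF A]] op_linear) (simp add: pointwise algebra_simps)
    qed (use q[OF j] in \<open>simp add: V_def\<close>)
    show "F22 (V j k l) = cscale (c + of_nat l) (V j k l)" for k l
      by (induction k) (simp_all add: F220 VS F22_f_op[OF A_all[OF A]] op_linear)
    show V2: "V j k (Suc (Suc l)) = 0" for k l
      by (simp add: V21 op_linear F21_F21[OF A_all[OF A]])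
    have F120: "F12 (V j 0 l) = cscale (if l = 1 then b + c else 0) (V j 0 (l - 1))" for l
    proof -
      consider "l = 0" | "l = 1" | l' where "l = Suc (Suc l')" by (metis One_nat_def not0_implies_Suc)
      then show ?thesis
      proof cases
        case 1
        then show ?thesis using q[OF j] by (simp add: V_def)
      next
        case 2
        have "F12 (F21 (q j)) = cscale (of_nat d) (q j)"
          using q[OF j] F12_F21[of "q j"] d_unique[of "q j"] by (simp add: op_linear)
        then show ?thesis using q[OF j] 2 by (simp add: V_def)
      next
        case 3
        then show ?thesis using V2[of 0 l'] by (simp add: op_linear)
      qed
    qed
    show "F12 (V j k l) = cscale ((-1) ^ k * (if l = 1 then b + c else 0)) (V j k (l - 1))" for k l
    proof (induction k)
      case (Suc k)
      then show ?case
        by (simp add: VS F12_f_op[OF A_all[OF A]] op_linear)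
    qed (use F120 in simp)
    have par0: "hom_part odd_monomial (odd l \<noteq> s) (V j 0 l) = V j 0 l" for l
    proof (induction l)
      case (Suc l)
      have "(\<not> (odd l \<noteq> s)) = (odd (Suc l) \<noteq> s)" by auto
      then show ?case using hom_part_ops(2)[OF Suc] by (simp only: V0)
    qed (use q[OF j] in \<open>simp add: V_def\<close>)
    show "hom_part odd_monomial (odd (k + l) \<noteq> s) (V j k l) = V j k l" for k l
    proof (induction k)
      case (Suc k)
      have "(\<not> (odd (k + l) \<noteq> s)) = (odd (Suc k + l) \<noteq> s)" by auto
      then show ?case using hom_part_ops(1)[OF Suc] by (simp only: VS)
    qed (use par0 in simp)
    show "e_op (V j 0 l) = 0" for l
    proof (induction l)
      case (Suc l)
      have "F21 (e_op (V j 0 l)) = - e_op (F21 (V j 0 l))" by (rule F21_e_op[OF A_all[OF A]])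
      then show ?case using Suc by (simp add: V0 op_linear)
    qed (use q[OF j] in \<open>simp add: V_def\<close>)
    show "h_op (V j 0 l) = cscale (of_nat a) (V j 0 l)" for l
    proof (induction l)
      case (Suc l)
      then show ?case by (simp add: V0 h_op_F21[OF A_all[OF A]] op_linear)
    qed (use q[OF j] in \<open>simp add: V_def\<close>)
  qed
  have V_funpow: "V j k l = (f_op ^^ k) (V j 0 l)" for j k l by (simp add: V_def)
  have V_h: "h_op (V j k l) = cscale (of_nat a - of_nat k) (V j k l)"
    if j: "j < length ps" "ps ! j = (a, b, c, s)" for j k l a b c s
    using H_u[OF VA[OF j, of 0 l] V_sing[OF j, of l]] by (simp add: V_funpow[of j k l])
  have VK: "V j k 0 \<in> K" if j: "j < length ps" for j k
    using VA[OF j, of _ _ _ _ k 0] V_F12[OF j, of _ _ _ _ k 0] by (cases "ps ! j") (auto simp: K_def)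
  \<comment> \<open>If the coefficient were nonzero, the eigenvalues of \<open>F22\<close> would
    agree, hence j = j' as the values c are distinct, and then those of \<open>h_op\<close> would
    give k = k'.\<close>
  have V_coord: "V j k 0 (mo j' k') = 0"
    if j: "j < length ps" and jk': "(j', k') \<in> I" and neq: "(j, k) \<noteq> (j', k')" for j k j' k'
  proof (rule ccontr)
    assume nz: "V j k 0 (mo j' k') \<noteq> 0"
    obtain a b c s where p: "ps ! j = (a, b, c, s)" by (cases "ps ! j")
    obtain a' b' c' s' where p': "ps ! j' = (a', b', c', s')" by (cases "ps ! j'")
    have j': "j' < length ps" "k' \<le> 2 * a'" using jk' p' by (auto simp: I_def)
    note m = mo[OF j'(1) p' j'(2)]
    have in_S: "V j k 0 \<in> S_all" by (rule A_all[OF VA[OF j p]])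
    have "c' * V j k 0 (mo j' k') = c * V j k 0 (mo j' k')"
      using F22_diag[OF in_S, of "mo j' k'"] V_F22[OF j p, of k 0] m by (auto simp: pointwise)
    then have "c = c'" using nz by simp
    then have "j = j'"
      using nth_eq_iff_index_eq[OF inj, of j j'] j j'(1) p p' by simp
    moreover have "(of_nat a' - of_nat k') * V j k 0 (mo j' k') = (of_nat a - of_nat k) * V j k 0 (mo j' k')"
      using h_op_diag[OF in_S, of "mo j' k'"] V_h[OF j p, of k 0] m by (auto simp: pointwise)
    ultimately have "k = k'" using nz p p' by simp
    then show False using neq \<open>j = j'\<close> by simp
  qed
  have K_sep: "p = 0" if "p \<in> K" "\<And>x. x \<in> I \<Longrightarrow> p (case x of (j, k) \<Rightarrow> mo j k) = 0" for p
  proof (rule sep)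
    show "p \<in> ?A" "F12 p = 0" using that(1) by (simp_all add: K_def)
    show "p (mo j k) = 0" if "j < length ps" "k \<le> 2 * fst (ps ! j)" for j k
      using that \<open>\<And>x. x \<in> I \<Longrightarrow> p (case x of (j, k) \<Rightarrow> mo j k) = 0\<close>[of "(j, k)"] by (simp add: I_def)
  qed
  \<comment> \<open>For k > 2a the index belongs to none of the selected monomials, so all
    coordinates of the vector are 0 and separation makes it vanish.\<close>
  have V_out: "V j k 0 = 0" if j: "j < length ps" and k: "k > 2 * fst (ps ! j)" for j k
  proof (rule K_sep[OF VK[OF j]])
    fix x assume x: "x \<in> I"
    then have "(j, k) \<noteq> x" using k by (auto simp: I_def)
    then show "V j k 0 (case x of (j, k) \<Rightarrow> mo j k) = 0"
      using V_coord[OF j, of "fst x" "snd x" k] x by (simp add: case_prod_beta)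
  qed
  have fI: "finite I"
    by (rule finite_subset[of _ "(\<Union>j<length ps. {j} \<times> {..2 * fst (ps ! j)})"]) (auto simp: I_def)
  have sub_K: "cfun.subspace K"
    using subspace unfolding K_def cfun.subspace_def by (auto simp: op_linear)
  have basis_K: "basis_on I (\<lambda>x. if x \<in> I then V (fst x) (snd x) 0 else 0) K"
  proof (rule basis_on_dual[OF fI sub_K, where m = "\<lambda>(j, k). mo j k"])
    fix x assume x: "x \<in> I"
    then obtain j k where jk: "x = (j, k)" "j < length ps" "k \<le> 2 * fst (ps ! j)" by (auto simp: I_def)
    obtain a b c s where p: "ps ! j = (a, b, c, s)" by (cases "ps ! j")
    show "(if x \<in> I then V (fst x) (snd x) 0 else 0) (case x of (j, k) \<Rightarrow> mo j k) \<noteq> 0"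
    proof
      assume "(if x \<in> I then V (fst x) (snd x) 0 else 0) (case x of (j, k) \<Rightarrow> mo j k) = 0"
      \<comment> \<open>With its own coordinate zero as well, the vector would vanish by separation,
        against \<open>u_nonzero\<close>.\<close>
      then have "V j k 0 (mo j k) = 0" using x jk by simp
      then have "V j k 0 (case y of (j, k) \<Rightarrow> mo j k) = 0" if "y \<in> I" for y
        using V_coord[OF jk(2), of "fst y" "snd y" k] that by (cases "y = (j, k)"; cases y) auto
      then have "V j k 0 = 0" by (rule K_sep[OF VK[OF jk(2)]])
      moreover have "V j k 0 \<noteq> 0"
        using u_nonzero[OF VA[OF jk(2) p, of 0 0] V_sing[OF jk(2) p, of 0] refl, of k] q[OF jk(2) p] jk(3) p
        by (simp add: V_def)
      ultimately show False by simp
    qed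
  next
    fix x show "(if x \<in> I then V (fst x) (snd x) 0 else 0) \<in> K" if "x \<in> I"
      using that VK[of "fst x" "snd x"] by (auto simp: I_def)
    fix y assume "x \<in> I" "y \<in> I" "x \<noteq> y"
    then show "(if x \<in> I then V (fst x) (snd x) 0 else 0) (case y of (j, k) \<Rightarrow> mo j k) = 0"
      using V_coord[of "fst x" "fst y" "snd y" "snd x"] by (auto simp: I_def case_prod_beta)
  qed (use K_sep in auto)
  have basis: "basis_on (idx ps) B ?A"
  \<comment> \<open>In degree 0 both \<open>F12\<close> and \<open>F21\<close> are zero and
    \<open>K\<close> is the whole space; for d > 0 the space is the double of
    \<open>K\<close>.\<close>
  proof (cases "d = 0")
    case True
    then have KA: "K = ?A" using F12_0 by (auto simp: K_def)
    have idx: "(j, k, l) \<in> idx ps \<longleftrightarrow> (j, k) \<in> I \<and> l = 0" for j k l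
      using len[of j] True by (cases "ps ! j") (auto simp: idx_def I_def)
    show ?thesis
    proof (rule basis_on_reindex_scale[OF basis_K[unfolded KA], where h = "\<lambda>(j, k, l). (j, k)" and r = "\<lambda>_. 1"])
      show "bij_betw (\<lambda>(j, k, l). (j, k)) (idx ps) I"
        by (rule bij_betw_byWitness[where f' = "\<lambda>(j, k). (j, k, 0)"]) (auto simp: idx)
    qed (auto simp: B_def idx)
  next
    case False
    have idx: "(j, k, l) \<in> idx ps \<longleftrightarrow> (j, k) \<in> I \<and> l \<le> 1" for j k l
      using len[of j] False by (cases "ps ! j") (auto simp: idx_def I_def)
    have dF: "F12 (F21 p) = cscale (of_nat d) p - F21 (F12 p)" if "p \<in> ?A" for p
      using F12_F21[OF A_all[OF that]] d_unique[OF that] by simp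
    have "basis_on (I \<times> {..1::nat}) (\<lambda>(x, l). if l = 0 then (if x \<in> I then V (fst x) (snd x) 0 else 0)
        else if l = 1 then F21 (if x \<in> I then V (fst x) (snd x) 0 else 0) else 0) ?A"
    proof (rule basis_on_double[OF basis_K _ subspace linear_on_ops(5) S_inv_ops(5)])
      fix p assume p: "p \<in> ?A"
      \<comment> \<open>Dividing F12 F21 + F21 F12 = d by d gives the decomposition; both
        \<open>?k\<close> and \<open>?k'\<close> lie in \<open>K\<close> because \<open>F12\<close>
        squares to 0.\<close>
      let ?k = "cscale (1 / of_nat d) (F12 (F21 p))" and ?k' = "cscale (1 / of_nat d) (F12 p)"
      have "?k \<in> K" "?k' \<in> K"
        using p subspace by (simp_all add: K_def S_inv_ops cfun.subspace_scale op_linear F12_F12)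
      moreover have "p = ?k + F21 ?k'"
        using dF[OF p] False by (simp add: op_linear pointwise field_simps)
      ultimately show "\<exists>k\<in>K. \<exists>k'\<in>K. p = k + F21 k'" by blast
    next
      fix k k' assume k: "k \<in> K" "k' \<in> K" "k + F21 k' = 0"
      then have "F12 (F21 k') = cscale (of_nat d) k'"
        using dF[of k'] by (auto simp: K_def op_linear)
      moreover have "F12 (k + F21 k') = F12 (F21 k')" using k(1) by (simp add: op_linear K_def)
      ultimately have "k' = 0" using k(3) False by (simp add: op_linear cscale_eq_0_iff)
      then show "k = 0 \<and> k' = 0" using k(3) by (simp add: op_linear)
    qed (auto simp: K_def)
    then show ?thesis
    \<comment> \<open>The sign (-1)^k arises because \<open>V j k 1\<close> is f^k F21 q, whereas
      the doubled basis contains F21 f^k q.\<close>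
    proof (rule basis_on_reindex_scale[where h = "\<lambda>(j, k, l). ((j, k), l)" and r = "\<lambda>(j, k, l). if l = 1 then (-1) ^ k else 1"])
      show "bij_betw (\<lambda>(j, k, l). ((j, k), l)) (idx ps) (I \<times> {..1::nat})"
        by (rule bij_betw_byWitness[where f' = "\<lambda>((j, k), l). (j, k, l)"]) (auto simp: idx)
      fix x assume x: "x \<in> idx ps"
      obtain j k l where jkl: "x = (j, k, l)" by (cases x)
      have j: "j < length ps" using x jkl by (auto simp: idx I_def)
      obtain a b c s where p: "ps ! j = (a, b, c, s)" by (cases "ps ! j")
      show "B x = cscale ((\<lambda>(j, k, l). if l = 1 then (-1) ^ k else 1) x)
          (case (\<lambda>(j, k, l). ((j, k), l)) x of (x, l) \<Rightarrow> if l = 0 then (if x \<in> I then V (fst x) (snd x) 0 else 0)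
            else if l = 1 then F21 (if x \<in> I then V (fst x) (snd x) 0 else 0) else 0)"
        using x V_F21[OF j p, of k 0] by (auto simp: jkl B_def idx le_Suc_eq)
    qed (auto simp: B_def split: if_splits)
  qed
  \<comment> \<open>\<open>B\<close> was truncated to the index set. That the vectors themselves
    vanish outside it allows the action formula to be read with neighbouring indices out of
    range.\<close>
  have B_eq: "B (j, k, l) = V j k l" if j: "j < length ps" for j k l
  proof (cases "(j, k, l) \<in> idx ps")
    case False
    obtain a b c s where p: "ps ! j = (a, b, c, s)" by (cases "ps ! j")
    have "V j k l = 0"
    proof (cases "k \<le> 2 * a")
      case True
      then have "l > gl_len b c" using False j p by (auto simp: idx_def)
      then obtain l' where l: "l = Suc l'" "d \<noteq> 0 \<longrightarrow> 0 < l'" using len[OF j p] by (cases l) (auto split: if_splits)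
      show ?thesis
      proof (cases "d = 0")
        case True
        then show ?thesis using l V_F21[OF j p, of k l'] F21_0[OF VA[OF j p]] by simp
      next
        case False
        then obtain l'' where "l' = Suc l''" using l by (cases l') auto
        then show ?thesis using V_2[OF j p] l by simp
      qed
    next
      case False
      then have "V j k 0 = 0" using V_out[OF j, of k] p by simp
      then show ?thesis
        by (induction l) (simp_all add: V_F21[OF j p] op_linear)
    qed
    then show ?thesis using False by (simp add: B_def)
  qed (simp add: B_def)
  have act: "act (S_inv d) (X, Y) (B x) = std_act ps X Y B x" if X: "X \<in> spo21" and x: "x \<in> idx ps" for X Y x
  proof -
    obtain j k l where jkl: "x = (j, k, l)" by (cases x)
    have j: "j < length ps" using x jkl by (auto simp: idx_def)
    obtain a b c s where p: "ps ! j = (a, b, c, s)" by (cases "ps ! j")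
    have in_S: "V j k l \<in> S_all" by (rule A_all[OF VA[OF j p]])
    have "F11 (V j k l) = cscale (of_nat d) (V j k l) - F22 (V j k l)"
      using d_unique[OF VA[OF j p, of k l]] by (simp add: algebra_simps)
    also have "of_nat d = b + c" using q[OF j p] by simp
    finally have F11: "F11 (V j k l) = cscale (b - of_nat l) (V j k l)"
      unfolding V_F22[OF j p] by (simp add: pointwise algebra_simps)
    have F21: "F21 (V j k l) = cscale ((-1) ^ k) (V j k (l + 1))"
      using V_F21[OF j p, of k l] by (simp add: cscale_cscale power_add[symmetric])
    have "act (S_inv d) (X, Y) (B x) = spo_act X (V j k l) + gl_op Y (V j k l)"
      using spo_op_eq[OF in_S X] by (simp add: S_inv_def jkl B_eq[OF j] spo_act_def)
    also have "spo_act X (V j k l) = cscale (X $ 1 $ 1 * (of_nat a - of_nat k)) (V j k l)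
      + cscale (X $ 1 $ 2 * e_coeff (of_nat a) k * e_coeff (of_nat a) (k - 1)) (V j (k - 2) l)
      - cscale (X $ 2 $ 1) (V j (k + 2) l) + cscale (X $ 1 $ 3 * e_coeff (of_nat a) k) (V j (k - 1) l)
      + cscale (X $ 2 $ 3) (V j (k + 1) l)"
      using spo_act_u[OF VA[OF j p, of 0 l] V_sing[OF j p, of l], of X k] unfolding V_funpow[symmetric] .
    also have "gl_op Y (V j k l) = cscale (Y $ 1 $ 1 * (b - of_nat l) + Y $ 2 $ 2 * (c + of_nat l)) (V j k l)
      + cscale ((-1) ^ k * Y $ 2 $ 1) (V j k (l + 1))
      + cscale ((-1) ^ k * Y $ 1 $ 2 * (if l = 1 then b + c else 0)) (V j k (l - 1))"
      unfolding gl_op_def F11 F21 V_F22[OF j p] V_F12[OF j p] by (simp add: pointwise algebra_simps)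
    finally show ?thesis
      by (simp add: jkl std_act_def p B_eq[OF j] add.assoc)
  qed
  have "hom_part (odd_idx (S_inv d)) (std_par ps x) (B x) = B x" if x: "x \<in> idx ps" for x
  proof -
    obtain j k l where jkl: "x = (j, k, l)" "j < length ps" using x by (cases x) (auto simp: idx_def)
    obtain a b c s where p: "ps ! j = (a, b, c, s)" by (cases "ps ! j")
    show ?thesis
      using V_par[OF jkl(2) p, of k l] by (simp add: jkl(1) B_eq[OF jkl(2)] S_inv_def std_par_def p)
  qed
  moreover have "linear_on ?A (act (S_inv d) (X, Y))" for X Y
    using linear_on_joint[of ?A X Y] by (simp add: S_inv_def)
  ultimately show ?thesis
    using basis act unfolding std_basis_def by blast
qed

section \<open>Joint highest weight vectors\<close>

text \<open>The highest weight vectors are built as products applied to 1, so that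
  \<open>normal_order\<close> and the vanishing of all derivatives of 1 can evaluate the operators
  on them.\<close>

definition one_poly :: "(gen \<Rightarrow> nat) \<Rightarrow> complex" where
  "one_poly m = (if m = mon 0 0 0 0 0 0 then 1 else 0)"

lemma one_poly_S_all [simp]: "one_poly \<in> S_all"
  by (auto simp: S_all_def one_poly_def)

lemma pd_one [simp]: "pd g one_poly = 0"
proof
  fix m
  have "m(g := Suc (m g)) \<noteq> mon 0 0 0 0 0 0" by (cases g) (auto simp: fun_eq_iff mon_def split: gen.splits)
  then have "one_poly (m(g := Suc (m g))) = 0" by (simp add: one_poly_def)
  then show "pd g one_poly m = 0 m" by (simp add: pd_def zero_fun_apply)
qed

abbreviation x1_pow :: "nat \<Rightarrow> ((gen \<Rightarrow> nat) \<Rightarrow> complex) \<Rightarrow> (gen \<Rightarrow> nat) \<Rightarrow> complex" where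
  "x1_pow n \<equiv> gmult X1 ^^ n"

lemma x1_pow_S_all [simp]: "p \<in> S_all \<Longrightarrow> x1_pow n p \<in> S_all"
  by (induction n) auto

lemma x1_pow_cscale: "x1_pow n (cscale c p) = cscale c (x1_pow n p)" and x1_pow_0: "x1_pow n 0 = 0"
  and x1_pow_minus: "x1_pow n (- p) = - x1_pow n p"
  by (induction n) (auto simp: gmult_cscale gmult_0 gmult_minus)

lemma gmult_x1_pow: "g \<noteq> X1 \<Longrightarrow> gmult g (x1_pow n p) = x1_pow n (gmult g p)"
proof (induction n)
  case (Suc n)
  then show ?case using gmult_gmult[of g X1 "x1_pow n p"] by (simp add: sgn_gen_def)
qed simp

lemma pd_x1_pow: "g \<noteq> X1 \<Longrightarrow> p \<in> S_all \<Longrightarrow> pd g (x1_pow n p) = x1_pow n (pd g p)"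
proof (induction n)
  case (Suc n)
  then show ?case using pd_gmult[of "x1_pow n p" g X1] by (simp add: sgn_gen_def)
qed simp

lemma pd_X1_x1_pow:
  assumes "p \<in> S_all" "pd X1 p = 0"
  shows "pd X1 (x1_pow n p) = cscale (of_nat n) (x1_pow (n - 1) p)"
proof (induction n)
  case (Suc n)
  have "gmult X1 (x1_pow (n - 1) p) = x1_pow n p" if "n \<noteq> 0" using that by (cases n) auto
  then have "pd X1 (x1_pow (Suc n) p) = x1_pow n p + cscale (of_nat n) (x1_pow n p)"
    using pd_gmult[OF x1_pow_S_all[OF assms(1)], of X1 X1 n] Suc
    by (cases "n = 0") (simp_all add: sgn_gen_def gmult_cscale gmult_0)
  then show ?case by (simp add: pointwise algebra_simps)
qed (simp add: assms)

lemma gmult_X1_x1_pow: "gmult X1 (x1_pow n p) = x1_pow (Suc n) p"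
  by simp

lemma x1_pow_apply:
  assumes "p \<in> S_all"
  shows "x1_pow n p (mon i j k r s t) = (if n \<le> i then p (mon (i - n) j k r s t) else 0)"
proof (induction n arbitrary: i)
  case (Suc n)
  then show ?case
    using S_all_zero[OF assms, of "mon (i - Suc n) j k r s t"] by (auto simp: gmult_def)
qed simp

lemma S_deg_gmult: "p \<in> S_deg d \<Longrightarrow> gmult g p \<in> S_deg (Suc d)"
proof -
  assume p: "p \<in> S_deg d"
  have "total_degree m = Suc d" if "gmult g p m \<noteq> 0" for m
  proof -
    have "0 < m g" "p (m(g := m g - 1)) \<noteq> 0" using that by (auto simp: gmult_def split: if_splits)
    then show ?thesis using p by (cases g) (auto simp: S_deg_def total_degree_def)
  qed
  then show ?thesis by (auto simp: S_deg_def gmult_def split: if_splits)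
qed

lemma S_deg_one: "one_poly \<in> S_deg 0"
  by (auto simp: S_deg_def one_poly_def total_degree_def)

lemma S_deg_x1_pow: "p \<in> S_deg d \<Longrightarrow> x1_pow n p \<in> S_deg (d + n)"
  by (induction n) (auto intro: S_deg_gmult)

definition hw1 :: "nat \<Rightarrow> (gen \<Rightarrow> nat) \<Rightarrow> complex" where
  "hw1 d = x1_pow d one_poly"

text \<open>F12 sends x1^(d-1) x3 to x1^(d-1) eta3, and the second term is the correction that
  cancels this. The correction has degree at least 2, hence this summand starts at d = 2.\<close>

definition hw2 :: "nat \<Rightarrow> (gen \<Rightarrow> nat) \<Rightarrow> complex" where
  "hw2 d = x1_pow (d - 1) (gmult X3 one_poly) + x1_pow (d - 2) (gmult Eta1 (gmult Eta3 one_poly))"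

text \<open>These are all four monomials of degree 3 with weight (0) and
  \<open>F22\<close>-eigenvalue 3/2. Under \<open>D22\<close> the first term cancels the last, under
  \<open>D12\<close> it cancels the two middle ones.\<close>

definition hw3 :: "(gen \<Rightarrow> nat) \<Rightarrow> complex" where
  "hw3 = gmult X3 (gmult X3 (gmult Eta3 one_poly)) + gmult X2 (gmult X3 (gmult Eta1 one_poly))
    - gmult X1 (gmult X3 (gmult Eta2 one_poly)) + gmult Eta1 (gmult Eta2 (gmult Eta3 one_poly))"

lemma hom_part_one: "hom_part odd_monomial False one_poly = one_poly"
  unfolding hom_part_eq_iff by (auto simp: one_poly_def odd_monomial_def)

lemma hom_part_x1_pow: "hom_part odd_monomial t p = p \<Longrightarrow> hom_part odd_monomial t (x1_pow n p) = x1_pow n p"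
proof (induction n)
  case (Suc n)
  then show ?case using hom_part_gmult[of t "x1_pow n p" X1] by simp
qed simp

lemma hom_part_gmultI:
  "hom_part odd_monomial (odd_gen g \<noteq> t) p = p \<Longrightarrow> hom_part odd_monomial t (gmult g p) = gmult g p"
  using hom_part_gmult[of "odd_gen g \<noteq> t" p g] by (cases "odd_gen g"; cases t) auto

lemma hom_part_diff: "hom_part q s (u - v) = hom_part q s u - hom_part q s v"
  by (auto simp: pointwise)

text \<open>The eigenvalue b of \<open>F11\<close> is encoded by b + c = d, as F11 + F22 acts by the
  degree.\<close>

definition is_joint_hw :: "nat \<Rightarrow> params \<Rightarrow> ((gen \<Rightarrow> nat) \<Rightarrow> complex) \<Rightarrow> bool" where
  "is_joint_hw d = (\<lambda>(a, b, c, s) p. p \<in> space (S_inv d) \<and> p \<noteq> 0 \<and> F12 p = 0 \<and> e_op p = 0 \<and>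
      h_op p = cscale (of_nat a) p \<and> F22 p = cscale c p \<and> hom_part odd_monomial s p = p \<and> b + c = of_nat d)"

lemmas x1_pow_simps = pd_x1_pow pd_X1_x1_pow gmult_x1_pow gmult_X1_x1_pow x1_pow_cscale x1_pow_0 x1_pow_minus

lemma hw1_is_joint_hw: "is_joint_hw d (d, of_nat d + 1 / 2, - 1 / 2, False) (hw1 d)"
proof -
  have "hw1 d (mon d 0 0 0 0 0) \<noteq> 0" by (simp add: hw1_def x1_pow_apply one_poly_def)
  then have "hw1 d \<noteq> 0" by (auto simp: pointwise)
  moreover have "hw1 d \<in> S_deg d" using S_deg_x1_pow[OF S_deg_one, of d] by (simp add: hw1_def)
  moreover have "D12 (hw1 d) = 0" "D22 (hw1 d) = 0" "F12 (hw1 d) = 0" "e_op (hw1 d) = 0"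
    by (simp_all add: hw1_def op_defs x1_pow_simps gmult_0 pd_0 pd_cscale del: funpow.simps)
  moreover have "h_op (hw1 d) = cscale (of_nat d) (hw1 d)" "F22 (hw1 d) = cscale (- 1 / 2) (hw1 d)"
    by (cases d; simp add: hw1_def op_defs x1_pow_simps gmult_0 pd_0 gmult_cscale del: funpow.simps)+
  moreover have "hom_part odd_monomial False (hw1 d) = hw1 d"
    unfolding hw1_def by (intro hom_part_x1_pow hom_part_one)
  ultimately show ?thesis by (simp add: is_joint_hw_def S_inv_def)
qed

lemma hw2_is_joint_hw:
  assumes "d \<ge> 2"
  shows "is_joint_hw d (d - 1, of_nat d - 1 / 2, 1 / 2, False) (hw2 d)"
proof -
  obtain n where d: "d = Suc (Suc n)" using assms by (metis Suc_le_D numeral_2_eq_2 Suc_le_mono)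
  have hw2: "hw2 d = x1_pow (Suc n) (gmult X3 one_poly) + x1_pow n (gmult Eta1 (gmult Eta3 one_poly))"
    by (simp add: hw2_def d)
  have "hw2 d (mon (Suc n) 0 1 0 0 0) \<noteq> 0"
    unfolding hw2 plus_fun_apply
    by (simp only: x1_pow_apply S_all_gmult) (simp add: one_poly_def gmult_def)
  then have "hw2 d \<noteq> 0" by (auto simp: pointwise)
  moreover have "hw2 d \<in> S_deg d"
    using S_deg_x1_pow[OF S_deg_gmult[OF S_deg_one], of "Suc n" X3]
      S_deg_x1_pow[OF S_deg_gmult[OF S_deg_gmult[OF S_deg_one]], of n Eta1 Eta3] subspace_S_deg[of d]
    unfolding hw2 by (simp add: d cfun.subspace_add del: funpow.simps)
  moreover have "D12 (hw2 d) = 0" "D22 (hw2 d) = 0" "F12 (hw2 d) = 0" "e_op (hw2 d) = 0"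
    unfolding hw2
    by (simp_all add: op_defs x1_pow_simps normal_order del: funpow.simps)
  moreover have "h_op (hw2 d) = cscale (of_nat (d - 1)) (hw2 d)" "F22 (hw2 d) = cscale (1 / 2) (hw2 d)"
    unfolding hw2
    by (cases n; simp add: op_defs x1_pow_simps normal_order d del: funpow.simps; simp add: pointwise algebra_simps)+
  moreover have "hom_part odd_monomial False (hw2 d) = hw2 d"
    unfolding hw2 hom_part_add
    by (intro arg_cong2[of _ _ _ _ "(+)"] hom_part_x1_pow hom_part_gmultI) (simp_all add: hom_part_one)
  ultimately show ?thesis by (simp add: is_joint_hw_def S_inv_def)
qed

lemma two_mult_fun: "2 * p = cscale 2 (p :: 'i \<Rightarrow> complex)"
  unfolding mult_2 by (simp add: pointwise)

lemma hw3_is_joint_hw: "is_joint_hw 3 (0, 3 / 2, 3 / 2, True) hw3"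
proof -
  have "hw3 (mon 0 0 0 1 1 1) \<noteq> 0" by (simp add: hw3_def pointwise gmult_def one_poly_def)
  then have "hw3 \<noteq> 0" by (auto simp: pointwise)
  moreover have "gmult g (gmult h (gmult k one_poly)) \<in> S_deg 3" for g h k
    using S_deg_gmult[OF S_deg_gmult[OF S_deg_gmult[OF S_deg_one]], of g h k] by (simp add: numeral_3_eq_3)
  then have "hw3 \<in> S_deg 3"
    using subspace_S_deg[of 3] by (simp add: hw3_def cfun.subspace_add cfun.subspace_diff)
  moreover have "D12 hw3 = 0" "D22 hw3 = 0" "F12 hw3 = 0" "e_op hw3 = 0" "h_op hw3 = 0" "F22 hw3 = cscale (3 / 2) hw3"
    by (simp_all add: hw3_def op_defs normal_order two_mult_fun) (simp_all add: pointwise algebra_simps)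
  moreover have "hom_part odd_monomial True hw3 = hw3"
    unfolding hw3_def hom_part_add hom_part_diff
    by (intro arg_cong2[of _ _ _ _ "(+)"] arg_cong2[of _ _ _ _ "(-)"] hom_part_gmultI) (simp_all add: hom_part_one)
  ultimately show ?thesis by (simp add: is_joint_hw_def S_inv_def)
qed

text \<open>Two applications of f move one x1 to x2 up to sign, and a single one turns x1 into eta3
  up to sign; so this monomial has the weight of f^k x1^n. With k = 2 j + t it runs through all x1^i
  x2^j eta3^t of degree n.\<close>

definition mo1 :: "nat \<Rightarrow> nat \<Rightarrow> gen \<Rightarrow> nat" where
  "mo1 n k = mon (n - k div 2 - k mod 2) (k div 2) 0 0 0 (k mod 2)"

definition mo2 :: "nat \<Rightarrow> nat \<Rightarrow> gen \<Rightarrow> nat" where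
  "mo2 n k = mon (n - k div 2 - k mod 2) (k div 2) 1 0 0 (k mod 2)"

lemma mo_weight:
  assumes "k \<le> 2 * n"
  shows "of_nat (n - k div 2 - k mod 2) - of_nat (k div 2) = (of_nat n - of_nat k :: complex)"
proof -
  have "k div 2 + k mod 2 \<le> n" using assms by presburger
  moreover have "(of_nat k :: complex) = 2 * of_nat (k div 2) + of_nat (k mod 2)"
    by (metis mult_div_mod_eq of_nat_add of_nat_mult of_nat_numeral)
  ultimately show ?thesis by (simp add: of_nat_diff)
qed

lemma S_inv_sep:
  assumes p: "p \<in> space (S_inv d)" "F12 p = 0"
    and m1: "\<And>k. k \<le> 2 * d \<Longrightarrow> p (mo1 d k) = 0"
    and m2: "\<And>k. d \<ge> 2 \<Longrightarrow> k \<le> 2 * (d - 1) \<Longrightarrow> p (mo2 (d - 1) k) = 0"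
    and m3: "d = 3 \<Longrightarrow> p (mon 0 0 0 1 1 1) = 0"
  shows "p = 0"
proof (rule F12_kernel_zero)
  have S: "p \<in> S_deg d" and D: "D12 p = 0" "D22 p = 0" using p(1) by (simp_all add: S_inv_def)
  then show "p \<in> S_all" "F12 p = 0" "D12 p = 0" "D22 p = 0" using S_deg_subset_S_all p(2) by auto
  have deg: "p m = 0" if "total_degree m \<noteq> d" for m using S that by (auto simp: S_deg_def)
  show "p (mon i j 0 0 0 t) = 0" if "t \<le> 1" for i j t
  proof (cases "i + j + t = d")
    case True
    have "(2 * j + t) div 2 = j" "(2 * j + t) mod 2 = t" using that by auto
    then have "mo1 d (2 * j + t) = mon i j 0 0 0 t" using True by (auto simp: mo1_def)
    then show ?thesis using m1[of "2 * j + t"] True that by auto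
  next
    case False
    then show ?thesis by (intro deg) (simp add: total_degree_def)
  qed
  show "p (mon i j 1 0 0 t) = 0" if "t \<le> 1" for i j t
  proof (cases "i + j + 1 + t = d")
    case True
    show ?thesis
    proof (cases "d \<ge> 2")
      case True
      have "(2 * j + t) div 2 = j" "(2 * j + t) mod 2 = t" using that by auto
      then have "mo2 (d - 1) (2 * j + t) = mon i j 1 0 0 t" using \<open>i + j + 1 + t = d\<close> by (auto simp: mo2_def)
      then show ?thesis using m2[OF True, of "2 * j + t"] \<open>i + j + 1 + t = d\<close> that by auto
    next
      case False
      then have "i = 0" "j = 0" "t = 0" using True by auto
      \<comment> \<open>In degree 1 there is no second summand; the coefficient of p at x3 is that
        of F12 p at eta3.\<close>
      moreover have "F12 p (mon 0 0 0 0 0 1) = 0" using p(2) by (simp add: zero_fun_apply)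
      ultimately show ?thesis by (simp add: F12_def gmult_def pd_def pointwise)
    qed
  next
    case False
    then show ?thesis by (intro deg) (simp add: total_degree_def)
  qed
  show "p (mon 0 0 0 1 1 1) = 0"
    using m3 deg[of "mon 0 0 0 1 1 1"] by (cases "d = 3") (simp_all add: total_degree_def)
qed

section \<open>Parameters of the summands and the final comparison\<close>

definition S_inv_params :: "nat \<Rightarrow> params list" where
  "S_inv_params d = take (if d \<le> 1 then 1 else if d = 3 then 3 else 2)
     [(d, of_nat d + 1 / 2, - 1 / 2, False), (d - 1, of_nat d - 1 / 2, 1 / 2, False), (0, 3 / 2, 3 / 2, True)]"

lemma S_inv_basis: "\<exists>B. std_basis (S_inv d) (S_inv_params d) B"
proof (rule S_inv_std_basis[where q = "\<lambda>j. [hw1 d, hw2 d, hw3] ! j"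
      and mo = "\<lambda>j. [mo1 d, mo2 (d - 1), \<lambda>k. mon 0 0 0 1 1 1] ! j"])
  let ?q = "\<lambda>j. [hw1 d, hw2 d, hw3] ! j" and ?mo = "\<lambda>j. [mo1 d, mo2 (d - 1), \<lambda>k. mon 0 0 0 1 1 1] ! j"
  let ?ps = "S_inv_params d"
  have cases: "(j = 0 \<and> ?ps ! j = (d, of_nat d + 1 / 2, - 1 / 2, False))
    \<or> (j = 1 \<and> d \<ge> 2 \<and> ?ps ! j = (d - 1, of_nat d - 1 / 2, 1 / 2, False))
    \<or> (j = 2 \<and> d = 3 \<and> ?ps ! j = (0, 3 / 2, 3 / 2, True))" if "j < length ?ps" for j
  proof -
    have "j = 0 \<or> (j = 1 \<and> d \<ge> 2) \<or> (j = 2 \<and> d = 3)"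
      using that by (auto simp: S_inv_params_def split: if_splits)
    then show ?thesis by (auto simp: S_inv_params_def)
  qed
  {
    fix j a b c s assume j: "j < length ?ps" "?ps ! j = (a, b, c, s)"
    have "is_joint_hw d (?ps ! j) (?q j)"
      using cases[OF j(1)]
    proof (elim disjE conjE)
      assume "j = 2" "d = 3" "?ps ! j = (0, 3 / 2, 3 / 2, True)"
      then show ?thesis using hw3_is_joint_hw by (simp add: numeral_2_eq_2)
    qed (use hw1_is_joint_hw hw2_is_joint_hw in simp_all)
    then show "?q j \<in> space (S_inv d) \<and> ?q j \<noteq> 0 \<and> F12 (?q j) = 0 \<and> e_op (?q j) = 0 \<and>
        h_op (?q j) = cscale (of_nat a) (?q j) \<and> F22 (?q j) = cscale c (?q j) \<and>
        hom_part odd_monomial s (?q j) = ?q j \<and> b + c = of_nat d"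
      unfolding j(2) by (simp add: is_joint_hw_def)
    fix k assume k: "k \<le> 2 * a"
    show "of_nat (?mo j k X1) + of_nat (?mo j k Eta1) - of_nat (?mo j k X2) - of_nat (?mo j k Eta2)
        = of_nat a - (of_nat k :: complex) \<and>
      of_nat (?mo j k Eta1 + ?mo j k Eta2 + ?mo j k X3) - 1 / 2 = c"
      using cases[OF j(1)]
    proof (elim disjE conjE)
      assume "j = 0" "?ps ! j = (d, of_nat d + 1 / 2, - 1 / 2, False)"
      then show ?thesis using j(2) k mo_weight[of k d] by (simp add: mo1_def)
    next
      assume "j = 1" "?ps ! j = (d - 1, of_nat d - 1 / 2, 1 / 2, False)"
      then show ?thesis using j(2) k mo_weight[of k "d - 1"] by (simp add: mo2_def)
    next
      assume "j = 2" "?ps ! j = (0, 3 / 2, 3 / 2, True)"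
      then show ?thesis using j(2) k by (simp add: numeral_2_eq_2)
    qed
  }
  show "distinct (map (\<lambda>(a, b, c, s). c) ?ps)"
    by (simp add: S_inv_params_def)
  show "p = 0" if p: "p \<in> space (S_inv d)" "F12 p = 0"
    and c: "\<And>j k. j < length ?ps \<Longrightarrow> k \<le> 2 * fst (?ps ! j) \<Longrightarrow> p (?mo j k) = 0" for p
  proof (rule S_inv_sep[OF p])
    show "p (mo1 d k) = 0" if "k \<le> 2 * d" for k using c[of 0 k] that by (simp add: S_inv_params_def)
    show "p (mo2 (d - 1) k) = 0" if "d \<ge> 2" "k \<le> 2 * (d - 1)" for k
      using c[of 1 k] that by (simp add: S_inv_params_def)
    show "p (mon 0 0 0 1 1 1) = 0" if "d = 3" using c[of 2 0] that by (simp add: S_inv_params_def)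
  qed
qed

text \<open>The parities of the highest weight vectors of \<open>V\<close> and \<open>W\<close> are
  unknown; the shift is chosen to give the tensor product the prescribed parity
  \<open>t\<close>.\<close>

lemma std_basis_irr_tensor:
  assumes "irr_spo21 V (of_nat a)" "irr_gl11 W b c"
  shows "\<exists>s B. std_basis (parity_shift s (V \<otimes> W)) [(a, b, c, t)] B"
proof -
  obtain r r' v w where "spo_basis V a r v" "gl_basis W b c r' w"
    using irr_spo21_basis[OF assms(1)] irr_gl11_basis[OF assms(2)] by blast
  then obtain B where "std_basis (V \<otimes> W) [(a, b, c, r \<noteq> r')] B" using std_basis_tensor by blast
  then have "std_basis (parity_shift ((r \<noteq> r') \<noteq> t) (V \<otimes> W)) [(a, b, c, (r \<noteq> r') \<noteq> ((r \<noteq> r') \<noteq> t))] B"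
    by (rule std_basis_parity_shift)
  moreover have "((r \<noteq> r') \<noteq> ((r \<noteq> r') \<noteq> t)) = t" by auto
  ultimately have "std_basis (parity_shift ((r \<noteq> r') \<noteq> t) (V \<otimes> W)) [(a, b, c, t)] B" by simp
  then show ?thesis by blast
qed

text \<open>The first two conjuncts show that families \<open>V\<close> and \<open>W\<close> as in
  the third do exist, so that the decompositions are not vacuous. For any such families both sides
  have bases with the same parameters.\<close>

theorem theorem1p5:
  shows "(\<forall>a::nat. \<exists>M :: (complex^3^3, nat) super_module. irr_spo21 M (of_nat a)) \<and>
    (\<forall>b c. \<exists>M :: (complex^2^2, nat) super_module. irr_gl11 M b c) \<and>
    (\<forall>(V :: nat \<Rightarrow> (complex^3^3, 'i) super_module)
      (W :: complex \<Rightarrow> complex \<Rightarrow> (complex^2^2, 'j) super_module).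
      (\<forall>a. irr_spo21 (V a) (of_nat a)) \<and> (\<forall>b c. irr_gl11 (W b c) b c) \<longrightarrow>
      (\<forall>d\<ge>4. \<exists>s t. S_inv d \<cong>
         parity_shift s (V d \<otimes> W (of_nat d + 1/2) (-1/2)) \<oplus>
         parity_shift t (V (d - 1) \<otimes> W (of_nat d - 1/2) (1/2))) \<and>
      (\<exists>s. S_inv 0 \<cong> parity_shift s (V 0 \<otimes> W (1/2) (-1/2))) \<and>
      (\<exists>s. S_inv 1 \<cong> parity_shift s (V 1 \<otimes> W (3/2) (-1/2))) \<and>
      (\<exists>s t. S_inv 2 \<cong>
         parity_shift s (V 2 \<otimes> W (5/2) (-1/2)) \<oplus>
         parity_shift t (V 1 \<otimes> W (3/2) (1/2))) \<and>
      (\<exists>s t r. S_inv 3 \<cong>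
         parity_shift s (V 3 \<otimes> W (7/2) (-1/2)) \<oplus>
         parity_shift t (V 2 \<otimes> W (5/2) (1/2)) \<oplus>
         parity_shift r (V 0 \<otimes> W (3/2) (3/2))))"
proof (intro conjI allI impI)
  show "\<exists>M :: (complex^3^3, nat) super_module. irr_spo21 M (of_nat a)" for a by (rule irr_spo21_exists)
  show "\<exists>M :: (complex^2^2, nat) super_module. irr_gl11 M b c" for b c by (rule irr_gl11_exists)
next
  fix V :: "nat \<Rightarrow> (complex^3^3, 'i) super_module" and W :: "complex \<Rightarrow> complex \<Rightarrow> (complex^2^2, 'j) super_module"
  assume VW: "(\<forall>a. irr_spo21 (V a) (of_nat a)) \<and> (\<forall>b c. irr_gl11 (W b c) b c)"
  have piece: "\<exists>s B. std_basis (parity_shift s (V a \<otimes> W b c)) [(a, b, c, t)] B" for a b c t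
    using VW by (intro std_basis_irr_tensor) auto
  \<comment> \<open>The parameter lists for d = 2 and for all d >= 4 have the same shape.\<close>
  have two: "\<exists>s t. S_inv d \<cong> parity_shift s (V d \<otimes> W (of_nat d + 1/2) (-1/2)) \<oplus>
      parity_shift t (V (d - 1) \<otimes> W (of_nat d - 1/2) (1/2))" if "d \<ge> 2" "d \<noteq> 3" for d
  proof -
    have "S_inv_params d = [(d, of_nat d + 1 / 2, - 1 / 2, False), (d - 1, of_nat d - 1 / 2, 1 / 2, False)]"
      using that by (simp add: S_inv_params_def)
    then obtain B where "std_basis (S_inv d) [(d, of_nat d + 1 / 2, - 1 / 2, False), (d - 1, of_nat d - 1 / 2, 1 / 2, False)] B"
      using S_inv_basis[of d] by auto
    moreover obtain s B1 where "std_basis (parity_shift s (V d \<otimes> W (of_nat d + 1/2) (-1/2))) [(d, of_nat d + 1 / 2, - 1 / 2, False)] B1"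
      using piece by blast
    moreover obtain t B2 where "std_basis (parity_shift t (V (d - 1) \<otimes> W (of_nat d - 1/2) (1/2))) [(d - 1, of_nat d - 1 / 2, 1 / 2, False)] B2"
      using piece by blast
    ultimately show ?thesis using std_basis_direct_sum std_basis_iso by blast
  qed
  show "\<exists>s t. S_inv d \<cong> parity_shift s (V d \<otimes> W (of_nat d + 1/2) (-1/2)) \<oplus>
      parity_shift t (V (d - 1) \<otimes> W (of_nat d - 1/2) (1/2))" if "d \<ge> 4" for d
    using two[of d] that by simp
  show "\<exists>s t. S_inv 2 \<cong> parity_shift s (V 2 \<otimes> W (5/2) (-1/2)) \<oplus> parity_shift t (V 1 \<otimes> W (3/2) (1/2))"
    using two[of 2] by simp
  show "\<exists>s. S_inv 0 \<cong> parity_shift s (V 0 \<otimes> W (1/2) (-1/2))"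
  proof -
    obtain B where "std_basis (S_inv 0) [(0, 1 / 2, - 1 / 2, False)] B"
      using S_inv_basis[of 0] by (auto simp: S_inv_params_def)
    then show ?thesis using piece[of 0 "1 / 2" "- 1 / 2" False] std_basis_iso by blast
  qed
  show "\<exists>s. S_inv 1 \<cong> parity_shift s (V 1 \<otimes> W (3/2) (-1/2))"
  proof -
    obtain B where "std_basis (S_inv 1) [(1, 3 / 2, - 1 / 2, False)] B"
      using S_inv_basis[of 1] by (auto simp: S_inv_params_def)
    then show ?thesis using piece[of 1 "3 / 2" "- 1 / 2" False] std_basis_iso by blast
  qed
  show "\<exists>s t r. S_inv 3 \<cong> parity_shift s (V 3 \<otimes> W (7/2) (-1/2)) \<oplus>
      parity_shift t (V 2 \<otimes> W (5/2) (1/2)) \<oplus> parity_shift r (V 0 \<otimes> W (3/2) (3/2))"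
  proof -
    obtain B where "std_basis (S_inv 3) [(3, 7 / 2, - 1 / 2, False), (2, 5 / 2, 1 / 2, False), (0, 3 / 2, 3 / 2, True)] B"
      using S_inv_basis[of 3] by (auto simp: S_inv_params_def)
    moreover obtain s B1 where "std_basis (parity_shift s (V 3 \<otimes> W (7/2) (-1/2))) [(3, 7 / 2, - 1 / 2, False)] B1"
      using piece by blast
    moreover obtain t B2 where "std_basis (parity_shift t (V 2 \<otimes> W (5/2) (1/2))) [(2, 5 / 2, 1 / 2, False)] B2"
      using piece by blast
    moreover obtain r B3 where "std_basis (parity_shift r (V 0 \<otimes> W (3/2) (3/2))) [(0, 3 / 2, 3 / 2, True)] B3"
      using piece by blast
    \<comment> \<open>The sum nests to the right, so the last two summands are joined first.\<close>
    moreover obtain C where "std_basis (parity_shift t (V 2 \<otimes> W (5/2) (1/2)) \<oplus> parity_shift r (V 0 \<otimes> W (3/2) (3/2)))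
        [(2, 5 / 2, 1 / 2, False), (0, 3 / 2, 3 / 2, True)] C"
      using std_basis_direct_sum calculation(3,4) by blast
    ultimately show ?thesis using std_basis_direct_sum std_basis_iso by blast
  qed
qed

end
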